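(* Let $N\ge3$ be an integer, $\frac{2}{N-2}<\alpha<\frac4{N-2}$, and $\beta=\frac2\alpha\bigl(N-2-\frac2\alpha\bigr)>0$. Let $u\in C^2(0,\infty)$, $u\not\equiv0$, be a solution of $$u''+\frac{N-1}{r}u'+|u|^\alpha u=0\quad\text{on }(0,\infty).\tag{1}$$ Then the following properties hold. (i) There is a constant $C$ such that $|u(r)|\le Cr^{-(N-2-\frac2\alpha)}$ for $r>1$. In addition, either $u(r)$ has a finite limit as $r\to0$, or else $r^{\frac2\alpha}u(r)\to\pm\beta^{\frac1\alpha}$ as $r\to0$. In the first case, $u'(r)\to0$ as $r\to0$, and in the second case $r^{\frac2\alpha+1}u'(r)\to\mp\frac2\alpha\beta^{\frac1\alpha}$ as $r\to0$. (ii) $u$ satisfies one of the following properties. (a) $u$ is a regular solution of (1), i.e. $u\in C^2([0,\infty))$ and $u'(0)=0$. In this case, $u$ oscillates indefinitely as $r\to\infty$. (b) $u$ is a constant-sign, singular solution of (1), i.e. either $u=\pm\beta^{\frac1\alpha}r^{-\frac2\alpha}$ or else $u=\pm u_\lambda$ for some $\lambda>0$. (c) $u$ is a singular, sign-changing solution. In this case, $r^{\frac2\alpha}u(r)\to\pm\beta^{\frac1\alpha}$ as $r\to0$, and $u$ oscillates indefinitely as $r\to\infty$. (iii) $u$ satisfies (c) if and only if there exists $r_0>0$ such that $$\frac{r_0^2}{2}|u'(r_0)|^2+\frac2\alpha r_0u(r_0)u'(r_0)+\frac1{\alpha+2}r_0^2|u(r_0)|^{\alpha+2}+\frac{4-(N-2)\alpha}{\alpha^2}|u(r_0)|^2=0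 .$$ (iv) Let $U\in C^2(\mathbb{R}^N\setminus\{0\})$ be defined by $U(x)=u(|x|)$ for $x\neq0$. Then $U\in L^{\alpha+1}_{\mathrm{loc}}(\mathbb{R}^N)$ and $U$ is a solution of $-\Delta U=|U|^\alpha U$ in $\mathcal{D}'(\mathbb{R}^N)$.
   Context: All functions are real-valued. The family $(u_\lambda)_{\lambda>0}\subset C^2(0,\infty)$ is the known one-parameter family of positive singular solutions of (1): for each $\lambda>0$, $u_\lambda$ is the positive solution of $u''+\frac{N-1}{r}u'+|u|^\alpha u=0$ on $(0,\infty)$ satisfying $r^{\frac2\alpha}u_\lambda(r)\to\beta^{\frac1\alpha}$ as $r\to0$ and $r^{N-2}u_\lambda(r)\to\lambda$ as $r\to\infty$. (It is known, by Serrin and Zou, that together with $\beta^{\frac1\alpha}r^{-\frac2\alpha}$ these are all the positive solutions of (1) on $(0,\infty)$.) "Singular" means that $u$ has no finite limit as $r\to0$. "Oscillates indefinitely as $r\to\infty$" means that $u$ changes sign on $(R,\infty)$ for every $R>0$. In statements with $\pm$ and $\mp$, the upper signs correspond to each other, as do the lower signs. *)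

theory Defs
  imports "HOL-Analysis.Analysis"
begin

section \<open>Radial solutions of the Lane--Emden equation\<close>

text \<open>
  Functions on \<open>(0,\<infinity>)\<close> are functions \<open>real \<Rightarrow> real\<close>; their values on \<open>(-\<infinity>,0]\<close> play no role.
  In the next definition derivatives are taken within \<open>S\<close>, hence are one-sided at an end
  point of an interval \<open>S\<close> that belongs to \<open>S\<close>.
\<close>

definition C2_on :: "real set \<Rightarrow> (real \<Rightarrow> real) \<Rightarrow> bool" where
  "C2_on S f \<longleftrightarrow> (\<exists>f' f''.
     (\<forall>x\<in>S. (f has_real_derivative f' x) (at x within S)) \<and>
     (\<forall>x\<in>S. (f' has_real_derivative f'' x) (at x within S)) \<and>
     continuous_on S f'')"

definition radial_solution :: "nat \<Rightarrow> real \<Rightarrow> (real \<Rightarrow> real) \<Rightarrow> bool" where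
  "radial_solution N \<alpha> u \<longleftrightarrow> C2_on {0<..} u \<and>
     (\<forall>r>0. deriv (deriv u) r + (real N - 1) / r * deriv u r + \<bar>u r\<bar> powr \<alpha> * u r = 0)"

definition beta :: "nat \<Rightarrow> real \<Rightarrow> real" where
  "beta N \<alpha> = 2 / \<alpha> * (real N - 2 - 2 / \<alpha>)"

text \<open>
  \<open>u \<in> C\<^sup>2([0,\<infinity>))\<close> and \<open>u'(0) = 0\<close>: as \<open>u\<close> is only given on \<open>(0,\<infinity>)\<close>, this means that it
  has an extension \<open>v\<close> with these properties.
\<close>

definition regular :: "(real \<Rightarrow> real) \<Rightarrow> bool" where
  "regular u \<longleftrightarrow> (\<exists>v. (\<forall>r>0. v r = u r) \<and> C2_on {0..} v \<and>
     (v has_real_derivative 0) (at 0 within {0..}))"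

definition finite_limit_at_0 :: "(real \<Rightarrow> real) \<Rightarrow> bool" where
  "finite_limit_at_0 u \<longleftrightarrow> (\<exists>l. (u \<longlongrightarrow> l) (at_right 0))"

definition singular :: "(real \<Rightarrow> real) \<Rightarrow> bool" where
  "singular u \<longleftrightarrow> \<not> finite_limit_at_0 u"

definition constant_sign :: "(real \<Rightarrow> real) \<Rightarrow> bool" where
  "constant_sign u \<longleftrightarrow> (\<forall>r>0. u r > 0) \<or> (\<forall>r>0. u r < 0)"

definition changes_sign_on :: "real set \<Rightarrow> (real \<Rightarrow> real) \<Rightarrow> bool" where
  "changes_sign_on S u \<longleftrightarrow> (\<exists>r\<in>S. u r > 0) \<and> (\<exists>s\<in>S. u s < 0)"

definition oscillates_at_infinity :: "(real \<Rightarrow> real) \<Rightarrow> bool" where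
  "oscillates_at_infinity u \<longleftrightarrow> (\<forall>R>0. changes_sign_on {R<..} u)"

definition u_lambda_spec :: "nat \<Rightarrow> real \<Rightarrow> real \<Rightarrow> (real \<Rightarrow> real) \<Rightarrow> bool" where
  "u_lambda_spec N \<alpha> \<mu> v \<longleftrightarrow> radial_solution N \<alpha> v \<and> (\<forall>r>0. v r > 0) \<and>
     ((\<lambda>r. r powr (2 / \<alpha>) * v r) \<longlongrightarrow> beta N \<alpha> powr (1 / \<alpha>)) (at_right 0) \<and>
     ((\<lambda>r. r powr (real N - 2) * v r) \<longlongrightarrow> \<mu>) at_top"

text \<open>
  The parameter is called \<open>\<mu>\<close>, as \<open>\<lambda>\<close> is reserved for abstraction;
  \<open>v = u\<^sub>\<mu>\<close>, where \<open>u\<^sub>\<mu>\<close> is \<^emph>\<open>the\<close> function with the above property. The definite description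
  is spelled out, uniqueness included, instead of using \<open>THE\<close>, since the property determines
  a function on \<open>(0,\<infinity>)\<close> only.
\<close>

definition is_u_lambda :: "nat \<Rightarrow> real \<Rightarrow> real \<Rightarrow> (real \<Rightarrow> real) \<Rightarrow> bool" where
  "is_u_lambda N \<alpha> \<mu> v \<longleftrightarrow> u_lambda_spec N \<alpha> \<mu> v \<and>
     (\<forall>w. u_lambda_spec N \<alpha> \<mu> w \<longrightarrow> (\<forall>r>0. w r = v r))"

section \<open>Smooth functions and distributions\<close>

definition partial_deriv :: "'a::euclidean_space \<Rightarrow> ('a \<Rightarrow> real) \<Rightarrow> 'a \<Rightarrow> real" where
  "partial_deriv b f x = frechet_derivative f (at x) b"

text \<open>\<open>f\<close> is of class \<open>C\<^sup>k\<close> on the set \<open>S\<close>, which is meant to be open.\<close>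

fun Ck_on :: "nat \<Rightarrow> 'a::euclidean_space set \<Rightarrow> ('a \<Rightarrow> real) \<Rightarrow> bool" where
  "Ck_on 0 S f \<longleftrightarrow> continuous_on S f"
| "Ck_on (Suc k) S f \<longleftrightarrow>
     (\<forall>x\<in>S. f differentiable at x) \<and> (\<forall>b\<in>Basis. Ck_on k S (partial_deriv b f))"

definition test_function :: "('a::euclidean_space \<Rightarrow> real) \<Rightarrow> bool" where
  "test_function \<phi> \<longleftrightarrow> (\<forall>k. Ck_on k UNIV \<phi>) \<and> compact (closure {x. \<phi> x \<noteq> 0})"

definition laplacian :: "('a::euclidean_space \<Rightarrow> real) \<Rightarrow> 'a \<Rightarrow> real" where
  "laplacian f x = (\<Sum>b\<in>Basis. partial_deriv b (partial_deriv b f) x)"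

definition Lp_loc :: "real \<Rightarrow> ('a::euclidean_space \<Rightarrow> real) \<Rightarrow> bool" where
  "Lp_loc p f \<longleftrightarrow> f \<in> borel_measurable lebesgue \<and>
     (\<forall>K. compact K \<longrightarrow> set_integrable lebesgue K (\<lambda>x. \<bar>f x\<bar> powr p))"

text \<open>
  \<open>-\<Delta>f = g\<close> in \<open>\<D>'\<close>. Local integrability of \<open>f\<close> and \<open>g\<close> is required, so that both are
  distributions and the integrals below are genuine.
\<close>

definition minus_laplacian_distr ::
  "('a::euclidean_space \<Rightarrow> real) \<Rightarrow> ('a \<Rightarrow> real) \<Rightarrow> bool" where
  "minus_laplacian_distr f g \<longleftrightarrow> Lp_loc 1 f \<and> Lp_loc 1 g \<and>
     (\<forall>\<phi>. test_function \<phi> \<longrightarrow>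
        (LINT x|lebesgue. f x * (- laplacian \<phi> x)) = (LINT x|lebesgue. g x * \<phi> x))"

end

theory Submission
  imports Defs
begin

text \<open>
  In the variable \<open>t = ln r\<close> the rescaled solution \<open>w t = r\<^bsup>2/\<alpha>\<^esup> u r\<close> satisfies the autonomous
  equation \<open>w'' = (\<kappa> - \<gamma>) w' + \<kappa> \<gamma> w - |w|\<^bsup>\<alpha>\<^esup> w\<close> with \<open>\<kappa> = 2/\<alpha>\<close> and \<open>\<gamma> = N - 2 - 2/\<alpha>\<close>.
  The two bounds on \<open>\<alpha>\<close> say precisely that \<open>0 < \<gamma> < \<kappa>\<close>. Hence \<open>\<beta> = \<kappa> \<gamma>\<close> is positive, the
  equilibria are \<open>0\<close> (a saddle with exponents \<open>\<kappa>\<close> and \<open>- \<gamma>\<close>) and \<open>\<plusminus> k\<close> with \<open>k\<^bsup>\<alpha>\<^esup> = \<beta>\<close>, and the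
  damping is negative: the energy
  \<open>E = w'\<^sup>2/2 - \<beta> w\<^sup>2/2 + |w|\<^bsup>\<alpha>+2\<^esup>/(\<alpha>+2)\<close> has derivative \<open>(\<kappa> - \<gamma>) w'\<^sup>2 \<ge> 0\<close>. Up to the factor
  \<open>r\<^bsup>4/\<alpha>\<^esup>\<close>, this energy is the expression in part (iii) (lemma \<open>energy_ln\<close>).

  As \<open>E\<close> is coercive and nondecreasing, the orbit is bounded for \<open>t \<le> 0\<close> and converges to an
  equilibrium as \<open>t \<rightarrow> -\<infinity>\<close> (\<open>tendsto_at_bot\<close>); Gronwall's inequality for \<open>E\<close> gives the bound at infinity
  (\<open>exponential_growth_bound\<close>). If the limit is \<open>0\<close>, the orbit leaves along the unstable manifold,
  \<open>w\<close> is asymptotic to a multiple of \<open>e\<^bsup>\<kappa>t\<^esup>\<close>, so that \<open>u\<close> has a finite limit and is regular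
  (\<open>vanishing_asymptotics\<close>, \<open>regular_iff\<close>), and \<open>E > 0\<close> throughout. If the limit is \<open>\<plusminus> k\<close>, then \<open>u\<close> is
  singular and \<open>E\<close> is negative near \<open>-\<infinity>\<close>.

  The sign of \<open>E\<close> decides about oscillation. Where \<open>w = 0\<close> the energy is nonnegative, so a solution
  with \<open>E < 0\<close> throughout has constant sign. Conversely, a solution that is eventually positive is bounded and
  converges to \<open>0\<close> or \<open>k\<close>, where the energy is at most \<open>0\<close> (\<open>positive_imp_bounded\<close>,
  \<open>positive_imp_tendsto\<close>); so \<open>E > 0\<close> at one point forces oscillation. A singular solution therefore
  changes sign if and only if \<open>E\<close> vanishes somewhere. A singular solution of constant sign either is the
  equilibrium \<open>\<plusminus> k\<close>, which is the explicit power, or it connects \<open>\<plusminus> k\<close> to \<open>0\<close> and decays like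
  \<open>\<mu> e\<^bsup>-\<gamma>t\<^esup>\<close> (\<open>stable_manifold_asymptotics\<close>); the number \<open>\<mu>\<close> determines it
  (\<open>fast_decay_unique\<close>), so it is \<open>u\<^sub>\<mu>\<close>.

  For part (iv), \<open>|u|\<close>, \<open>r |u'|\<close> and \<open>r\<^sup>2 |u|\<^bsup>\<alpha>+1\<^esup>\<close> are \<open>O(r\<^bsup>-2/\<alpha>\<^esup>)\<close> near \<open>0\<close>, and \<open>2 + 2/\<alpha> < N\<close>. So all
  terms of Green's identity, cut off near the origin, are dominated by a multiple of the integrable function
  \<open>|x|\<^bsup>-2-2/\<alpha>\<^esup>\<close>, and no contribution of the origin survives in the limit (\<open>green_punctured\<close>).
\<close>

section \<open>Calculus on the line\<close>

lemma has_real_derivative_abs: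
  fixes x :: real
  assumes "x \<noteq> 0"
  shows "(abs has_real_derivative sgn x) (at x)"
proof (cases "x > 0")
  case True
  have "((\<lambda>x. x) has_real_derivative sgn x) (at x)" using True by simp
  then show ?thesis
    by (rule has_field_derivative_transform_within_open[of _ _ _ "{0<..}"]) (use True in auto)
next
  case False
  have "((\<lambda>x. - x) has_real_derivative sgn x) (at x)"
    using False assms by (auto intro!: derivative_eq_intros)
  then show ?thesis
    by (rule has_field_derivative_transform_within_open[of _ _ _ "{..<0}"])
      (use False assms in auto)
qed

lemma has_real_derivative_abs_powr_mult:
  fixes a x :: real
  assumes "0 < a"
  shows "((\<lambda>x. \<bar>x\<bar> powr a * x) has_real_derivative (a + 1) * \<bar>x\<bar> powr a) (at x)"
proof (cases "x = 0")
  case True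
  have "((\<lambda>h. \<bar>h\<bar> powr a) \<longlongrightarrow> \<bar>0\<bar> powr a) (at (0::real))"
    using assms by (intro tendsto_powr' tendsto_rabs tendsto_ident_at tendsto_const) auto
  moreover have "eventually (\<lambda>h. \<bar>h\<bar> powr a = (\<bar>h\<bar> powr a * h - 0) / h) (at (0::real))"
    by (auto simp: eventually_at_filter)
  ultimately have "((\<lambda>h. (\<bar>h\<bar> powr a * h - 0) / h) \<longlongrightarrow> 0) (at (0::real))"
    using assms by (auto elim: Lim_transform_eventually)
  then show ?thesis
    using True by (simp add: DERIV_def)
next
  case False
  have "((\<lambda>x. \<bar>x\<bar> powr a * x) has_real_derivative
      (a * \<bar>x\<bar> powr (a - 1) * sgn x) * x + \<bar>x\<bar> powr a) (at x)"
    using False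
    by (auto intro!: derivative_eq_intros DERIV_chain'[OF has_real_derivative_abs] simp: algebra_simps)
  moreover have "(a * \<bar>x\<bar> powr (a - 1) * sgn x) * x + \<bar>x\<bar> powr a = (a + 1) * \<bar>x\<bar> powr a"
    using False by (simp add: powr_diff sgn_if abs_if field_simps)
  ultimately show ?thesis by simp
qed

lemma has_real_derivative_abs_powr_add_2:
  fixes a x :: real
  assumes "0 < a"
  shows "((\<lambda>x. \<bar>x\<bar> powr (a + 2)) has_real_derivative (a + 2) * (\<bar>x\<bar> powr a * x)) (at x)"
proof -
  have "\<bar>x\<bar> powr (a + 2) = (\<bar>x\<bar> powr a * x) * x" for x :: real
    by (cases "x = 0") (auto simp: powr_add power2_eq_square)
  moreover have "((\<lambda>x. (\<bar>x\<bar> powr a * x) * x) has_real_derivative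
      (a + 1) * \<bar>x\<bar> powr a * x + 1 * (\<bar>x\<bar> powr a * x)) (at x)"
    by (rule DERIV_mult[OF has_real_derivative_abs_powr_mult[OF assms] DERIV_ident])
  ultimately show ?thesis
    by (simp add: algebra_simps)
qed

lemma abs_powr_add_2:
  fixes a x :: real
  shows "\<bar>x\<bar> powr (a + 2) = \<bar>x\<bar> powr a * x\<^sup>2"
  by (cases "x = 0") (auto simp: powr_add power2_eq_square)

lemma gronwall:
  fixes g g' :: "real \<Rightarrow> real"
  assumes "\<And>t. t \<in> {a..b} \<Longrightarrow> (g has_real_derivative g' t) (at t)"
    and "\<And>t. t \<in> {a..b} \<Longrightarrow> g' t \<le> L * g t"
    and "a \<le> b"
  shows "g b \<le> g a * exp (L * (b - a))"
proof -
  have "exp (- L * b) * g b \<le> exp (- L * a) * g a"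
  proof (rule deriv_nonpos_imp_antimono[OF _ _ \<open>a \<le> b\<close>])
    fix t assume t: "t \<in> {a..b}"
    show "((\<lambda>t. exp (- L * t) * g t) has_real_derivative exp (- L * t) * (g' t - L * g t)) (at t)"
      by (auto intro!: derivative_eq_intros assms(1)[OF t] simp: algebra_simps)
    show "exp (- L * t) * (g' t - L * g t) \<le> 0"
      using assms(2)[OF t] by (simp add: mult_le_0_iff)
  qed
  then have "exp (L * b) * (exp (- L * b) * g b) \<le> exp (L * b) * (exp (- L * a) * g a)"
    by (rule mult_left_mono) simp
  moreover have "exp (L * b) * (exp (- L * b) * g b) = g b"
    by (simp add: mult.assoc[symmetric] exp_minus_inverse)
  moreover have "exp (L * b) * (exp (- L * a) * g a) = g a * exp (L * (b - a))"
    by (simp add: exp_diff exp_minus field_simps)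
  ultimately show ?thesis by metis
qed

lemma monotone_bounded_tendsto_at_top:
  fixes f :: "real \<Rightarrow> real"
  assumes "\<And>s t. T \<le> s \<Longrightarrow> s \<le> t \<Longrightarrow> f s \<le> f t" and "\<And>t. T \<le> t \<Longrightarrow> f t \<le> C"
  obtains l where "(f \<longlongrightarrow> l) at_top" "\<And>t. T \<le> t \<Longrightarrow> f t \<le> l"
proof -
  have bdd: "bdd_above (f ` {T..})"
    using assms(2) by (auto intro!: bdd_aboveI)
  have "(f \<longlongrightarrow> (SUP t\<in>{T..}. f t)) at_top"
  proof (rule increasing_tendsto)
    show "\<forall>\<^sub>F t in at_top. f t \<le> (SUP t\<in>{T..}. f t)"
      using eventually_ge_at_top[of T] by eventually_elim (auto intro: cSUP_upper bdd)
    fix x assume "x < (SUP t\<in>{T..}. f t)"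
    then obtain s where s: "s \<ge> T" "x < f s"
      using less_cSUP_iff[OF _ bdd] by auto
    show "\<forall>\<^sub>F t in at_top. x < f t"
      using eventually_ge_at_top[of s] by eventually_elim (use s assms(1) in fastforce)
  qed
  then show thesis
    by (rule that) (auto intro: cSUP_upper bdd)
qed

text \<open>
  If \<open>f'\<close> were large at some \<open>t\<close>, the bound on \<open>f''\<close> would keep it large on an interval whose length is
  independent of \<open>t\<close>, and \<open>f\<close> would not settle down.
\<close>

lemma barbalat:
  fixes f f' f'' :: "real \<Rightarrow> real"
  assumes f: "\<And>t. t \<ge> T \<Longrightarrow> (f has_real_derivative f' t) (at t)"
    and f': "\<And>t. t \<ge> T \<Longrightarrow> (f' has_real_derivative f'' t) (at t)"
    and bound: "\<And>t. t \<ge> T \<Longrightarrow> \<bar>f'' t\<bar> \<le> M"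
    and lim: "(f \<longlongrightarrow> l) at_top"
  shows "(f' \<longlongrightarrow> 0) at_top"
proof (rule tendstoI)
  fix e :: real assume e: "e > 0"
  have M: "0 \<le> M"
    using bound[of T] by (auto intro: order_trans[OF abs_ge_zero])
  \<comment> \<open>over a step of this length \<open>f'\<close> varies by less than \<open>e / 2\<close>\<close>
  define h where "h = e / (2 * (M + 1))"
  have h: "h > 0" "M * h < e / 2"
    using e M by (auto simp: h_def field_simps)
  have "\<forall>\<^sub>F t in at_top. dist (f t) l < h * e / 4"
    using lim h e by (intro tendstoD) auto
  then obtain S where S: "\<And>t. t \<ge> S \<Longrightarrow> dist (f t) l < h * e / 4"
    by (auto simp: eventually_at_top_linorder)
  show "\<forall>\<^sub>F t in at_top. dist (f' t) 0 < e"
    using eventually_ge_at_top[of "max S T"]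
  proof eventually_elim
    fix t assume t: "t \<ge> max S T"
    obtain x where x: "t < x" "x < t + h" "f (t + h) - f t = (t + h - t) * f' x"
      using MVT2[of t "t + h" f f'] f t h by auto
    obtain y where y: "t < y" "y < x" "f' x - f' t = (x - t) * f'' y"
      using MVT2[of t x f' f''] f' t x by auto
    have "\<bar>f (t + h) - f t\<bar> < h * e / 2"
      using S[of t] S[of "t + h"] t h unfolding dist_real_def by linarith
    then have "h * \<bar>f' x\<bar> < h * (e / 2)"
      using x h by (simp add: abs_mult)
    then have 1: "\<bar>f' x\<bar> < e / 2"
      using h by (simp only: mult_less_cancel_left_pos)
    have "\<bar>f' x - f' t\<bar> = (x - t) * \<bar>f'' y\<bar>"
      using y x by (simp add: abs_mult)
    also have "\<dots> \<le> h * M"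
      using x y t bound[of y] h by (intro mult_mono) auto
    finally show "dist (f' t) 0 < e"
      using 1 h by (simp add: dist_real_def mult.commute)
  qed
qed

text \<open>
  A continuous function whose limes inferior is smaller than its limes superior takes every value in
  between at arbitrarily large times. Each such value would be a root of \<open>g\<close>, so there would be
  infinitely many roots.
\<close>

lemma tendsto_root_if_finitely_many_roots:
  fixes f g :: "real \<Rightarrow> real"
  assumes f: "\<And>t. t \<ge> T \<Longrightarrow> isCont f t" and g: "\<And>x. isCont g x"
    and lim: "((\<lambda>t. g (f t)) \<longlongrightarrow> 0) at_top"
    and bound: "\<And>t. t \<ge> T \<Longrightarrow> \<bar>f t\<bar> \<le> M"
    and zeros: "finite {x. g x = 0}"
  obtains l where "g l = 0" "(f \<longlongrightarrow> l) at_top"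
proof -
  define A where "A = {c. \<exists>\<^sub>F t in at_top. f t > c}"
  have M: "A \<subseteq> {..M}"
  proof
    fix c assume "c \<in> A"
    then have "\<exists>\<^sub>F t in at_top. f t > c" by (simp add: A_def)
    then have "\<exists>\<^sub>F t in at_top. t \<ge> T \<and> f t > c"
      by (rule frequently_eventually_conj[OF _ eventually_ge_at_top[of T]])
    from frequently_ex[OF this] obtain t where "f t > c" "t \<ge> T" by blast
    then show "c \<in> {..M}" using bound[of t] by auto
  qed
  have ne: "-M - 1 \<in> A"
  proof -
    have "\<forall>\<^sub>F t in at_top. f t > -M - 1"
      using eventually_ge_at_top[of T] by eventually_elim (use bound in force)
    then have "\<exists>\<^sub>F t in at_top. f t > -M - 1"
      by (rule eventually_frequently[OF trivial_limit_at_top_linorder])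
    then show ?thesis by (simp add: A_def)
  qed
  have bdd: "bdd_above A" by (rule bdd_above_mono[OF bdd_above_Iic M])
  define l where "l = Sup A"
  have up: "\<forall>\<^sub>F t in at_top. f t < d" if "d > l" for d
  proof -
    obtain c where c: "l < c" "c < d" using \<open>d > l\<close> dense by blast
    then have "c \<notin> A" using cSup_upper[OF _ bdd, of c] by (auto simp: l_def)
    then have "\<forall>\<^sub>F t in at_top. \<not> f t > c" by (simp add: A_def frequently_def)
    then show ?thesis by eventually_elim (use c in auto)
  qed
  have freq: "\<exists>\<^sub>F t in at_top. f t > c" if "c < l" for c
  proof -
    obtain d where "d \<in> A" "c < d" using \<open>c < l\<close> less_cSup_iff[OF _ bdd] ne unfolding l_def by blast
    then have "\<exists>\<^sub>F t in at_top. f t > d" by (simp add: A_def)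
    then show ?thesis by (rule frequently_elim1) (use \<open>c < d\<close> in auto)
  qed
  have ev: "\<forall>\<^sub>F t in at_top. c < f t" if "c < l" for c
  proof (rule ccontr)
    assume "\<not> ?thesis"
    then have low: "\<exists>\<^sub>F t in at_top. f t \<le> c" by (simp add: frequently_def not_le)
    have "g x = 0" if x: "x \<in> {c<..<l}" for x
    proof (rule ccontr)
      assume gx: "g x \<noteq> 0"
      have "\<forall>\<^sub>F t in at_top. \<bar>g (f t)\<bar> < \<bar>g x\<bar>"
        using tendstoD[OF lim, of "\<bar>g x\<bar>"] gx by (simp add: dist_real_def)
      then obtain S where S: "\<And>t. t \<ge> S \<Longrightarrow> \<bar>g (f t)\<bar> < \<bar>g x\<bar>"
        by (auto simp: eventually_at_top_linorder)
      have "\<exists>\<^sub>F t in at_top. t \<ge> max S T \<and> f t \<le> c"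
        by (rule frequently_eventually_conj[OF low eventually_ge_at_top[of "max S T"]])
      from frequently_ex[OF this] obtain s where s: "f s \<le> c" "s \<ge> max S T" by blast
      have "\<exists>\<^sub>F t in at_top. t \<ge> s \<and> f t > x"
        using frequently_eventually_conj[OF freq[of x] eventually_ge_at_top[of s]] x by simp
      from frequently_ex[OF this] obtain t where t: "f t > x" "t \<ge> s" by blast
      have "\<exists>r\<ge>s. r \<le> t \<and> f r = x"
        using IVT[of f s x t] s t x f by auto
      then obtain r where "r \<ge> s" "f r = x" by blast
      then have "r \<ge> S" "f r = x" using s by auto
      then show False using S[of r] by simp
    qed
    then have "{c<..<l} \<subseteq> {x. g x = 0}" by auto
    then have "finite {c<..<l}" using zeros finite_subset by blast
    then show False using \<open>c < l\<close> by (simp add: infinite_Ioo)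
  qed
  have lim_f: "(f \<longlongrightarrow> l) at_top"
    using up ev by (intro order_tendstoI) auto
  then have "((\<lambda>t. g (f t)) \<longlongrightarrow> g l) at_top"
    by (rule isCont_tendsto_compose[OF g])
  then have "g l = 0" by (rule tendsto_unique[OF trivial_limit_at_top_linorder _ lim])
  then show thesis using lim_f by (rule that)
qed

lemma abs_powr_mult_lipschitz:
  fixes a x y :: real
  assumes a: "0 < a" and x: "\<bar>x\<bar> \<le> M" and y: "\<bar>y\<bar> \<le> M"
  shows "\<bar>\<bar>x\<bar> powr a * x - \<bar>y\<bar> powr a * y\<bar> \<le> (a + 1) * M powr a * \<bar>x - y\<bar>"
proof -
  have "norm (\<bar>x\<bar> powr a * x - \<bar>y\<bar> powr a * y) \<le> (a + 1) * M powr a * norm (x - y)"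
  proof (rule field_differentiable_bound[where S = "{-M..M}" and f' = "\<lambda>x. (a + 1) * \<bar>x\<bar> powr a"])
    show "((\<lambda>x. \<bar>x\<bar> powr a * x) has_real_derivative (a + 1) * \<bar>z\<bar> powr a) (at z within {-M..M})" for z
      by (rule DERIV_subset[OF has_real_derivative_abs_powr_mult[OF a]]) simp
    show "norm ((a + 1) * \<bar>z\<bar> powr a) \<le> (a + 1) * M powr a" if "z \<in> {-M..M}" for z
      using that a by (auto simp: abs_mult intro!: mult_left_mono powr_mono2)
  qed (use x y in auto)
  then show ?thesis by simp
qed

text \<open>
  The half line below \<open>Q\<close> is a barrier: consider the last time before \<open>t\<close> at which \<open>f\<close> is at most
  \<open>max (f T) Q\<close>.
\<close>

lemma le_max_if_deriv_nonpos_above: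
  fixes f f' :: "real \<Rightarrow> real"
  assumes f: "\<And>t. t \<ge> T \<Longrightarrow> (f has_real_derivative f' t) (at t)"
    and neg: "\<And>t. t \<ge> T \<Longrightarrow> f t \<ge> Q \<Longrightarrow> f' t \<le> 0"
    and t: "t \<ge> T"
  shows "f t \<le> max (f T) Q"
proof (rule ccontr)
  assume *: "\<not> ?thesis"
  define A where "A = {T..t} \<inter> f -` {..max (f T) Q}"
  have cont: "continuous_on {T..t} f"
    using f by (auto intro!: DERIV_atLeastAtMost_imp_continuous_on)
  have "closed A"
    unfolding A_def by (rule continuous_closed_preimage[OF cont]) auto
  then have "compact A"
    using compact_Int_closed[of "{T..t}" A] by (simp add: A_def Int_absorb1 inf_commute inf_left_commute)
  moreover have "A \<noteq> {}" using t by (auto simp: A_def)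
  ultimately obtain s where s: "s \<in> A" "\<And>x. x \<in> A \<Longrightarrow> x \<le> s"
    using compact_attains_sup[of A] by auto
  have st: "T \<le> s" "s < t" "f s \<le> max (f T) Q"
    using s(1) * by (auto simp: A_def order.strict_iff_order)
  have above: "f x > max (f T) Q" if "s < x" "x \<le> t" for x
  proof (rule ccontr)
    assume "\<not> ?thesis"
    then have "x \<in> A" using that st by (auto simp: A_def)
    then show False using s(2)[of x] that by auto
  qed
  have "f t \<le> f s"
  proof (rule DERIV_nonpos_imp_decreasing_open[of s t])
    show "\<exists>y. (f has_real_derivative y) (at x) \<and> y \<le> 0" if "s < x" "x < t" for x
      using f[of x] neg[of x] above[of x] that st by auto
    show "continuous_on {s..t} f" by (rule continuous_on_subset[OF cont]) (use st in auto)
  qed (use st in auto)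
  then show False using above[of t] st by auto
qed

section \<open>The autonomous Emden--Fowler equation\<close>

text \<open>
  The linear part factors as \<open>(d/dt - \<kappa>) (d/dt + \<gamma>)\<close>, which is the reason for this choice of
  parameters. No order between \<open>\<kappa>\<close> and \<open>\<gamma>\<close> is imposed here, because reversing time exchanges them; in this
  way every statement at \<open>+\<infinity>\<close> yields one at \<open>-\<infinity>\<close>. The second function is \<open>p = w'\<close>.
\<close>

locale emden_fowler =
  fixes \<alpha> \<kappa> \<gamma> :: real and w p :: "real \<Rightarrow> real"
  assumes alpha_pos: "0 < \<alpha>" and kappa_pos: "0 < \<kappa>" and gamma_pos: "0 < \<gamma>"
    and deriv_w: "\<And>t. (w has_real_derivative p t) (at t)"
    and deriv_p: "\<And>t. (p has_real_derivative
      (\<kappa> - \<gamma>) * p t + \<kappa> * \<gamma> * w t - \<bar>w t\<bar> powr \<alpha> * w t) (at t)"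

text \<open>
  Two solutions are bounded on \<open>[s, t]\<close>, and the nonlinearity is Lipschitz on bounded sets. So the squared
  distance in the phase plane satisfies a Gronwall inequality and starts from \<open>0\<close>.
\<close>

lemma emden_fowler_unique_forward:
  assumes "emden_fowler \<alpha> \<kappa> \<gamma> w p" "emden_fowler \<alpha> \<kappa> \<gamma> v q"
    and init: "w s = v s" "p s = q s" and "s \<le> t"
  shows "w t = v t \<and> p t = q t"
proof -
  interpret W: emden_fowler \<alpha> \<kappa> \<gamma> w p by fact
  interpret V: emden_fowler \<alpha> \<kappa> \<gamma> v q by fact
  have cont: "continuous_on {s..t} w" "continuous_on {s..t} v"
    using W.deriv_w V.deriv_w by (auto intro!: DERIV_atLeastAtMost_imp_continuous_on)
  obtain M1 where M1: "\<And>x. x \<in> {s..t} \<Longrightarrow> \<bar>w x\<bar> \<le> M1"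
    using compact_imp_bounded[OF compact_continuous_image[OF cont(1) compact_Icc]]
    unfolding bounded_iff real_norm_def by blast
  obtain M2 where M2: "\<And>x. x \<in> {s..t} \<Longrightarrow> \<bar>v x\<bar> \<le> M2"
    using compact_imp_bounded[OF compact_continuous_image[OF cont(2) compact_Icc]]
    unfolding bounded_iff real_norm_def by blast
  define C where "C = (\<alpha> + 1) * (max M1 M2) powr \<alpha>"
  have C: "0 \<le> C" using W.alpha_pos by (simp add: C_def)
  define h where "h x = \<bar>w x\<bar> powr \<alpha> * w x - \<bar>v x\<bar> powr \<alpha> * v x" for x
  have h: "\<bar>h x\<bar> \<le> C * \<bar>w x - v x\<bar>" if "x \<in> {s..t}" for x
    unfolding h_def C_def
    by (rule abs_powr_mult_lipschitz[OF W.alpha_pos]) (use M1[OF that] M2[OF that] in auto)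
  define g where "g x = (w x - v x)\<^sup>2 + (p x - q x)\<^sup>2" for x
  define g' where "g' x = 2 * (w x - v x) * (p x - q x)
    + 2 * (p x - q x) * ((\<kappa> - \<gamma>) * (p x - q x) + \<kappa> * \<gamma> * (w x - v x) - h x)" for x
  define L where "L = 1 + 2 * \<bar>\<kappa> - \<gamma>\<bar> + \<kappa> * \<gamma> + C"
  have "g t \<le> g s * exp (L * (t - s))"
  proof (rule gronwall[OF _ _ \<open>s \<le> t\<close>])
    fix x assume x: "x \<in> {s..t}"
    show "(g has_real_derivative g' x) (at x)"
      unfolding g_def g'_def h_def
      by (rule derivative_eq_intros refl W.deriv_w W.deriv_p V.deriv_w V.deriv_p)+
        (simp add: algebra_simps)
    have two: "2 * \<bar>(w x - v x) * (p x - q x)\<bar> \<le> g x"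
      using sum_squares_bound[of "\<bar>w x - v x\<bar>" "\<bar>p x - q x\<bar>"] by (simp add: g_def abs_mult)
    have 1: "2 * (w x - v x) * (p x - q x) \<le> g x" using two abs_ge_self[of "(w x - v x) * (p x - q x)"] by linarith
    have "(\<kappa> - \<gamma>) * (p x - q x)\<^sup>2 \<le> \<bar>\<kappa> - \<gamma>\<bar> * g x"
      by (intro mult_mono) (auto simp: g_def)
    then have 2: "2 * (p x - q x) * ((\<kappa> - \<gamma>) * (p x - q x)) \<le> 2 * \<bar>\<kappa> - \<gamma>\<bar> * g x"
      by (simp add: power2_eq_square algebra_simps)
    have 3: "2 * (p x - q x) * (\<kappa> * \<gamma> * (w x - v x)) \<le> \<kappa> * \<gamma> * g x"
      using mult_left_mono[OF 1, of "\<kappa> * \<gamma>"] W.kappa_pos W.gamma_pos by (simp only: mult_ac) simp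
    have "2 * (p x - q x) * (- h x) \<le> \<bar>2 * (p x - q x) * (- h x)\<bar>" by simp
    also have "\<dots> = 2 * (\<bar>p x - q x\<bar> * \<bar>h x\<bar>)"
      by (simp only: abs_mult abs_minus_cancel abs_numeral mult.assoc)
    also have "\<dots> \<le> 2 * (\<bar>p x - q x\<bar> * (C * \<bar>w x - v x\<bar>))"
      by (intro mult_left_mono h x) auto
    also have "\<dots> = C * (2 * \<bar>(w x - v x) * (p x - q x)\<bar>)" by (simp add: abs_mult)
    also have "\<dots> \<le> C * g x" by (intro mult_left_mono two C)
    finally have 4: "2 * (p x - q x) * (- h x) \<le> C * g x" .
    have "g' x = 2 * (w x - v x) * (p x - q x) + 2 * (p x - q x) * ((\<kappa> - \<gamma>) * (p x - q x))
       + 2 * (p x - q x) * (\<kappa> * \<gamma> * (w x - v x)) + 2 * (p x - q x) * (- h x)"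
      by (simp add: g'_def algebra_simps)
    then show "g' x \<le> L * g x"
      using 1 2 3 4 by (simp add: L_def algebra_simps)
  qed
  then have "g t \<le> 0" using init by (simp add: g_def)
  then show ?thesis
    by (simp add: g_def sum_power2_le_zero_iff)
qed

context emden_fowler
begin

lemma reversed: "emden_fowler \<alpha> \<gamma> \<kappa> (\<lambda>t. w (- t)) (\<lambda>t. - p (- t))"
proof
  show "((\<lambda>t. w (- t)) has_real_derivative - p (- t)) (at t)" for t
    using deriv_w[of "- t"] by (simp add: DERIV_mirror)
  have "((\<lambda>t. p (- t)) has_real_derivative
     ((\<kappa> - \<gamma>) * p (- t) + \<kappa> * \<gamma> * w (- t) - \<bar>w (- t)\<bar> powr \<alpha> * w (- t)) * (- 1)) (at t)" for t
    by (rule DERIV_chain2[OF deriv_p]) (auto intro!: derivative_eq_intros)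
  from DERIV_minus[OF this]
  show "((\<lambda>t. - p (- t)) has_real_derivative
     (\<gamma> - \<kappa>) * - p (- t) + \<gamma> * \<kappa> * w (- t) - \<bar>w (- t)\<bar> powr \<alpha> * w (- t)) (at t)" for t
    by (simp add: algebra_simps)
qed (use alpha_pos kappa_pos gamma_pos in auto)

lemma negated: "emden_fowler \<alpha> \<kappa> \<gamma> (\<lambda>t. - w t) (\<lambda>t. - p t)"
proof
  show "((\<lambda>t. - w t) has_real_derivative - p t) (at t)" for t
    by (rule DERIV_minus[OF deriv_w])
  show "((\<lambda>t. - p t) has_real_derivative
     (\<kappa> - \<gamma>) * - p t + \<kappa> * \<gamma> * - w t - \<bar>- w t\<bar> powr \<alpha> * - w t) (at t)" for t
    using DERIV_minus[OF deriv_p[of t]] by (simp add: algebra_simps)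
qed (use alpha_pos kappa_pos gamma_pos in auto)

lemma isCont_w: "isCont w t" and isCont_p: "isCont p t"
  using deriv_w deriv_p DERIV_isCont by blast+

definition energy :: "real \<Rightarrow> real" where
  "energy t = (p t)\<^sup>2 / 2 - \<kappa> * \<gamma> / 2 * (w t)\<^sup>2 + \<bar>w t\<bar> powr (\<alpha> + 2) / (\<alpha> + 2)"

lemma deriv_energy: "(energy has_real_derivative (\<kappa> - \<gamma>) * (p t)\<^sup>2) (at t)"
proof -
  have 1: "((\<lambda>t. \<bar>w t\<bar> powr (\<alpha> + 2)) has_real_derivative
      (\<alpha> + 2) * (\<bar>w t\<bar> powr \<alpha> * w t) * p t) (at t)"
    by (rule DERIV_chain2[OF has_real_derivative_abs_powr_add_2[OF alpha_pos] deriv_w])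
  have 2: "((\<lambda>t. (p t)\<^sup>2 / 2 - \<kappa> * \<gamma> / 2 * (w t)\<^sup>2) has_real_derivative
     p t * ((\<kappa> - \<gamma>) * p t + \<kappa> * \<gamma> * w t - \<bar>w t\<bar> powr \<alpha> * w t) - \<kappa> * \<gamma> * (w t * p t)) (at t)"
    by (auto intro!: derivative_eq_intros deriv_w deriv_p)
  have "(energy has_real_derivative
     p t * ((\<kappa> - \<gamma>) * p t + \<kappa> * \<gamma> * w t - \<bar>w t\<bar> powr \<alpha> * w t) - \<kappa> * \<gamma> * (w t * p t)
     + (\<alpha> + 2) * (\<bar>w t\<bar> powr \<alpha> * w t) * p t / (\<alpha> + 2)) (at t)"
    unfolding energy_def by (rule DERIV_add[OF 2 DERIV_cdivide[OF 1]])
  moreover have "(\<alpha> + 2) * (\<bar>w t\<bar> powr \<alpha> * w t) * p t / (\<alpha> + 2) = \<bar>w t\<bar> powr \<alpha> * w t * p t"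
    using alpha_pos by simp
  ultimately show ?thesis
    by (simp add: algebra_simps power2_eq_square)
qed

lemma isCont_energy: "isCont energy t"
  using deriv_energy DERIV_isCont by blast

definition k :: real where "k = (\<kappa> * \<gamma>) powr (1 / \<alpha>)"

lemma k_pos: "0 < k" and k_powr: "k powr \<alpha> = \<kappa> * \<gamma>"
  using alpha_pos kappa_pos gamma_pos by (auto simp: k_def powr_powr)

lemma equilibrium_cases:
  assumes "\<kappa> * \<gamma> * x - \<bar>x\<bar> powr \<alpha> * x = 0"
  shows "x \<in> {0, k, - k}"
proof (cases "x = 0")
  case False
  then have "\<bar>x\<bar> powr \<alpha> = k powr \<alpha>"
    using assms k_powr by (simp add: left_diff_distrib[symmetric])
  then have "(\<bar>x\<bar> powr \<alpha>) powr (1 / \<alpha>) = (k powr \<alpha>) powr (1 / \<alpha>)" by metis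
  then have "\<bar>x\<bar> = k" using alpha_pos k_pos by (simp add: powr_powr)
  then show ?thesis by auto
qed auto

text \<open>
  The energy is monotone and bounded along the orbit, hence converges; as its derivative is a multiple
  of \<open>p\<^sup>2\<close> with bounded derivative, Barbalat's lemma gives \<open>p \<rightarrow> 0\<close>. A second application to \<open>p\<close> itself
  gives \<open>p' \<rightarrow> 0\<close>, so \<open>w\<close> approaches the finite set of equilibria.
\<close>

lemma bounded_imp_tendsto_equilibrium:
  assumes "\<kappa> \<noteq> \<gamma>"
    and w: "\<And>t. t \<ge> T \<Longrightarrow> \<bar>w t\<bar> \<le> M" and p: "\<And>t. t \<ge> T \<Longrightarrow> \<bar>p t\<bar> \<le> M"
  obtains l where "l \<in> {0, k, - k}" "(w \<longlongrightarrow> l) at_top" "(p \<longlongrightarrow> 0) at_top"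
proof -
  have M: "0 \<le> M" using w[of T] by (auto intro: order_trans[OF abs_ge_zero])
  define p' where "p' t = (\<kappa> - \<gamma>) * p t + \<kappa> * \<gamma> * w t - \<bar>w t\<bar> powr \<alpha> * w t" for t
  have wpow: "\<bar>w t\<bar> powr a \<le> M powr a" if "t \<ge> T" "0 \<le> a" for t a
    using w that by (intro powr_mono2) auto
  define B where "B = \<bar>\<kappa> - \<gamma>\<bar> * M + \<kappa> * \<gamma> * M + M powr \<alpha> * M"
  have p'_bound: "\<bar>p' t\<bar> \<le> B" if "t \<ge> T" for t
  proof -
    have "\<bar>p' t\<bar> \<le> \<bar>(\<kappa> - \<gamma>) * p t\<bar> + \<bar>\<kappa> * \<gamma> * w t\<bar> + \<bar>\<bar>w t\<bar> powr \<alpha> * w t\<bar>"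
      unfolding p'_def by linarith
    also have "\<dots> \<le> B"
      unfolding B_def abs_mult using w[OF that] p[OF that] wpow[OF that, of \<alpha>] alpha_pos kappa_pos gamma_pos
      by (intro add_mono mult_mono) auto
    finally show ?thesis .
  qed
  define f where "f t = (\<kappa> - \<gamma>) * energy t" for t
  have df: "(f has_real_derivative (\<kappa> - \<gamma>)\<^sup>2 * (p t)\<^sup>2) (at t)" for t
    unfolding f_def using DERIV_cmult[OF deriv_energy[of t], of "\<kappa> - \<gamma>"]
    by (simp add: power2_eq_square mult.assoc)
  have ddf: "((\<lambda>t. (\<kappa> - \<gamma>)\<^sup>2 * (p t)\<^sup>2) has_real_derivative (\<kappa> - \<gamma>)\<^sup>2 * (2 * p t * p' t)) (at t)" for t
    unfolding p'_def by (auto intro!: derivative_eq_intros deriv_p)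
  have "f s \<le> f t" if "s \<le> t" for s t
    by (rule DERIV_nonneg_imp_nondecreasing[OF that]) (use df in force)
  moreover have "f t \<le> \<bar>\<kappa> - \<gamma>\<bar> * (M\<^sup>2 / 2 + \<kappa> * \<gamma> / 2 * M\<^sup>2 + M powr (\<alpha> + 2) / (\<alpha> + 2))" if "t \<ge> T" for t
  proof -
    have sq: "(w t)\<^sup>2 \<le> M\<^sup>2" "(p t)\<^sup>2 \<le> M\<^sup>2"
      using w[OF that] p[OF that] by (auto simp: abs_le_square_iff[symmetric] M)
    have "\<bar>energy t\<bar> \<le> (p t)\<^sup>2 / 2 + \<kappa> * \<gamma> / 2 * (w t)\<^sup>2 + \<bar>w t\<bar> powr (\<alpha> + 2) / (\<alpha> + 2)"
    proof -
      have "0 \<le> (p t)\<^sup>2 / 2" "0 \<le> \<kappa> * \<gamma> / 2 * (w t)\<^sup>2" "0 \<le> \<bar>w t\<bar> powr (\<alpha> + 2) / (\<alpha> + 2)"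
        using alpha_pos kappa_pos gamma_pos by auto
      then show ?thesis unfolding energy_def by linarith
    qed
    also have "\<dots> \<le> M\<^sup>2 / 2 + \<kappa> * \<gamma> / 2 * M\<^sup>2 + M powr (\<alpha> + 2) / (\<alpha> + 2)"
      using sq wpow[OF that, of "\<alpha> + 2"] alpha_pos kappa_pos gamma_pos
      by (intro add_mono divide_right_mono mult_left_mono) auto
    finally have "\<bar>f t\<bar> \<le> \<bar>\<kappa> - \<gamma>\<bar> * (M\<^sup>2 / 2 + \<kappa> * \<gamma> / 2 * M\<^sup>2 + M powr (\<alpha> + 2) / (\<alpha> + 2))"
      unfolding f_def abs_mult by (intro mult_left_mono) auto
    then show ?thesis by linarith
  qed
  ultimately obtain lf where lf: "(f \<longlongrightarrow> lf) at_top"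
    using monotone_bounded_tendsto_at_top[of T f] by blast
  have "((\<lambda>t. (\<kappa> - \<gamma>)\<^sup>2 * (p t)\<^sup>2) \<longlongrightarrow> 0) at_top"
  proof (rule barbalat[OF df ddf _ lf])
    fix t assume t: "t \<ge> T"
    have "\<bar>p t * p' t\<bar> \<le> M * B"
      unfolding abs_mult using p[OF t] p'_bound[OF t] M by (intro mult_mono) auto
    then show "\<bar>(\<kappa> - \<gamma>)\<^sup>2 * (2 * p t * p' t)\<bar> \<le> (\<kappa> - \<gamma>)\<^sup>2 * (2 * (M * B))"
      by (simp add: abs_mult mult_left_mono)
  qed
  then have "((\<lambda>t. (\<kappa> - \<gamma>)\<^sup>2 * (p t)\<^sup>2 / (\<kappa> - \<gamma>)\<^sup>2) \<longlongrightarrow> 0 / (\<kappa> - \<gamma>)\<^sup>2) at_top"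
    using \<open>\<kappa> \<noteq> \<gamma>\<close> by (intro tendsto_divide tendsto_const) auto
  then have "((\<lambda>t. (p t)\<^sup>2) \<longlongrightarrow> 0) at_top"
    using \<open>\<kappa> \<noteq> \<gamma>\<close> by simp
  then have lim_p: "(p \<longlongrightarrow> 0) at_top"
    by simp
  define p'' where "p'' t = (\<kappa> - \<gamma>) * p' t + \<kappa> * \<gamma> * p t - (\<alpha> + 1) * \<bar>w t\<bar> powr \<alpha> * p t" for t
  have dp: "(p has_real_derivative p' t) (at t)" for t
    unfolding p'_def by (rule deriv_p)
  have dp': "(p' has_real_derivative p'' t) (at t)" for t
  proof -
    have "((\<lambda>t. (\<kappa> - \<gamma>) * p t + \<kappa> * \<gamma> * w t) has_real_derivative
        (\<kappa> - \<gamma>) * p' t + \<kappa> * \<gamma> * p t) (at t)"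
      by (intro DERIV_add DERIV_cmult dp deriv_w)
    from DERIV_diff[OF this DERIV_chain2[OF has_real_derivative_abs_powr_mult[OF alpha_pos] deriv_w]]
    show ?thesis unfolding p'_def p''_def .
  qed
  have "(p' \<longlongrightarrow> 0) at_top"
  proof (rule barbalat[OF dp dp' _ lim_p])
    fix t assume t: "t \<ge> T"
    have "\<bar>p'' t\<bar> \<le> \<bar>(\<kappa> - \<gamma>) * p' t\<bar> + \<bar>\<kappa> * \<gamma> * p t\<bar> + \<bar>(\<alpha> + 1) * \<bar>w t\<bar> powr \<alpha> * p t\<bar>"
      unfolding p''_def by linarith
    also have "\<dots> \<le> \<bar>\<kappa> - \<gamma>\<bar> * B + \<kappa> * \<gamma> * M + (\<alpha> + 1) * M powr \<alpha> * M"
      unfolding abs_mult using p'_bound[OF t] p[OF t] wpow[OF t, of \<alpha>] alpha_pos kappa_pos gamma_pos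
      by (intro add_mono mult_mono) auto
    finally show "\<bar>p'' t\<bar> \<le> \<bar>\<kappa> - \<gamma>\<bar> * B + \<kappa> * \<gamma> * M + (\<alpha> + 1) * M powr \<alpha> * M" .
  qed
  then have "((\<lambda>t. p' t - (\<kappa> - \<gamma>) * p t) \<longlongrightarrow> 0 - (\<kappa> - \<gamma>) * 0) at_top"
    by (intro tendsto_intros lim_p)
  then have lim_g: "((\<lambda>t. \<kappa> * \<gamma> * w t - \<bar>w t\<bar> powr \<alpha> * w t) \<longlongrightarrow> 0) at_top"
    by (simp add: p'_def)
  obtain l where l: "\<kappa> * \<gamma> * l - \<bar>l\<bar> powr \<alpha> * l = 0" "(w \<longlongrightarrow> l) at_top"
  proof (rule tendsto_root_if_finitely_many_roots[OF isCont_w _ lim_g w])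
    show "isCont (\<lambda>x. \<kappa> * \<gamma> * x - \<bar>x\<bar> powr \<alpha> * x) x" for x
      by (rule DERIV_isCont) (rule derivative_intros has_real_derivative_abs_powr_mult[OF alpha_pos])+
    show "finite {x. \<kappa> * \<gamma> * x - \<bar>x\<bar> powr \<alpha> * x = 0}"
      by (rule finite_subset[of _ "{0, k, - k}"]) (use equilibrium_cases in blast)+
  qed
  show thesis
    by (rule that[OF equilibrium_cases[OF l(1)] l(2) lim_p])
qed

end

section \<open>Solutions that are positive near infinity\<close>

context emden_fowler
begin

lemma exp_deriv_unstable:
  "((\<lambda>t. exp (- \<kappa> * t) * (p t + \<gamma> * w t)) has_real_derivative
     - exp (- \<kappa> * t) * (\<bar>w t\<bar> powr \<alpha> * w t)) (at t)"
  by (auto intro!: derivative_eq_intros deriv_w deriv_p simp: algebra_simps)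

lemma exp_deriv_stable:
  "((\<lambda>t. exp (\<gamma> * t) * (p t - \<kappa> * w t)) has_real_derivative
     - exp (\<gamma> * t) * (\<bar>w t\<bar> powr \<alpha> * w t)) (at t)"
  by (auto intro!: derivative_eq_intros deriv_w deriv_p simp: algebra_simps)

lemma exp_deriv_w:
  "((\<lambda>t. exp (a * t) * w t) has_real_derivative exp (a * t) * (p t + a * w t)) (at t)"
  by (auto intro!: derivative_eq_intros deriv_w simp: algebra_simps)

text \<open>
  For positive \<open>w\<close> the function \<open>e\<^bsup>-\<kappa>t\<^esup> (p + \<gamma> w)\<close> is nonincreasing. Once it is negative, the derivative
  \<open>e\<^bsup>\<gamma>t\<^esup> (p + \<gamma> w)\<close> of \<open>e\<^bsup>\<gamma>t\<^esup> w\<close> stays below a negative constant, which drives \<open>w\<close> below \<open>0\<close>.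
\<close>

lemma positive_imp_log_derivative_ge:
  assumes pos: "\<And>t. t \<ge> T \<Longrightarrow> 0 < w t" and "s \<ge> T"
  shows "0 \<le> p s + \<gamma> * w s"
proof (rule ccontr)
  assume neg: "\<not> ?thesis"
  define c where "c = - exp (- \<kappa> * s) * (p s + \<gamma> * w s)"
  have c: "c > 0" using neg by (simp add: c_def mult_pos_neg not_le)
  \<comment> \<open>the descent rate of \<open>e\<^bsup>\<gamma>t\<^esup> w\<close> from time \<open>s\<close> on\<close>
  define d where "d = c * exp ((\<kappa> + \<gamma>) * s)"
  have d: "d > 0" using c by (simp add: d_def)
  have z: "exp (\<gamma> * t) * (p t + \<gamma> * w t) \<le> - d" if "t \<ge> s" for t
  proof -
    have "exp (- \<kappa> * t) * (p t + \<gamma> * w t) \<le> exp (- \<kappa> * s) * (p s + \<gamma> * w s)"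
    proof (rule deriv_nonpos_imp_antimono[OF exp_deriv_unstable _ that])
      fix x assume "x \<in> {s..t}"
      then have "0 < w x" using pos \<open>s \<ge> T\<close> by simp
      then show "- exp (- \<kappa> * x) * (\<bar>w x\<bar> powr \<alpha> * w x) \<le> 0" by simp
    qed
    then have "exp ((\<kappa> + \<gamma>) * t) * (exp (- \<kappa> * t) * (p t + \<gamma> * w t)) \<le> exp ((\<kappa> + \<gamma>) * t) * - c"
      by (intro mult_left_mono) (auto simp: c_def)
    also have "exp ((\<kappa> + \<gamma>) * t) * (exp (- \<kappa> * t) * (p t + \<gamma> * w t)) = exp (\<gamma> * t) * (p t + \<gamma> * w t)"
      by (simp add: mult.assoc[symmetric] exp_add[symmetric] distrib_right)
    also have "exp ((\<kappa> + \<gamma>) * t) * - c \<le> exp ((\<kappa> + \<gamma>) * s) * - c"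
      using that c kappa_pos gamma_pos by (intro mult_right_mono_neg) auto
    finally show ?thesis by (simp add: d_def mult.commute)
  qed
  define t where "t = s + exp (\<gamma> * s) * w s / d + 1"
  have "w s > 0" using pos \<open>s \<ge> T\<close> by auto
  then have t: "t \<ge> s" "t \<ge> T" using d \<open>s \<ge> T\<close> by (auto simp: t_def intro: order_trans[of _ s])
  have "exp (\<gamma> * t) * w t + d * t \<le> exp (\<gamma> * s) * w s + d * s"
  proof (rule deriv_nonpos_imp_antimono[OF _ _ t(1)])
    show "((\<lambda>t. exp (\<gamma> * t) * w t + d * t) has_real_derivative
      exp (\<gamma> * t) * (p t + \<gamma> * w t) + d) (at t)" for t
      by (intro DERIV_add exp_deriv_w DERIV_cmult_Id)
  qed (use z in force)
  also have "\<dots> = d * t - d" using d by (simp add: t_def algebra_simps)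
  finally have "exp (\<gamma> * t) * w t < 0" using d by simp
  then show False using pos[OF t(2)] by (simp add: mult_less_0_iff)
qed

text \<open>
  The logarithmic derivative \<open>q = p / w\<close> solves the Riccati equation
  \<open>q' = - (q - \<kappa>) (q + \<gamma>) - w\<^bsup>\<alpha>\<^esup>\<close>. It is at least \<open>- \<gamma>\<close> by the previous lemma, and bounded above since
  \<open>q' \<le> 0\<close> whenever \<open>q \<ge> \<kappa>\<close>. As \<open>e\<^bsup>\<gamma>t\<^esup> w\<close> is nondecreasing, a large value \<open>w t\<close> keeps \<open>w\<close> large on
  \<open>[t, t + 1]\<close>; then \<open>q\<close> would drop by more than the length of its range.
\<close>

lemma positive_imp_bounded:
  assumes pos: "\<And>t. t \<ge> T \<Longrightarrow> 0 < w t"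
  obtains M where "\<And>t. t \<ge> T \<Longrightarrow> \<bar>w t\<bar> \<le> M" "\<And>t. t \<ge> T \<Longrightarrow> \<bar>p t\<bar> \<le> M"
proof -
  define q where "q t = p t / w t" for t
  define q' where "q' t = - ((q t - \<kappa>) * (q t + \<gamma>)) - w t powr \<alpha>" for t
  have q_ge: "- \<gamma> \<le> q t" if "t \<ge> T" for t
    using positive_imp_log_derivative_ge[OF pos that] pos[OF that]
    by (simp add: q_def field_simps)
  have dq: "(q has_real_derivative q' t) (at t)" if "t \<ge> T" for t
  proof -
    have "(q has_real_derivative (((\<kappa> - \<gamma>) * p t + \<kappa> * \<gamma> * w t - \<bar>w t\<bar> powr \<alpha> * w t) * w t - p t * p t)
        / (w t * w t)) (at t)"
      unfolding q_def using pos[OF that] by (intro DERIV_divide deriv_p deriv_w) auto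
    moreover have "(((\<kappa> - \<gamma>) * p t + \<kappa> * \<gamma> * w t - \<bar>w t\<bar> powr \<alpha> * w t) * w t - p t * p t)
        / (w t * w t) = q' t"
      using pos[OF that] by (simp add: q'_def q_def field_simps)
    ultimately show ?thesis by simp
  qed
  define Q where "Q = max (q T) \<kappa>"
  have q_le: "q t \<le> Q" if "t \<ge> T" for t
    unfolding Q_def
  proof (rule le_max_if_deriv_nonpos_above[OF dq _ that])
    fix t assume t: "t \<ge> T" "\<kappa> \<le> q t"
    then have "0 \<le> (q t - \<kappa>) * (q t + \<gamma>)"
      using q_ge[of t] by (intro mult_nonneg_nonneg) auto
    then show "q' t \<le> 0" unfolding q'_def using powr_ge_zero[of "w t" \<alpha>] by linarith
  qed auto
  define C where "C = (\<kappa> + \<gamma>)\<^sup>2 / 4"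
  have quad: "- ((x - \<kappa>) * (x + \<gamma>)) \<le> C" for x
    using zero_le_power2[of "2 * x - \<kappa> + \<gamma>"] by (simp add: C_def power2_eq_square field_simps)
  define B where "B = (exp (\<gamma> * \<alpha>) * (C + \<gamma> + Q)) powr (1 / \<alpha>)"
  have w_le: "w t \<le> B" if t: "t \<ge> T" for t
  proof -
    obtain x where x: "t < x" "x < t + 1" "q (t + 1) - q t = (t + 1 - t) * q' x"
      using MVT2[of t "t + 1" q q'] dq t by auto
    have "exp (\<gamma> * t) * w t \<le> exp (\<gamma> * x) * w x"
      by (rule DERIV_nonneg_imp_nondecreasing[of t x "\<lambda>t. exp (\<gamma> * t) * w t"])
        (use exp_deriv_w positive_imp_log_derivative_ge[OF pos] t x in fastforce)+
    also have "\<dots> \<le> exp (\<gamma> * (t + 1)) * w x"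
      using pos[of x] t x gamma_pos by (intro mult_right_mono) auto
    finally have "exp (\<gamma> * t) * w t \<le> exp (\<gamma> * t) * (exp \<gamma> * w x)"
      by (simp add: distrib_left exp_add mult.assoc)
    then have "w t \<le> exp \<gamma> * w x" by simp
    then have "w t powr \<alpha> \<le> (exp \<gamma> * w x) powr \<alpha>"
      using pos[OF t] alpha_pos by (intro powr_mono2) auto
    also have "\<dots> = exp (\<gamma> * \<alpha>) * w x powr \<alpha>"
      using pos[of x] t x by (simp add: powr_mult exp_powr_real)
    also have "w x powr \<alpha> \<le> C + \<gamma> + Q"
      using quad[of "q x"] x q_le[OF t] q_ge[of "t + 1"] t by (simp add: q'_def)
    finally have "w t powr \<alpha> \<le> exp (\<gamma> * \<alpha>) * (C + \<gamma> + Q)" by simp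
    then have "(w t powr \<alpha>) powr (1 / \<alpha>) \<le> B"
      unfolding B_def using alpha_pos by (intro powr_mono2) auto
    then show ?thesis using pos[OF t] alpha_pos by (simp add: powr_powr)
  qed
  define M where "M = max 1 (max \<gamma> \<bar>Q\<bar>) * B"
  have B: "0 \<le> B" by (simp add: B_def)
  show thesis
  proof (rule that[of M])
    fix t assume t: "t \<ge> T"
    have "1 * B \<le> M" unfolding M_def using B by (intro mult_right_mono) auto
    then show "\<bar>w t\<bar> \<le> M" using w_le[OF t] pos[OF t] by simp
    have "\<bar>p t\<bar> = \<bar>q t\<bar> * w t" using pos[OF t] by (simp add: q_def abs_mult)
    also have "\<dots> \<le> M" unfolding M_def
      using q_le[OF t] q_ge[OF t] w_le[OF t] pos[OF t] B gamma_pos by (intro mult_mono) auto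
    finally show "\<bar>p t\<bar> \<le> M" .
  qed
qed

lemma positive_imp_tendsto:
  assumes "\<kappa> \<noteq> \<gamma>" and pos: "\<And>t. t \<ge> T \<Longrightarrow> 0 < w t"
  obtains l where "l \<in> {0, k}" "(w \<longlongrightarrow> l) at_top" "(p \<longlongrightarrow> 0) at_top"
proof -
  obtain M where M: "\<And>t. t \<ge> T \<Longrightarrow> \<bar>w t\<bar> \<le> M" "\<And>t. t \<ge> T \<Longrightarrow> \<bar>p t\<bar> \<le> M"
    using positive_imp_bounded[OF pos] by blast
  obtain l where l: "l \<in> {0, k, - k}" "(w \<longlongrightarrow> l) at_top" "(p \<longlongrightarrow> 0) at_top"
    using bounded_imp_tendsto_equilibrium[OF \<open>\<kappa> \<noteq> \<gamma>\<close> M] by blast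
  have "\<forall>\<^sub>F t in at_top. 0 \<le> w t"
    using eventually_ge_at_top[of T] by eventually_elim (use pos in \<open>auto intro: less_imp_le\<close>)
  then have "0 \<le> l"
    by (rule tendsto_lowerbound[OF l(2)]) simp
  then have "l \<in> {0, k}" using l(1) k_pos by auto
  then show thesis using l by (intro that)
qed

lemma tendsto_energy:
  assumes "(w \<longlongrightarrow> l) F" "(p \<longlongrightarrow> 0) F"
  shows "(energy \<longlongrightarrow> \<bar>l\<bar> powr (\<alpha> + 2) / (\<alpha> + 2) - \<kappa> * \<gamma> / 2 * l\<^sup>2) F"
proof -
  have "((\<lambda>t. \<bar>w t\<bar> powr (\<alpha> + 2)) \<longlongrightarrow> \<bar>l\<bar> powr (\<alpha> + 2)) F"
    by (rule isCont_tendsto_compose[OF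
      DERIV_isCont[OF has_real_derivative_abs_powr_add_2[OF alpha_pos]] assms(1)])
  then have "(energy \<longlongrightarrow> 0\<^sup>2 / 2 - \<kappa> * \<gamma> / 2 * l\<^sup>2 + \<bar>l\<bar> powr (\<alpha> + 2) / (\<alpha> + 2)) F"
    unfolding energy_def using alpha_pos by (intro tendsto_intros assms) auto
  then show ?thesis by simp
qed

lemma equilibrium_energy_neg: "\<bar>k\<bar> powr (\<alpha> + 2) / (\<alpha> + 2) - \<kappa> * \<gamma> / 2 * k\<^sup>2 < 0"
proof -
  have "\<bar>k\<bar> powr (\<alpha> + 2) = \<kappa> * \<gamma> * k\<^sup>2"
    using k_pos k_powr abs_powr_add_2[of k \<alpha>] by simp
  moreover have "\<kappa> * \<gamma> * k\<^sup>2 / (\<alpha> + 2) < \<kappa> * \<gamma> * k\<^sup>2 / 2"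
    using k_pos alpha_pos kappa_pos gamma_pos by (intro divide_strict_left_mono) auto
  ultimately show ?thesis by simp
qed

text \<open>
  First, \<open>w\<close> decays exponentially at some rate \<open>\<delta> < \<gamma>\<close>. Then \<open>X = - e\<^bsup>\<gamma>t\<^esup> (p - \<kappa> w)\<close> is at least
  \<open>(\<delta> + \<kappa>) e\<^bsup>\<gamma>t\<^esup> w > 0\<close>, and its logarithmic derivative is at most a multiple of \<open>w\<^bsup>\<alpha>\<^esup>\<close>, hence integrable.
  So \<open>X\<close> is bounded, and with it the nondecreasing positive function \<open>e\<^bsup>\<gamma>t\<^esup> w\<close>.
\<close>

lemma stable_manifold_asymptotics:
  assumes pos: "\<And>t. t \<ge> T \<Longrightarrow> 0 < w t"
    and lim_w: "(w \<longlongrightarrow> 0) at_top" and lim_p: "(p \<longlongrightarrow> 0) at_top"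
  obtains \<mu> where "\<mu> > 0" "((\<lambda>t. exp (\<gamma> * t) * w t) \<longlongrightarrow> \<mu>) at_top"
proof -
  \<comment> \<open>\<open>\<delta>\<close> and \<open>n\<close> are positive with \<open>n - \<delta> = \<kappa> - \<gamma>\<close> and \<open>n \<delta> < \<kappa> \<gamma>\<close>, whence \<open>(d/dt - n) (d/dt + \<delta>) w \<ge> 0\<close> for small \<open>w > 0\<close>\<close>
  define m where "m = min \<kappa> \<gamma> / 2"
  define \<delta> where "\<delta> = \<gamma> - m"
  define n where "n = \<kappa> - m"
  have m: "0 < m" "m < \<kappa>" "m < \<gamma>"
    using gamma_pos kappa_pos by (auto simp: m_def min_def)
  have \<delta>: "0 < \<delta>" "0 < n" using m by (auto simp: \<delta>_def n_def)
  have "\<kappa> * \<gamma> - n * \<delta> = m * (\<kappa> + \<gamma> - m)"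
    by (simp add: \<delta>_def n_def algebra_simps)
  also have "\<dots> > 0" using m by (intro mult_pos_pos) auto
  finally have gap: "0 < \<kappa> * \<gamma> - n * \<delta>" .
  have "((\<lambda>t. w t powr \<alpha>) \<longlongrightarrow> 0 powr \<alpha>) at_top"
    using alpha_pos pos
    by (intro tendsto_powr'[OF lim_w] tendsto_const)
      (auto simp: eventually_at_top_linorder intro!: exI[of _ T] less_imp_le)
  then have "\<forall>\<^sub>F t in at_top. w t powr \<alpha> < \<kappa> * \<gamma> - n * \<delta>"
    using order_tendstoD(2)[OF _ gap] by simp
  then obtain S0 where S0: "\<And>t. t \<ge> S0 \<Longrightarrow> w t powr \<alpha> < \<kappa> * \<gamma> - n * \<delta>"
    by (auto simp: eventually_at_top_linorder)
  define S where "S = max S0 T"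
  have S: "w t powr \<alpha> \<le> \<kappa> * \<gamma> - n * \<delta>" "0 < w t" "t \<ge> T" if "t \<ge> S" for t
    using S0[of t] pos[of t] that by (auto simp: S_def)
  have dv: "((\<lambda>t. exp (- n * t) * (p t + \<delta> * w t)) has_real_derivative
     exp (- n * t) * (w t * (\<kappa> * \<gamma> - n * \<delta> - \<bar>w t\<bar> powr \<alpha>))) (at t)" for t
    by (auto intro!: derivative_eq_intros deriv_w deriv_p simp: algebra_simps \<delta>_def n_def)
  have decay: "p s + \<delta> * w s \<le> 0" if s: "s \<ge> S" for s
  proof (rule ccontr)
    assume "\<not> ?thesis"
    then have vs: "p s + \<delta> * w s > 0" by simp
    have "p s + \<delta> * w s \<le> p t + \<delta> * w t" if "t \<ge> s" for t
    proof -
      have "exp (- n * s) * (p s + \<delta> * w s) \<le> exp (- n * t) * (p t + \<delta> * w t)"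
      proof (rule DERIV_nonneg_imp_nondecreasing[OF that])
        fix x assume "s \<le> x"
        then have "0 \<le> exp (- n * x) * (w x * (\<kappa> * \<gamma> - n * \<delta> - \<bar>w x\<bar> powr \<alpha>))"
          using S[of x] s by (intro mult_nonneg_nonneg) auto
        then show "\<exists>y. ((\<lambda>t. exp (- n * t) * (p t + \<delta> * w t)) has_real_derivative y) (at x) \<and> 0 \<le> y"
          using dv by blast
      qed
      then have "exp (n * t) * (exp (- n * s) * (p s + \<delta> * w s)) \<le> exp (n * t) * (exp (- n * t) * (p t + \<delta> * w t))"
        by (rule mult_left_mono) simp
      also have "\<dots> = p t + \<delta> * w t"
        by (simp only: mult.assoc[symmetric] exp_add[symmetric]) simp
      also have "exp (n * t) * (exp (- n * s) * (p s + \<delta> * w s)) = exp (n * (t - s)) * (p s + \<delta> * w s)"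
        by (simp only: mult.assoc[symmetric] exp_add[symmetric]) (simp add: algebra_simps)
      finally have "exp (n * (t - s)) * (p s + \<delta> * w s) \<le> p t + \<delta> * w t" .
      moreover have "1 * (p s + \<delta> * w s) \<le> exp (n * (t - s)) * (p s + \<delta> * w s)"
        using that \<delta> vs by (intro mult_right_mono) auto
      ultimately show ?thesis by simp
    qed
    then have "\<forall>\<^sub>F t in at_top. p s + \<delta> * w s \<le> p t + \<delta> * w t"
      by (auto simp: eventually_at_top_linorder)
    moreover have "((\<lambda>t. p t + \<delta> * w t) \<longlongrightarrow> 0 + \<delta> * 0) at_top"
      by (intro tendsto_intros lim_w lim_p)
    ultimately have "p s + \<delta> * w s \<le> 0 + \<delta> * 0"
      by (intro tendsto_lowerbound) auto
    then show False using vs by simp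
  qed
  define D where "D = exp (\<delta> * S) * w S"
  have D: "0 < D" using S[of S] by (simp add: D_def)
  have w_le: "w t \<le> D * exp (- \<delta> * t)" if "t \<ge> S" for t
  proof -
    have "exp (\<delta> * t) * w t \<le> D"
      unfolding D_def
      by (rule deriv_nonpos_imp_antimono[OF exp_deriv_w _ that]) (use decay in \<open>simp add: mult_le_0_iff\<close>)
    then have "exp (- \<delta> * t) * (exp (\<delta> * t) * w t) \<le> exp (- \<delta> * t) * D"
      by (rule mult_left_mono) simp
    moreover have "exp (- \<delta> * t) * (exp (\<delta> * t) * w t) = w t"
      by (simp only: mult.assoc[symmetric] exp_add[symmetric]) simp
    ultimately show ?thesis by (simp only: mult.commute)
  qed
  define X where "X t = - (exp (\<gamma> * t) * (p t - \<kappa> * w t))" for t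
  have X_ge: "(\<delta> + \<kappa>) * (exp (\<gamma> * t) * w t) \<le> X t" if "t \<ge> S" for t
  proof -
    have "exp (\<gamma> * t) * ((\<delta> + \<kappa>) * w t) \<le> exp (\<gamma> * t) * (- (p t - \<kappa> * w t))"
      using decay[OF that] by (intro mult_left_mono) (auto simp: algebra_simps)
    then show ?thesis
      unfolding X_def by (simp only: mult_minus_right mult.left_commute)
  qed
  have X_pos: "0 < X t" if "t \<ge> S" for t
    by (rule less_le_trans[OF _ X_ge[OF that]]) (use \<delta> kappa_pos S[OF that] in simp)
  \<comment> \<open>\<open>- c e\<^bsup>-\<alpha>\<delta>t\<^esup>\<close> is an antiderivative of the bound for \<open>X' / X\<close>\<close>
  define c where "c = D powr \<alpha> / ((\<delta> + \<kappa>) * (\<alpha> * \<delta>))"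
  have dX: "(X has_real_derivative exp (\<gamma> * t) * (\<bar>w t\<bar> powr \<alpha> * w t)) (at t)" for t
    unfolding X_def using DERIV_minus[OF exp_deriv_stable[of t]] by simp
  have dl: "((\<lambda>t. ln (X t) + c * exp (- (\<alpha> * \<delta>) * t)) has_real_derivative
     (exp (\<gamma> * t) * (\<bar>w t\<bar> powr \<alpha> * w t)) / X t - D powr \<alpha> / (\<delta> + \<kappa>) * exp (- (\<alpha> * \<delta>) * t)) (at t)"
    if "t \<ge> S" for t
  proof -
    have "c * (\<alpha> * \<delta>) = D powr \<alpha> / (\<delta> + \<kappa>)"
      using \<delta> alpha_pos by (simp add: c_def)
    moreover have "((\<lambda>t. ln (X t) + c * exp (- (\<alpha> * \<delta>) * t)) has_real_derivative
     (exp (\<gamma> * t) * (\<bar>w t\<bar> powr \<alpha> * w t)) / X t - c * (\<alpha> * \<delta>) * exp (- (\<alpha> * \<delta>) * t)) (at t)"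
      using X_pos[OF that] by (auto intro!: derivative_eq_intros dX)
    ultimately show ?thesis by simp
  qed
  have dl_le: "(exp (\<gamma> * t) * (\<bar>w t\<bar> powr \<alpha> * w t)) / X t - D powr \<alpha> / (\<delta> + \<kappa>) * exp (- (\<alpha> * \<delta>) * t) \<le> 0"
    if "t \<ge> S" for t
  proof -
    have "w t powr \<alpha> \<le> (D * exp (- \<delta> * t)) powr \<alpha>"
      using w_le[OF that] S[OF that] alpha_pos by (intro powr_mono2) auto
    also have "\<dots> = D powr \<alpha> * exp (- (\<alpha> * \<delta>) * t)"
      using D by (simp add: powr_mult exp_powr_real mult_ac)
    finally have wa: "w t powr \<alpha> \<le> D powr \<alpha> * exp (- (\<alpha> * \<delta>) * t)" .
    have "(exp (\<gamma> * t) * (\<bar>w t\<bar> powr \<alpha> * w t)) / X t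
        \<le> (exp (\<gamma> * t) * (\<bar>w t\<bar> powr \<alpha> * w t)) / ((\<delta> + \<kappa>) * (exp (\<gamma> * t) * w t))"
      using X_ge[OF that] S[OF that] \<delta> kappa_pos X_pos[OF that] by (intro divide_left_mono mult_pos_pos) auto
    also have "\<dots> = w t powr \<alpha> / (\<delta> + \<kappa>)"
      using S[OF that] by simp
    also have "\<dots> \<le> D powr \<alpha> * exp (- (\<alpha> * \<delta>) * t) / (\<delta> + \<kappa>)"
      using wa \<delta> kappa_pos by (intro divide_right_mono) auto
    finally show ?thesis by simp
  qed
  have X_le: "X t \<le> exp (ln (X S) + c * exp (- (\<alpha> * \<delta>) * S))" if "t \<ge> S" for t
  proof -
    have "ln (X t) + c * exp (- (\<alpha> * \<delta>) * t) \<le> ln (X S) + c * exp (- (\<alpha> * \<delta>) * S)"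
      by (rule deriv_nonpos_imp_antimono[OF dl dl_le that]) auto
    moreover have "0 \<le> c * exp (- (\<alpha> * \<delta>) * t)"
      using \<delta> alpha_pos kappa_pos by (simp add: c_def)
    ultimately have "ln (X t) \<le> ln (X S) + c * exp (- (\<alpha> * \<delta>) * S)" by linarith
    then have "exp (ln (X t)) \<le> exp (ln (X S) + c * exp (- (\<alpha> * \<delta>) * S))" by simp
    then show ?thesis using X_pos[OF that] by simp
  qed
  obtain \<mu> where \<mu>: "((\<lambda>t. exp (\<gamma> * t) * w t) \<longlongrightarrow> \<mu>) at_top" "\<And>t. S \<le> t \<Longrightarrow> exp (\<gamma> * t) * w t \<le> \<mu>"
  proof (rule monotone_bounded_tendsto_at_top[of S "\<lambda>t. exp (\<gamma> * t) * w t"])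
    fix s t assume "S \<le> s" "s \<le> t"
    show "exp (\<gamma> * s) * w s \<le> exp (\<gamma> * t) * w t"
    proof (rule DERIV_nonneg_imp_nondecreasing[OF \<open>s \<le> t\<close>])
      fix x assume "s \<le> x"
      then have "0 \<le> exp (\<gamma> * x) * (p x + \<gamma> * w x)"
        using positive_imp_log_derivative_ge[OF pos, of x] S(3)[of x] \<open>S \<le> s\<close> by simp
      then show "\<exists>y. ((\<lambda>t. exp (\<gamma> * t) * w t) has_real_derivative y) (at x) \<and> 0 \<le> y"
        using exp_deriv_w by blast
    qed
  next
    fix t assume "S \<le> t"
    have "(\<delta> + \<kappa>) * (exp (\<gamma> * t) * w t) \<le> exp (ln (X S) + c * exp (- (\<alpha> * \<delta>) * S))"
      using X_ge X_le \<open>S \<le> t\<close> by (meson order_trans)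
    then show "exp (\<gamma> * t) * w t \<le> exp (ln (X S) + c * exp (- (\<alpha> * \<delta>) * S)) / (\<delta> + \<kappa>)"
      using \<delta> kappa_pos by (simp add: pos_le_divide_eq mult.commute)
  qed blast
  have "0 < exp (\<gamma> * S) * w S" using S[of S] by simp
  then have "0 < \<mu>" using \<mu>(2)[of S] by linarith
  then show thesis using \<mu>(1) by (rule that)
qed

end

section \<open>Global dynamics under negative damping\<close>

lemma emden_fowler_unique:
  assumes ef: "emden_fowler \<alpha> \<kappa> \<gamma> w p" "emden_fowler \<alpha> \<kappa> \<gamma> v q"
    and init: "w s = v s" "p s = q s"
  shows "w t = v t \<and> p t = q t"
proof (cases "s \<le> t")
  case True
  then show ?thesis by (rule emden_fowler_unique_forward[OF ef init])
next
  case False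
  have "w (- (- t)) = v (- (- t)) \<and> - p (- (- t)) = - q (- (- t))"
    by (rule emden_fowler_unique_forward[OF emden_fowler.reversed[OF ef(1)]
          emden_fowler.reversed[OF ef(2)], of "- s" "- t"]) (use init False in auto)
  then show ?thesis by simp
qed

context emden_fowler
begin

lemma constant_solution:
  assumes "l \<in> {0, k, - k}"
  shows "emden_fowler \<alpha> \<kappa> \<gamma> (\<lambda>_. l) (\<lambda>_. 0)"
proof
  have eq: "(\<kappa> - \<gamma>) * 0 + \<kappa> * \<gamma> * l - \<bar>l\<bar> powr \<alpha> * l = 0"
    using assms k_pos k_powr by auto
  show "((\<lambda>_. 0) has_real_derivative (\<kappa> - \<gamma>) * 0 + \<kappa> * \<gamma> * l - \<bar>l\<bar> powr \<alpha> * l) (at t)" for t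
    unfolding eq by (rule DERIV_const)
qed (use alpha_pos kappa_pos gamma_pos in auto)

lemma energy_negated: "emden_fowler.energy \<alpha> \<kappa> \<gamma> (\<lambda>t. - w t) (\<lambda>t. - p t) = energy"
  by (simp add: fun_eq_iff energy_def emden_fowler.energy_def[OF negated])

lemma k_reversed: "emden_fowler.k \<alpha> \<gamma> \<kappa> = k"
  by (simp add: k_def emden_fowler.k_def[OF reversed] mult.commute)

end

text \<open>
  Here the energy is nondecreasing in time.
\<close>

locale subcritical_emden_fowler = emden_fowler +
  assumes gamma_less_kappa: "\<gamma> < \<kappa>"
begin

lemma subcritical_negated: "subcritical_emden_fowler \<alpha> \<kappa> \<gamma> (\<lambda>t. - w t) (\<lambda>t. - p t)"
  by (intro subcritical_emden_fowler.intro negated subcritical_emden_fowler_axioms.intro gamma_less_kappa)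

lemma energy_mono: "s \<le> t \<Longrightarrow> energy s \<le> energy t"
  by (rule DERIV_nonneg_imp_nondecreasing) (use deriv_energy gamma_less_kappa in force)+

text \<open>
  If the energy takes the same value at two times, then \<open>p\<close> vanishes in between, so that some point of the orbit is an
  equilibrium; by uniqueness the orbit stays there.
\<close>

lemma energy_strict_mono:
  assumes "s < t" and nonconst: "\<not> (\<exists>l\<in>{0, k, - k}. \<forall>t. w t = l)"
  shows "energy s < energy t"
proof (rule ccontr)
  assume "\<not> ?thesis"
  then have eq: "energy x = energy s" if "s \<le> x" "x \<le> t" for x
    using energy_mono[of s x] energy_mono[of x t] that by auto
  have p0: "p x = 0" if x: "x \<in> {s<..<t}" for x
  proof -
    have "((\<lambda>_. energy s) has_real_derivative (\<kappa> - \<gamma>) * (p x)\<^sup>2) (at x)"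
      by (rule has_field_derivative_transform_within_open[OF deriv_energy, of "{s<..<t}"])
        (use x in \<open>auto intro: eq\<close>)
    then have "(\<kappa> - \<gamma>) * (p x)\<^sup>2 = 0"
      using DERIV_unique DERIV_const by blast
    then show ?thesis using gamma_less_kappa by simp
  qed
  obtain m where m: "m \<in> {s<..<t}" using dense[OF \<open>s < t\<close>] by auto
  have "((\<lambda>_. 0) has_real_derivative
      (\<kappa> - \<gamma>) * p m + \<kappa> * \<gamma> * w m - \<bar>w m\<bar> powr \<alpha> * w m) (at m)"
    by (rule has_field_derivative_transform_within_open[OF deriv_p, of "{s<..<t}"])
      (use p0 m in auto)
  then have "(\<kappa> - \<gamma>) * p m + \<kappa> * \<gamma> * w m - \<bar>w m\<bar> powr \<alpha> * w m = 0"
    by (rule DERIV_unique[OF _ DERIV_const])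
  then have l: "w m \<in> {0, k, - k}"
    using p0[OF m] by (intro equilibrium_cases) simp
  have "w x = w m" for x
    by (rule conjunct1[OF emden_fowler_unique[OF emden_fowler_axioms constant_solution[OF l], where s = m]])
      (simp_all add: p0[OF m])
  then have "\<exists>l\<in>{0, k, - k}. \<forall>t. w t = l"
    by (intro bexI[OF _ l] allI)
  then show False using nonconst by (rule notE[rotated])
qed

text \<open>
  The power \<open>|w|\<^bsup>\<alpha>+2\<^esup>\<close> grows faster than \<open>w\<^sup>2\<close>, so it absorbs the quadratic terms up to a constant.
\<close>

lemma energy_coercive:
  obtains K where "0 \<le> K" "\<And>t. (w t)\<^sup>2 / 2 + (p t)\<^sup>2 / 2 \<le> energy t + K"
proof -
  \<comment> \<open>\<open>a\<close> collects \<open>\<kappa> \<gamma> / 2\<close> from the energy and \<open>1 / 2\<close> from the left-hand side; for \<open>|x| \<ge> R\<close> the power dominates \<open>a x\<^sup>2\<close>\<close>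
  define a where "a = (\<kappa> * \<gamma> + 1) / 2"
  define R where "R = ((\<alpha> + 2) * a) powr (1 / \<alpha>)"
  have a: "a > 0" using kappa_pos gamma_pos by (simp add: a_def add_pos_pos)
  have R: "R > 0" "R powr \<alpha> = (\<alpha> + 2) * a"
    using a alpha_pos by (auto simp: R_def powr_powr)
  have main: "a * x\<^sup>2 \<le> \<bar>x\<bar> powr (\<alpha> + 2) / (\<alpha> + 2) + a * R\<^sup>2" for x :: real
  proof (cases "\<bar>x\<bar> \<le> R")
    case True
    then have "x\<^sup>2 \<le> R\<^sup>2" using R by (simp add: abs_le_square_iff[symmetric])
    then have "a * x\<^sup>2 \<le> a * R\<^sup>2" using a by simp
    moreover have "0 \<le> \<bar>x\<bar> powr (\<alpha> + 2) / (\<alpha> + 2)" using alpha_pos by simp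
    ultimately show ?thesis by linarith
  next
    case False
    have "R powr \<alpha> \<le> \<bar>x\<bar> powr \<alpha>"
      using False R alpha_pos by (intro powr_mono2) auto
    then have "(\<alpha> + 2) * a * x\<^sup>2 \<le> \<bar>x\<bar> powr \<alpha> * x\<^sup>2"
      using R by (intro mult_right_mono) auto
    then have "a * x\<^sup>2 \<le> \<bar>x\<bar> powr (\<alpha> + 2) / (\<alpha> + 2)"
      using alpha_pos by (simp add: abs_powr_add_2 pos_le_divide_eq mult_ac)
    moreover have "0 \<le> a * R\<^sup>2" using a by simp
    ultimately show ?thesis by linarith
  qed
  show thesis
  proof (rule that[of "a * R\<^sup>2"])
    show "0 \<le> a * R\<^sup>2" using a by simp
    show "(w t)\<^sup>2 / 2 + (p t)\<^sup>2 / 2 \<le> energy t + a * R\<^sup>2" for t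
      using main[of "w t"] by (simp add: energy_def a_def algebra_simps add_divide_distrib)
  qed
qed

text \<open>
  By coercivity \<open>(E + K)' \<le> 2 (\<kappa> - \<gamma>) (E + K)\<close>, and \<open>w\<^sup>2 \<le> 2 (E + K)\<close>.
\<close>

lemma exponential_growth_bound:
  obtains C where "0 \<le> C" "\<And>t. 0 \<le> t \<Longrightarrow> \<bar>w t\<bar> \<le> C * exp ((\<kappa> - \<gamma>) * t)"
proof -
  obtain K where K: "0 \<le> K" "\<And>t. (w t)\<^sup>2 / 2 + (p t)\<^sup>2 / 2 \<le> energy t + K"
    using energy_coercive by blast
  define C where "C = sqrt (2 * (energy 0 + K))"
  have E0: "0 \<le> energy 0 + K" using K(2)[of 0] zero_le_power2[of "w 0"] zero_le_power2[of "p 0"] by linarith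
  have C2: "C\<^sup>2 = 2 * (energy 0 + K)" using E0 by (simp add: C_def)
  have "\<bar>w t\<bar> \<le> C * exp ((\<kappa> - \<gamma>) * t)" if t: "0 \<le> t" for t
  proof -
    have "energy t + K \<le> (energy 0 + K) * exp (2 * (\<kappa> - \<gamma>) * (t - 0))"
    proof (rule gronwall[OF _ _ t])
      show "((\<lambda>t. energy t + K) has_real_derivative (\<kappa> - \<gamma>) * (p x)\<^sup>2) (at x)" for x
        using DERIV_add[OF deriv_energy DERIV_const[of K]] by simp
      show "(\<kappa> - \<gamma>) * (p x)\<^sup>2 \<le> 2 * (\<kappa> - \<gamma>) * (energy x + K)" for x
      proof -
        have "(p x)\<^sup>2 / 2 \<le> energy x + K"
          using K(2)[of x] zero_le_power2[of "w x"] by linarith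
        then have "(p x)\<^sup>2 \<le> 2 * (energy x + K)" by simp
        then have "(\<kappa> - \<gamma>) * (p x)\<^sup>2 \<le> (\<kappa> - \<gamma>) * (2 * (energy x + K))"
          using gamma_less_kappa by (intro mult_left_mono) auto
        then show ?thesis by (simp only: mult_ac)
      qed
    qed
    then have "(w t)\<^sup>2 / 2 \<le> (energy 0 + K) * exp (2 * (\<kappa> - \<gamma>) * (t - 0))"
      using K(2)[of t] zero_le_power2[of "p t"] by linarith
    then have "(w t)\<^sup>2 \<le> 2 * ((energy 0 + K) * exp (2 * (\<kappa> - \<gamma>) * (t - 0)))"
      by linarith
    then have "(w t)\<^sup>2 \<le> C\<^sup>2 * exp (2 * ((\<kappa> - \<gamma>) * t))"
      by (simp only: C2 mult.assoc diff_zero)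
    also have "\<dots> = (C * exp ((\<kappa> - \<gamma>) * t))\<^sup>2"
      by (simp only: power_mult_distrib exp_double)
    finally show ?thesis
      using E0 by (simp add: abs_le_square_iff[symmetric] C_def)
  qed
  moreover have "0 \<le> C" using E0 by (simp add: C_def)
  ultimately show thesis using that by blast
qed

lemma bounded_in_the_past:
  obtains M where "\<And>t. t \<le> s \<Longrightarrow> \<bar>w t\<bar> \<le> M" "\<And>t. t \<le> s \<Longrightarrow> \<bar>p t\<bar> \<le> M"
proof -
  obtain K where K: "0 \<le> K" "\<And>t. (w t)\<^sup>2 / 2 + (p t)\<^sup>2 / 2 \<le> energy t + K"
    using energy_coercive by blast
  define M where "M = sqrt (2 * (energy s + K))"
  have le: "(w t)\<^sup>2 \<le> M\<^sup>2 \<and> (p t)\<^sup>2 \<le> M\<^sup>2" "0 \<le> M" if "t \<le> s" for t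
  proof -
    have E: "(w t)\<^sup>2 / 2 + (p t)\<^sup>2 / 2 \<le> energy s + K"
      using K(2)[of t] energy_mono[OF that] by linarith
    have "0 \<le> energy s + K"
      using E zero_le_power2[of "w t"] zero_le_power2[of "p t"] by linarith
    then have "(w t)\<^sup>2 / 2 \<le> energy s + K" "(p t)\<^sup>2 / 2 \<le> energy s + K"
      using E zero_le_power2[of "w t"] zero_le_power2[of "p t"] by linarith+
    moreover have "M\<^sup>2 = 2 * (energy s + K)" "0 \<le> M"
      using \<open>0 \<le> energy s + K\<close> by (simp_all only: M_def real_sqrt_pow2 real_sqrt_ge_zero mult_nonneg_nonneg zero_le_numeral)
    ultimately show "(w t)\<^sup>2 \<le> M\<^sup>2 \<and> (p t)\<^sup>2 \<le> M\<^sup>2" "0 \<le> M"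
      by auto
  qed
  show thesis
    by (rule that[of M]) (use le abs_le_square_iff[of _ M] in force)+
qed

lemma tendsto_at_bot:
  obtains l where "l \<in> {0, k, - k}" "(w \<longlongrightarrow> l) at_bot" "(p \<longlongrightarrow> 0) at_bot"
proof -
  interpret R: emden_fowler \<alpha> \<gamma> \<kappa> "\<lambda>t. w (- t)" "\<lambda>t. - p (- t)" by (rule reversed)
  obtain M where M: "\<And>t. t \<le> 0 \<Longrightarrow> \<bar>w t\<bar> \<le> M" "\<And>t. t \<le> 0 \<Longrightarrow> \<bar>p t\<bar> \<le> M"
    using bounded_in_the_past[of 0] by blast
  obtain l where l: "l \<in> {0, R.k, - R.k}" "((\<lambda>t. w (- t)) \<longlongrightarrow> l) at_top" "((\<lambda>t. - p (- t)) \<longlongrightarrow> 0) at_top"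
    by (rule R.bounded_imp_tendsto_equilibrium[of 0 M]) (use M gamma_less_kappa in auto)
  have "(p \<longlongrightarrow> 0) at_bot"
    using tendsto_minus[OF l(3)] by (simp add: filterlim_at_bot_mirror)
  then show thesis
    using l k_reversed by (intro that[of l]) (auto simp: filterlim_at_bot_mirror)
qed

text \<open>
  A nonnegative solution of positive energy cannot touch \<open>0\<close>, since it would have \<open>w = p = 0\<close> and \<open>E = 0\<close> there. So it is positive
  and converges to \<open>0\<close> or \<open>k\<close>, where the energy is not positive, although \<open>E\<close> is nondecreasing.
\<close>

lemma positive_energy_imp_takes_negative:
  assumes "energy s > 0"
  shows "\<exists>t>T. w t < 0"
proof (rule ccontr)
  assume "\<not> ?thesis"
  then have nonneg: "0 \<le> w t" if "t > T" for t using that not_less by blast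
  define S where "S = max T s + 1"
  have pos: "0 < w t" if t: "t \<ge> S" for t
  proof (rule ccontr)
    assume "\<not> ?thesis"
    then have w0: "w t = 0" using nonneg[of t] t by (simp add: S_def)
    have "p t = 0"
      by (rule DERIV_local_min[OF deriv_w, of 1]) (use nonneg w0 t in \<open>auto simp: S_def\<close>)
    then have "energy t = 0" using w0 by (simp add: energy_def)
    moreover have "s \<le> t" using t by (simp add: S_def)
    ultimately show False using energy_mono[of s t] assms by simp
  qed
  obtain l where l: "l \<in> {0, k}" "(w \<longlongrightarrow> l) at_top" "(p \<longlongrightarrow> 0) at_top"
    by (rule positive_imp_tendsto[OF _ pos]) (use gamma_less_kappa in auto)
  have "\<forall>\<^sub>F t in at_top. energy s \<le> energy t"
    using eventually_ge_at_top[of s] by eventually_elim (rule energy_mono)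
  then have "energy s \<le> \<bar>l\<bar> powr (\<alpha> + 2) / (\<alpha> + 2) - \<kappa> * \<gamma> / 2 * l\<^sup>2"
    by (intro tendsto_lowerbound[OF tendsto_energy[OF l(2,3)]]) auto
  also have "\<dots> \<le> 0" using l(1) equilibrium_energy_neg by auto
  finally show False using assms by simp
qed

lemma positive_energy_imp_oscillates:
  assumes "energy s > 0"
  shows "\<exists>t>T. w t > 0" "\<exists>t>T. w t < 0"
  using positive_energy_imp_takes_negative[OF assms]
    subcritical_emden_fowler.positive_energy_imp_takes_negative[OF subcritical_negated, of s T]
    assms by (auto simp: energy_negated)

lemma vanishing_imp_energy_pos:
  assumes lim: "(w \<longlongrightarrow> 0) at_bot" and nonzero: "w s \<noteq> 0"
  shows "0 < energy t"
proof -
  obtain l where l: "l \<in> {0, k, - k}" "(w \<longlongrightarrow> l) at_bot" "(p \<longlongrightarrow> 0) at_bot"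
    by (rule tendsto_at_bot)
  have "(energy \<longlongrightarrow> 0) at_bot"
    using tendsto_energy[OF lim l(3)] by simp
  then have ge: "0 \<le> energy t" for t
    by (rule tendsto_upperbound)
      (auto simp: eventually_at_bot_linorder intro!: exI[of _ t] energy_mono)
  have "\<not> (\<exists>l\<in>{0, k, - k}. \<forall>t. w t = l)"
  proof
    assume "\<exists>l\<in>{0, k, - k}. \<forall>t. w t = l"
    then obtain l where "\<forall>t. w t = l" by blast
    then have "w = (\<lambda>_. l)" by auto
    then have "l = 0" using lim by (simp add: tendsto_const_iff)
    then show False using nonzero \<open>\<forall>t. w t = l\<close> by simp
  qed
  then have "energy (t - 1) < energy t" by (intro energy_strict_mono) auto
  then show ?thesis using ge[of "t - 1"] by linarith
qed

text \<open>
  Near \<open>-\<infinity>\<close> the solution is so small that the potential part of the energy is at most \<open>0\<close>. As \<open>E > 0\<close>, the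
  derivative \<open>p\<close> has no zeros there, so that \<open>w\<close> is strictly monotone and starts from the limit \<open>0\<close>.
\<close>

lemma vanishing_imp_sign:
  assumes lim: "(w \<longlongrightarrow> 0) at_bot" and nonzero: "w s \<noteq> 0"
  obtains T where "(\<forall>t\<le>T. 0 < w t) \<or> (\<forall>t\<le>T. w t < 0)"
proof -
  have "\<forall>\<^sub>F t in at_bot. \<bar>w t\<bar> < k"
    using tendstoD[OF lim k_pos] by simp
  then obtain T where T: "\<And>t. t \<le> T \<Longrightarrow> \<bar>w t\<bar> < k" by (auto simp: eventually_at_bot_linorder)
  have p0: "p t \<noteq> 0" if "t \<le> T" for t
  proof
    assume "p t = 0"
    then have "0 < \<bar>w t\<bar> powr (\<alpha> + 2) / (\<alpha> + 2) - \<kappa> * \<gamma> / 2 * (w t)\<^sup>2"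
      using vanishing_imp_energy_pos[OF assms, of t] by (simp add: energy_def)
    moreover have "\<bar>w t\<bar> powr \<alpha> \<le> \<kappa> * \<gamma>"
      unfolding k_powr[symmetric] using T[OF that] alpha_pos by (intro powr_mono2) auto
    then have "\<bar>w t\<bar> powr (\<alpha> + 2) \<le> \<kappa> * \<gamma> * (w t)\<^sup>2"
      unfolding abs_powr_add_2 by (intro mult_right_mono) auto
    then have "\<bar>w t\<bar> powr (\<alpha> + 2) / (\<alpha> + 2) \<le> \<kappa> * \<gamma> * (w t)\<^sup>2 / (\<alpha> + 2)"
      using alpha_pos by (intro divide_right_mono) auto
    moreover have "\<kappa> * \<gamma> * (w t)\<^sup>2 / (\<alpha> + 2) \<le> \<kappa> * \<gamma> * (w t)\<^sup>2 / 2"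
      using alpha_pos kappa_pos gamma_pos by (intro divide_left_mono) auto
    ultimately have "0 < \<kappa> * \<gamma> * (w t)\<^sup>2 / 2 - \<kappa> * \<gamma> / 2 * (w t)\<^sup>2" by linarith
    then show False by simp
  qed
  have sign: "(\<forall>t\<le>T. 0 < p t) \<or> (\<forall>t\<le>T. p t < 0)"
  proof (rule ccontr)
    assume "\<not> ?thesis"
    then obtain a b where ab: "a \<le> T" "b \<le> T" "p a \<le> 0" "0 \<le> p b" by (auto simp: not_less)
    have "\<exists>x. min a b \<le> x \<and> x \<le> max a b \<and> p x = 0"
    proof (cases "a \<le> b")
      case True
      then show ?thesis using IVT[of p a 0 b] ab isCont_p by auto
    next
      case False
      then show ?thesis using IVT2[of p a 0 b] ab isCont_p by auto
    qed
    then show False using p0 ab by (auto simp: max_def split: if_splits)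
  qed
  from sign have "(\<forall>t\<le>T. 0 < w t) \<or> (\<forall>t\<le>T. w t < 0)"
  proof
    assume *: "\<forall>t\<le>T. 0 < p t"
    have "0 < w t" if "t \<le> T" for t
    proof (rule DERIV_pos_imp_increasing_at_bot[OF _ lim])
      fix x assume "x \<le> t"
      then have "0 < p x" using * that by simp
      then show "\<exists>y. (w has_real_derivative y) (at x) \<and> 0 < y"
        using deriv_w by blast
    qed
    then show ?thesis by simp
  next
    assume *: "\<forall>t\<le>T. p t < 0"
    have "- 0 < - w t" if "t \<le> T" for t
    proof (rule DERIV_pos_imp_increasing_at_bot[OF _ tendsto_minus[OF lim]])
      fix x assume "x \<le> t"
      then have "0 < - p x" using * that by simp
      then show "\<exists>y. ((\<lambda>t. - w t) has_real_derivative y) (at x) \<and> 0 < y"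
        using DERIV_minus[OF deriv_w] by blast
    qed
    then show ?thesis by simp
  qed
  then show thesis by (rule that)
qed

text \<open>
  Time reversal turns the unstable manifold of \<open>0\<close> into the stable one and \<open>\<kappa>\<close> into \<open>\<gamma>\<close>.
\<close>

lemma vanishing_asymptotics:
  assumes lim: "(w \<longlongrightarrow> 0) at_bot"
  obtains \<mu> where "((\<lambda>t. exp (- \<kappa> * t) * w t) \<longlongrightarrow> \<mu>) at_bot"
proof -
  obtain l where l: "l \<in> {0, k, - k}" "(w \<longlongrightarrow> l) at_bot" "(p \<longlongrightarrow> 0) at_bot"
    by (rule tendsto_at_bot)
  note concl = that
  have main: thesis if v: "subcritical_emden_fowler \<alpha> \<kappa> \<gamma> v q" and "(v \<longlongrightarrow> 0) at_bot" "(q \<longlongrightarrow> 0) at_bot"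
    and pos: "\<forall>t\<le>T. 0 < v t" and c: "\<And>t. w t = c * v t" for v q T c
  proof -
    interpret V: subcritical_emden_fowler \<alpha> \<kappa> \<gamma> v q by (rule v)
    interpret R: emden_fowler \<alpha> \<gamma> \<kappa> "\<lambda>t. v (- t)" "\<lambda>t. - q (- t)" by (rule V.reversed)
    have lims: "((\<lambda>t. v (- t)) \<longlongrightarrow> 0) at_top" "((\<lambda>t. - q (- t)) \<longlongrightarrow> 0) at_top"
      using that(2) tendsto_minus[OF that(3)] by (auto simp: filterlim_at_bot_mirror)
    obtain \<mu> where "((\<lambda>t. exp (\<kappa> * t) * v (- t)) \<longlongrightarrow> \<mu>) at_top"
      by (rule R.stable_manifold_asymptotics[of "- T", OF _ lims]) (use pos in auto)
    then have "((\<lambda>t. exp (- \<kappa> * t) * v t) \<longlongrightarrow> \<mu>) at_bot"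
      by (simp add: filterlim_at_bot_mirror)
    then have "((\<lambda>t. c * (exp (- \<kappa> * t) * v t)) \<longlongrightarrow> c * \<mu>) at_bot"
      by (intro tendsto_intros)
    then have "((\<lambda>t. exp (- \<kappa> * t) * w t) \<longlongrightarrow> c * \<mu>) at_bot"
      unfolding c by (simp only: mult.left_commute)
    then show thesis by (rule concl)
  qed
  show thesis
  proof (cases "\<exists>s. w s \<noteq> 0")
    case False
    then show thesis by (intro that[of 0]) simp
  next
    case True
    then obtain s where "w s \<noteq> 0" by blast
    then obtain T where "(\<forall>t\<le>T. 0 < w t) \<or> (\<forall>t\<le>T. w t < 0)"
      by (rule vanishing_imp_sign[OF lim])
    then show thesis
    proof
      assume "\<forall>t\<le>T. 0 < w t"
      then show thesis
        by (rule main[OF subcritical_emden_fowler_axioms lim l(3), of _ 1]) simp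
    next
      assume "\<forall>t\<le>T. w t < 0"
      then show thesis
        using main[OF subcritical_negated, of T "-1"] tendsto_minus[OF lim] tendsto_minus[OF l(3)]
        by simp
    qed
  qed
qed

lemma negative_energy_imp_constant_sign:
  assumes "\<And>t. energy t < 0"
  shows "(\<forall>t. 0 < w t) \<or> (\<forall>t. w t < 0)"
proof (rule ccontr)
  assume "\<not> ?thesis"
  then obtain a b where ab: "w a \<le> 0" "0 \<le> w b" by (auto simp: not_less)
  have "\<exists>x. w x = 0"
  proof (cases "a \<le> b")
    case True
    then show ?thesis using IVT[of w a 0 b] ab isCont_w by auto
  next
    case False
    then show ?thesis using IVT2[of w a 0 b] ab isCont_w by auto
  qed
  then obtain x where "w x = 0" by blast
  then have "0 \<le> energy x" by (simp add: energy_def)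
  then show False using assms[of x] by simp
qed

text \<open>
  If \<open>w\<close> tends to \<open>k\<close> at both ends, the energy has the same limit at both ends and is constant, which leaves only the
  equilibrium. Otherwise \<open>w\<close> tends to \<open>0\<close> at \<open>+\<infinity>\<close>, along the stable manifold.
\<close>

lemma positive_imp_classified:
  assumes lim: "(w \<longlongrightarrow> k) at_bot" and pos: "\<And>t. 0 < w t"
  shows "(\<forall>t. w t = k) \<or> (\<exists>\<mu>>0. ((\<lambda>t. exp (\<gamma> * t) * w t) \<longlongrightarrow> \<mu>) at_top)"
proof -
  obtain l where l: "l \<in> {0, k, - k}" "(w \<longlongrightarrow> l) at_bot" "(p \<longlongrightarrow> 0) at_bot"
    by (rule tendsto_at_bot)
  obtain m where m: "m \<in> {0, k}" "(w \<longlongrightarrow> m) at_top" "(p \<longlongrightarrow> 0) at_top"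
    by (rule positive_imp_tendsto[of 0]) (use gamma_less_kappa pos in auto)
  show ?thesis
  proof (cases "m = 0")
    case True
    then show ?thesis using stable_manifold_asymptotics[of 0] pos m by metis
  next
    case False
    then have "m = k" using m by simp
    define e where "e = \<bar>k\<bar> powr (\<alpha> + 2) / (\<alpha> + 2) - \<kappa> * \<gamma> / 2 * k\<^sup>2"
    have "(energy \<longlongrightarrow> e) at_bot" "(energy \<longlongrightarrow> e) at_top"
      using tendsto_energy[OF lim l(3)] tendsto_energy[OF m(2,3)] \<open>m = k\<close> by (auto simp: e_def)
    note lims = this
    have "energy t = e" for t
    proof (rule antisym)
      show "energy t \<le> e"
        by (rule tendsto_lowerbound[OF lims(2)])
          (auto simp: eventually_at_top_linorder intro!: exI[of _ t] energy_mono)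
      show "e \<le> energy t"
        by (rule tendsto_upperbound[OF lims(1)])
          (auto simp: eventually_at_bot_linorder intro!: exI[of _ t] energy_mono)
    qed
    then have "\<exists>l\<in>{0, k, - k}. \<forall>t. w t = l"
      using energy_strict_mono[of 0 1] by auto
    then show ?thesis using pos[of 0] k_pos by auto
  qed
qed

end

section \<open>Uniqueness of the fast decaying solution\<close>

lemma le_limit_if_deriv_nonneg:
  fixes f f' :: "real \<Rightarrow> real"
  assumes "\<And>t. t \<ge> T \<Longrightarrow> (f has_real_derivative f' t) (at t)" "\<And>t. t \<ge> T \<Longrightarrow> 0 \<le> f' t"
    and "(f \<longlongrightarrow> l) at_top" and "T \<le> s"
  shows "f s \<le> l"
proof (rule tendsto_lowerbound[OF assms(3)])
  show "\<forall>\<^sub>F t in at_top. f s \<le> f t"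
    using eventually_ge_at_top[of s]
  proof eventually_elim
    fix t assume "s \<le> t"
    then show "f s \<le> f t"
    proof (rule DERIV_nonneg_imp_nondecreasing)
      fix x assume "s \<le> x"
      then have "T \<le> x" using \<open>T \<le> s\<close> by simp
      then show "\<exists>y. (f has_real_derivative y) (at x) \<and> 0 \<le> y"
        using assms(1,2) by blast
    qed
  qed
qed simp

lemma (in subcritical_emden_fowler) fast_decay_imp_tendsto_0:
  assumes pos: "\<And>t. 0 < w t" and lim: "((\<lambda>t. exp (\<gamma> * t) * w t) \<longlongrightarrow> \<mu>) at_top"
  shows "(w \<longlongrightarrow> 0) at_top \<and> (p \<longlongrightarrow> 0) at_top"
proof -
  have "((\<lambda>t. exp (- (\<gamma> * t))) \<longlongrightarrow> 0) at_top"
    by (rule filterlim_compose[OF exp_at_bot])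
      (use gamma_pos in \<open>auto simp: filterlim_uminus_at_bot intro!: filterlim_tendsto_pos_mult_at_top[OF tendsto_const _ filterlim_ident]\<close>)
  from tendsto_mult[OF this lim]
  have "((\<lambda>t. exp (- (\<gamma> * t)) * (exp (\<gamma> * t) * w t)) \<longlongrightarrow> 0) at_top" by simp
  moreover have "exp (- (\<gamma> * t)) * (exp (\<gamma> * t) * w t) = w t" for t
    by (simp only: mult.assoc[symmetric] exp_add[symmetric]) simp
  ultimately have "(w \<longlongrightarrow> 0) at_top" by simp
  moreover have "(p \<longlongrightarrow> 0) at_top"
    by (rule positive_imp_tendsto[of 0]) (use gamma_less_kappa pos in auto)
  ultimately show ?thesis ..
qed

text \<open>
  For large times both solutions lie where \<open>G x = \<kappa> \<gamma> x - x\<^bsup>\<alpha>+1\<^esup>\<close> is nondecreasing, and therefore the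
  weighted product \<open>e\<^bsup>-(\<kappa>-\<gamma>)t\<^esup> (w - v) (w - v)'\<close> is nondecreasing. It tends to \<open>0\<close>, so it is at most \<open>0\<close>, and
  \<open>(w - v)\<^sup>2\<close> is nonincreasing: if the solutions meet at a large time they agree from then on, hence everywhere. If
  they do not meet, one of them is larger, say \<open>w > v\<close>. Then the weighted Wronskian has a sign by
  monotonicity, so \<open>w / v\<close> is nondecreasing; but its limit is \<open>\<mu> / \<mu> = 1\<close>, a contradiction.
\<close>

lemma fast_decay_unique:
  assumes w: "subcritical_emden_fowler \<alpha> \<kappa> \<gamma> w p" and v: "subcritical_emden_fowler \<alpha> \<kappa> \<gamma> v q"
    and pos: "\<And>t. 0 < w t" "\<And>t. 0 < v t" and "\<mu> \<noteq> 0"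
    and lim_w: "((\<lambda>t. exp (\<gamma> * t) * w t) \<longlongrightarrow> \<mu>) at_top"
    and lim_v: "((\<lambda>t. exp (\<gamma> * t) * v t) \<longlongrightarrow> \<mu>) at_top"
  shows "w t = v t"
proof -
  interpret W: subcritical_emden_fowler \<alpha> \<kappa> \<gamma> w p by (rule w)
  interpret V: subcritical_emden_fowler \<alpha> \<kappa> \<gamma> v q by (rule v)
  define G where "G x = \<kappa> * \<gamma> * x - \<bar>x\<bar> powr \<alpha> * x" for x :: real
  define b where "b = \<kappa> - \<gamma>"
  have b: "b > 0" using W.gamma_less_kappa by (simp add: b_def)
  have dexp: "((\<lambda>t. exp (- b * t)) has_real_derivative - b * exp (- b * t)) (at t)" for t
    by (auto intro!: derivative_eq_intros)
  have exp0: "((\<lambda>t. exp (- b * t)) \<longlongrightarrow> 0) at_top"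
    by (rule filterlim_compose[OF exp_at_bot])
      (use b in \<open>auto simp: filterlim_uminus_at_bot intro!: filterlim_tendsto_pos_mult_at_top[OF tendsto_const _ filterlim_ident]\<close>)
  have lims: "(w \<longlongrightarrow> 0) at_top" "(p \<longlongrightarrow> 0) at_top" "(v \<longlongrightarrow> 0) at_top" "(q \<longlongrightarrow> 0) at_top"
    using W.fast_decay_imp_tendsto_0[OF pos(1) lim_w] V.fast_decay_imp_tendsto_0[OF pos(2) lim_v] by auto
  \<comment> \<open>the positive critical point of \<open>G\<close>\<close>
  define x0 where "x0 = (\<kappa> * \<gamma> / (\<alpha> + 1)) powr (1 / \<alpha>)"
  have x0: "0 < x0" "(\<alpha> + 1) * x0 powr \<alpha> = \<kappa> * \<gamma>"
    using W.alpha_pos W.kappa_pos W.gamma_pos by (auto simp: x0_def powr_powr)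
  have G_mono: "G x \<le> G y" if "0 \<le> x" "x \<le> y" "y \<le> x0" for x y
  proof (rule DERIV_nonneg_imp_nondecreasing[OF that(2)])
    fix z assume z: "x \<le> z" "z \<le> y"
    have "\<bar>z\<bar> powr \<alpha> \<le> x0 powr \<alpha>" using z that W.alpha_pos by (intro powr_mono2) auto
    then have "(\<alpha> + 1) * \<bar>z\<bar> powr \<alpha> \<le> \<kappa> * \<gamma>"
      unfolding x0(2)[symmetric] using W.alpha_pos by (intro mult_left_mono) auto
    moreover have "(G has_real_derivative \<kappa> * \<gamma> - (\<alpha> + 1) * \<bar>z\<bar> powr \<alpha>) (at z)"
      unfolding G_def
      by (intro DERIV_diff DERIV_cmult_Id has_real_derivative_abs_powr_mult[OF W.alpha_pos])
    ultimately show "\<exists>d. (G has_real_derivative d) (at z) \<and> 0 \<le> d" by fastforce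
  qed
  have "\<forall>\<^sub>F t in at_top. w t < x0 \<and> v t < x0"
    using order_tendstoD(2)[OF lims(1) x0(1)] order_tendstoD(2)[OF lims(3) x0(1)]
    by (rule eventually_conj)
  then obtain T where T: "\<And>t. t \<ge> T \<Longrightarrow> w t < x0 \<and> v t < x0"
    by (auto simp: eventually_at_top_linorder)
  have prod_le: "(w s - v s) * (p s - q s) \<le> 0" if "s \<ge> T" for s
  proof -
    have "exp (- b * s) * ((w s - v s) * (p s - q s)) \<le> 0"
    proof (rule le_limit_if_deriv_nonneg[of T "\<lambda>t. exp (- b * t) * ((w t - v t) * (p t - q t))", OF _ _ _ that])
      fix t
      have "((\<lambda>t. (w t - v t) * (p t - q t)) has_real_derivative
         (p t - q t) * (p t - q t) + ((b * p t + G (w t)) - (b * q t + G (v t))) * (w t - v t)) (at t)"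
        using W.deriv_p[of t] V.deriv_p[of t]
        by (intro DERIV_mult DERIV_diff W.deriv_w V.deriv_w) (simp_all add: b_def G_def algebra_simps)
      from DERIV_mult[OF dexp this]
      show "((\<lambda>t. exp (- b * t) * ((w t - v t) * (p t - q t))) has_real_derivative
         exp (- b * t) * ((p t - q t)\<^sup>2 + (G (w t) - G (v t)) * (w t - v t))) (at t)"
        by (rule DERIV_cong) (simp add: algebra_simps power2_eq_square)
      assume "t \<ge> T"
      have "0 \<le> (G (w t) - G (v t)) * (w t - v t)"
        using G_mono[of "w t" "v t"] G_mono[of "v t" "w t"] T[OF \<open>t \<ge> T\<close>] pos(1)[of t] pos(2)[of t]
        by (cases "w t \<le> v t") (auto intro: mult_nonpos_nonpos mult_nonneg_nonneg)
      then show "0 \<le> exp (- b * t) * ((p t - q t)\<^sup>2 + (G (w t) - G (v t)) * (w t - v t))"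
        by simp
    next
      have "((\<lambda>t. exp (- b * t) * ((w t - v t) * (p t - q t))) \<longlongrightarrow> 0 * ((0 - 0) * (0 - 0))) at_top"
        by (intro tendsto_mult tendsto_diff exp0 lims)
      then show "((\<lambda>t. exp (- b * t) * ((w t - v t) * (p t - q t))) \<longlongrightarrow> 0) at_top" by simp
    qed
    then show ?thesis by (simp add: mult_le_0_iff)
  qed
  have eq_after: "w t = v t" if "s \<ge> T" "w s = v s" "t \<ge> s" for s t
  proof -
    have "(w t - v t)\<^sup>2 \<le> (w s - v s)\<^sup>2"
    proof (rule deriv_nonpos_imp_antimono[OF _ _ that(3)])
      fix x assume "x \<in> {s..t}"
      show "((\<lambda>t. (w t - v t)\<^sup>2) has_real_derivative 2 * ((w x - v x) * (p x - q x))) (at x)"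
        by (auto intro!: derivative_eq_intros W.deriv_w V.deriv_w)
      show "2 * ((w x - v x) * (p x - q x)) \<le> 0"
        using prod_le[of x] \<open>x \<in> {s..t}\<close> that(1) by (simp only: atLeastAtMost_iff) linarith
    qed
    then show ?thesis using that(2) by simp
  qed
  have no_order: False
    if W: "subcritical_emden_fowler \<alpha> \<kappa> \<gamma> w p" and V: "subcritical_emden_fowler \<alpha> \<kappa> \<gamma> v q"
      and pos: "\<And>t. 0 < w t" "\<And>t. 0 < v t"
      and lim: "((\<lambda>t. exp (\<gamma> * t) * w t) \<longlongrightarrow> \<mu>) at_top" "((\<lambda>t. exp (\<gamma> * t) * v t) \<longlongrightarrow> \<mu>) at_top"
      and less: "\<And>t. t \<ge> T \<Longrightarrow> v t < w t" for w v p q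
  proof -
    interpret W1: subcritical_emden_fowler \<alpha> \<kappa> \<gamma> w p by (rule W)
    interpret V1: subcritical_emden_fowler \<alpha> \<kappa> \<gamma> v q by (rule V)
    have lims: "(w \<longlongrightarrow> 0) at_top" "(p \<longlongrightarrow> 0) at_top" "(v \<longlongrightarrow> 0) at_top" "(q \<longlongrightarrow> 0) at_top"
      using W1.fast_decay_imp_tendsto_0[OF pos(1) lim(1)] V1.fast_decay_imp_tendsto_0[OF pos(2) lim(2)] by auto
    have wronskian: "0 \<le> p s * v s - q s * w s" if "s \<ge> T" for s
    proof -
      have "exp (- b * s) * (q s * w s - p s * v s) \<le> 0"
      proof (rule le_limit_if_deriv_nonneg[of T "\<lambda>t. exp (- b * t) * (q t * w t - p t * v t)", OF _ _ _ that])
        fix t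
        have "((\<lambda>t. q t * w t - p t * v t) has_real_derivative
           ((b * q t + G (v t)) * w t + p t * q t) - ((b * p t + G (w t)) * v t + q t * p t)) (at t)"
          using W1.deriv_p[of t] V1.deriv_p[of t]
          by (intro DERIV_mult DERIV_diff W1.deriv_w V1.deriv_w) (simp_all add: b_def G_def algebra_simps)
        from DERIV_mult[OF dexp this]
        show "((\<lambda>t. exp (- b * t) * (q t * w t - p t * v t)) has_real_derivative
           exp (- b * t) * (w t * v t * (\<bar>w t\<bar> powr \<alpha> - \<bar>v t\<bar> powr \<alpha>))) (at t)"
          by (rule DERIV_cong) (simp add: algebra_simps G_def)
        assume "t \<ge> T"
        have "\<bar>v t\<bar> powr \<alpha> \<le> \<bar>w t\<bar> powr \<alpha>"
          using less[OF \<open>t \<ge> T\<close>] pos(2)[of t] W1.alpha_pos by (intro powr_mono2) auto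
        then show "0 \<le> exp (- b * t) * (w t * v t * (\<bar>w t\<bar> powr \<alpha> - \<bar>v t\<bar> powr \<alpha>))"
          using pos[of t] by simp
      next
        have "((\<lambda>t. exp (- b * t) * (q t * w t - p t * v t)) \<longlongrightarrow> 0 * (0 * 0 - 0 * 0)) at_top"
          by (intro tendsto_mult tendsto_diff exp0 lims)
        then show "((\<lambda>t. exp (- b * t) * (q t * w t - p t * v t)) \<longlongrightarrow> 0) at_top" by simp
      qed
      then show ?thesis by (simp add: mult_le_0_iff)
    qed
    have "((\<lambda>t. (exp (\<gamma> * t) * w t) / (exp (\<gamma> * t) * v t)) \<longlongrightarrow> \<mu> / \<mu>) at_top"
      by (intro tendsto_divide lim \<open>\<mu> \<noteq> 0\<close>)
    then have "((\<lambda>t. w t / v t) \<longlongrightarrow> 1) at_top" using \<open>\<mu> \<noteq> 0\<close> by simp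
    then have "w T / v T \<le> 1"
    proof (rule le_limit_if_deriv_nonneg[of T _ "\<lambda>t. (p t * v t - w t * q t) / (v t * v t)", rotated 2])
      fix t assume "t \<ge> T"
      show "((\<lambda>t. w t / v t) has_real_derivative (p t * v t - w t * q t) / (v t * v t)) (at t)"
        by (intro DERIV_divide W1.deriv_w V1.deriv_w) (use pos(2)[of t] in simp)
      show "0 \<le> (p t * v t - w t * q t) / (v t * v t)"
        using wronskian[OF \<open>t \<ge> T\<close>] pos(2)[of t] by (simp add: mult.commute)
    qed simp
    then show False using less[of T] pos(2)[of T] by simp
  qed
  have "\<exists>s\<ge>T. w s = v s"
  proof (rule ccontr)
    assume none: "\<not> ?thesis"
    have "(\<forall>t\<ge>T. v t < w t) \<or> (\<forall>t\<ge>T. w t < v t)"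
    proof (rule ccontr)
      assume "\<not> ?thesis"
      then obtain x y where xy: "x \<ge> T" "y \<ge> T" "w x - v x \<le> 0" "0 \<le> w y - v y"
        by (auto simp: not_less)
      have cont: "isCont (\<lambda>t. w t - v t) t" for t
        by (intro continuous_diff W.isCont_w V.isCont_w)
      have "\<exists>z. min x y \<le> z \<and> w z - v z = 0"
      proof (cases "x \<le> y")
        case True
        then show ?thesis using IVT[of "\<lambda>t. w t - v t" x 0 y] xy cont by auto
      next
        case False
        then show ?thesis using IVT2[of "\<lambda>t. w t - v t" x 0 y] xy cont by auto
      qed
      then show False using none xy by (auto simp: min_def split: if_splits)
    qed
    then show False
      using no_order[OF w v pos lim_w lim_v] no_order[OF v w pos(2,1) lim_v lim_w] by blast
  qed
  then obtain s where s: "s \<ge> T" "w s = v s" by blast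
  have "((\<lambda>t. w t - v t) has_real_derivative p (s + 1) - q (s + 1)) (at (s + 1))"
    by (intro DERIV_diff W.deriv_w V.deriv_w)
  then have "((\<lambda>t. 0) has_real_derivative p (s + 1) - q (s + 1)) (at (s + 1))"
    by (rule has_field_derivative_transform_within_open[of _ _ _ "{s<..}"])
      (use eq_after[OF s] in auto)
  then have "p (s + 1) - q (s + 1) = 0"
    by (rule DERIV_unique[OF _ DERIV_const])
  then have "p (s + 1) = q (s + 1)" by simp
  then show ?thesis
    using emden_fowler_unique[OF W.emden_fowler_axioms V.emden_fowler_axioms, of "s + 1" t]
      eq_after[OF s, of "s + 1"] by simp
qed

section \<open>Radial solutions in logarithmic time\<close>

lemma tendsto_at_right_0_transform:
  fixes f g :: "real \<Rightarrow> real"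
  assumes "(f \<longlongrightarrow> l) (at_right 0)" and "\<And>r. 0 < r \<Longrightarrow> f r = g r"
  shows "(g \<longlongrightarrow> l) (at_right 0)"
  using assms(1) by (rule Lim_transform_eventually)
    (rule eventually_mono[OF eventually_at_right_less], rule assms(2))

lemma exp_deriv_const: "((\<lambda>t. exp (c * t)) has_real_derivative c * exp (c * t)) (at t)"
  by (auto intro!: derivative_eq_intros)

text \<open>
  In this context \<open>w\<close> and \<open>p\<close> denote the rescaled solution and its derivative in logarithmic time.
\<close>

locale radial_emden =
  fixes N :: nat and \<alpha> :: real and u :: "real \<Rightarrow> real"
  assumes N_ge: "3 \<le> N" and alpha_gt: "2 / (real N - 2) < \<alpha>" and alpha_lt: "\<alpha> < 4 / (real N - 2)"
    and solution: "radial_solution N \<alpha> u"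
begin

lemma deriv_u: "0 < r \<Longrightarrow> (u has_real_derivative deriv u r) (at r)"
  and deriv_u': "0 < r \<Longrightarrow> (deriv u has_real_derivative deriv (deriv u) r) (at r)"
  and continuous_u'': "continuous_on {0<..} (deriv (deriv u))"
proof -
  obtain f' f'' where f: "\<And>x. 0 < x \<Longrightarrow> (u has_real_derivative f' x) (at x within {0<..})"
    "\<And>x. 0 < x \<Longrightarrow> (f' has_real_derivative f'' x) (at x within {0<..})" "continuous_on {0<..} f''"
    using solution unfolding radial_solution_def C2_on_def greaterThan_iff Ball_def by blast
  have within: "at x within {0<..} = at x" if "0 < x" for x :: real
    using that by (intro at_within_open) auto
  have f': "(u has_real_derivative f' x) (at x)" if "0 < x" for x
    using f(1)[OF that] within[OF that] by simp
  then have eq: "deriv u x = f' x" if "0 < x" for x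
    using that DERIV_imp_deriv by blast
  have f'': "(deriv u has_real_derivative f'' x) (at x)" if "0 < x" for x
  proof -
    have "(f' has_real_derivative f'' x) (at x)"
      using f(2)[OF that] within[OF that] by simp
    then show ?thesis
      by (rule has_field_derivative_transform_within_open[of _ _ _ "{0<..}"])
        (use that eq in auto)
  qed
  then have eq': "deriv (deriv u) x = f'' x" if "0 < x" for x
    using that DERIV_imp_deriv by blast
  show "0 < r \<Longrightarrow> (u has_real_derivative deriv u r) (at r)"
    using f' eq by simp
  show "0 < r \<Longrightarrow> (deriv u has_real_derivative deriv (deriv u) r) (at r)"
    using f'' eq' by simp
  have "continuous_on {0<..} f'' = continuous_on {0<..} (deriv (deriv u))"
    by (intro continuous_on_cong) (use eq' in auto)
  then show "continuous_on {0<..} (deriv (deriv u))" using f(3) by simp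
qed

lemma equation:
  "0 < r \<Longrightarrow> deriv (deriv u) r = - ((real N - 1) / r * deriv u r) - \<bar>u r\<bar> powr \<alpha> * u r"
  using solution unfolding radial_solution_def by (smt (verit))

definition w :: "real \<Rightarrow> real" where
  "w t = exp (2 / \<alpha> * t) * u (exp t)"

definition p :: "real \<Rightarrow> real" where
  "p t = exp (2 / \<alpha> * t) * (exp t * deriv u (exp t) + 2 / \<alpha> * u (exp t))"

lemma parameters: "0 < \<alpha>" "0 < real N - 2 - 2 / \<alpha>" "real N - 2 - 2 / \<alpha> < 2 / \<alpha>"
proof -
  have N: "0 < real N - 2" using N_ge by simp
  have "0 < 2 / (real N - 2)" using N by simp
  then show a: "0 < \<alpha>" using alpha_gt by linarith
  have "2 / \<alpha> < real N - 2" using alpha_gt N a by (simp add: field_simps)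
  then show "0 < real N - 2 - 2 / \<alpha>" by simp
  have "real N - 2 < 4 / \<alpha>" using alpha_lt N a by (simp add: field_simps)
  then show "real N - 2 - 2 / \<alpha> < 2 / \<alpha>" by simp
qed

sublocale subcritical_emden_fowler \<alpha> "2 / \<alpha>" "real N - 2 - 2 / \<alpha>" w p
proof
  show "0 < \<alpha>" by (rule parameters)
  show "0 < 2 / \<alpha>" by (rule divide_pos_pos[OF _ parameters(1)]) simp
  show "0 < real N - 2 - 2 / \<alpha>" "real N - 2 - 2 / \<alpha> < 2 / \<alpha>"
    by (rule parameters)+
  fix t :: real
  have dexp: "((\<lambda>t. exp (2 / \<alpha> * t)) has_real_derivative 2 / \<alpha> * exp (2 / \<alpha> * t)) (at t)"
    using exp_deriv_const[of "2 / \<alpha>" t] by simp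
  have du: "((\<lambda>t. u (exp t)) has_real_derivative deriv u (exp t) * exp t) (at t)"
    by (rule DERIV_chain2[OF deriv_u DERIV_exp]) simp
  have du': "((\<lambda>t. deriv u (exp t)) has_real_derivative deriv (deriv u) (exp t) * exp t) (at t)"
    by (rule DERIV_chain2[OF deriv_u' DERIV_exp]) simp
  show "(w has_real_derivative p t) (at t)"
    unfolding w_def p_def
    by (rule DERIV_cong[OF DERIV_mult[OF dexp du]]) (simp add: algebra_simps)
  have rew: "exp t * (deriv (deriv u) (exp t) * exp t)
      = - (real N - 1) * (exp t * deriv u (exp t)) - (exp t)\<^sup>2 * (\<bar>u (exp t)\<bar> powr \<alpha> * u (exp t))"
    by (simp add: equation field_simps power2_eq_square)
  have "\<bar>w t\<bar> powr \<alpha> = (exp t)\<^sup>2 * \<bar>u (exp t)\<bar> powr \<alpha>"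
    using parameters(1) by (simp add: w_def abs_mult powr_mult exp_powr_real exp_double[symmetric])
  then have nonlinear: "\<bar>w t\<bar> powr \<alpha> * w t = exp (2 / \<alpha> * t) * ((exp t)\<^sup>2 * (\<bar>u (exp t)\<bar> powr \<alpha> * u (exp t)))"
    by (simp add: w_def)
  have "(p has_real_derivative (2 / \<alpha> * exp (2 / \<alpha> * t)) * (exp t * deriv u (exp t) + 2 / \<alpha> * u (exp t))
     + ((exp t * deriv u (exp t) + deriv (deriv u) (exp t) * exp t * exp t)
         + 2 / \<alpha> * (deriv u (exp t) * exp t)) * exp (2 / \<alpha> * t)) (at t)"
    unfolding p_def
    by (intro DERIV_mult dexp DERIV_add DERIV_exp du' DERIV_cmult du)
  then show "(p has_real_derivative (2 / \<alpha> - (real N - 2 - 2 / \<alpha>)) * p t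
      + 2 / \<alpha> * (real N - 2 - 2 / \<alpha>) * w t - \<bar>w t\<bar> powr \<alpha> * w t) (at t)"
  proof (rule DERIV_cong)
    \<comment> \<open>after substitution of the equation for \<open>u''\<close>, the identity is linear in \<open>r u'\<close>, \<open>u\<close> and \<open>r\<^sup>2 |u|\<^bsup>\<alpha>\<^esup> u\<close>\<close>
    define A where "A = exp t * deriv u (exp t)"
    define B where "B = (exp t)\<^sup>2 * (\<bar>u (exp t)\<bar> powr \<alpha> * u (exp t))"
    define \<kappa> where "\<kappa> = 2 / \<alpha>"
    have "deriv (deriv u) (exp t) * exp t * exp t = - (real N - 1) * A - B"
      using rew by (simp add: A_def B_def mult_ac)
    note Deq = this
    show "(2 / \<alpha> * exp (2 / \<alpha> * t)) * (exp t * deriv u (exp t) + 2 / \<alpha> * u (exp t))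
     + ((exp t * deriv u (exp t) + deriv (deriv u) (exp t) * exp t * exp t)
         + 2 / \<alpha> * (deriv u (exp t) * exp t)) * exp (2 / \<alpha> * t) =
      (2 / \<alpha> - (real N - 2 - 2 / \<alpha>)) * p t
      + 2 / \<alpha> * (real N - 2 - 2 / \<alpha>) * w t - \<bar>w t\<bar> powr \<alpha> * w t"
      unfolding Deq nonlinear p_def mult.commute[of "deriv u (exp t)" "exp t"] A_def[symmetric] B_def[symmetric]
      unfolding w_def \<kappa>_def[symmetric]
      by (simp add: algebra_simps)
  qed
qed

lemma k_eq: "k = beta N \<alpha> powr (1 / \<alpha>)"
  by (simp add: k_def beta_def)

lemma w_ln: "0 < r \<Longrightarrow> r powr (2 / \<alpha>) * u r = w (ln r)"
  by (simp add: w_def powr_def)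

lemma p_ln:
  assumes "0 < r"
  shows "r powr (2 / \<alpha> + 1) * deriv u r = p (ln r) - 2 / \<alpha> * w (ln r)"
proof -
  have "exp (2 / \<alpha> * ln r) = r powr (2 / \<alpha>)" "exp (ln r) = r" "r powr 1 = r"
    using assms by (auto simp: powr_def)
  then show ?thesis
    unfolding w_def p_def powr_add by (simp only:) (simp add: algebra_simps)
qed

lemma w_ln_fast:
  assumes "0 < r"
  shows "r powr (real N - 2) * u r = exp ((real N - 2 - 2 / \<alpha>) * ln r) * w (ln r)"
proof -
  have "(real N - 2) * ln r = (real N - 2 - 2 / \<alpha>) * ln r + 2 / \<alpha> * ln r"
    by (simp add: algebra_simps)
  then have "r powr (real N - 2) = exp ((real N - 2 - 2 / \<alpha>) * ln r) * exp (2 / \<alpha> * ln r)"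
    using assms unfolding exp_add[symmetric] by (simp add: powr_def)
  then show ?thesis using assms by (simp add: w_def)
qed

lemma u_eq: "0 < r \<Longrightarrow> u r = r powr (- (2 / \<alpha>)) * w (ln r)"
  by (simp add: w_ln[symmetric] powr_minus)

lemma sign_w: "0 < w t \<longleftrightarrow> 0 < u (exp t)" "w t < 0 \<longleftrightarrow> u (exp t) < 0" "w t = 0 \<longleftrightarrow> u (exp t) = 0"
  by (auto simp: w_def zero_less_mult_iff mult_less_0_iff)

lemma filterlim_exp_at_right: "filterlim exp (at_right 0) (at_bot :: real filter)"
  by (simp add: filterlim_at exp_at_bot)

lemma tendsto_ln_iff_at_bot: "((\<lambda>r. f (ln r)) \<longlongrightarrow> l) (at_right 0) \<longleftrightarrow> (f \<longlongrightarrow> l) at_bot"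
  for f :: "real \<Rightarrow> real"
proof
  assume "(f \<longlongrightarrow> l) at_bot"
  then show "((\<lambda>r. f (ln r)) \<longlongrightarrow> l) (at_right 0)"
    by (rule filterlim_compose[OF _ ln_at_0])
next
  assume "((\<lambda>r. f (ln r)) \<longlongrightarrow> l) (at_right 0)"
  from filterlim_compose[OF this filterlim_exp_at_right] show "(f \<longlongrightarrow> l) at_bot" by simp
qed

lemma tendsto_ln_iff_at_top: "((\<lambda>r. f (ln r)) \<longlongrightarrow> l) at_top \<longleftrightarrow> (f \<longlongrightarrow> l) at_top"
  for f :: "real \<Rightarrow> real"
proof
  assume "(f \<longlongrightarrow> l) at_top"
  then show "((\<lambda>r. f (ln r)) \<longlongrightarrow> l) at_top"
    by (rule filterlim_compose[OF _ ln_at_top])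
next
  assume "((\<lambda>r. f (ln r)) \<longlongrightarrow> l) at_top"
  from filterlim_compose[OF this exp_at_top] show "(f \<longlongrightarrow> l) at_top" by simp
qed

lemma eventually_pos_at_right: "\<forall>\<^sub>F r in at_right (0 :: real). 0 < r"
  by (simp add: eventually_at_right_less)

lemma tendsto_w_iff: "((\<lambda>r. r powr (2 / \<alpha>) * u r) \<longlongrightarrow> l) (at_right 0) \<longleftrightarrow> (w \<longlongrightarrow> l) at_bot"
  unfolding tendsto_ln_iff_at_bot[symmetric]
  by (rule tendsto_cong, rule eventually_mono[OF eventually_pos_at_right], erule w_ln)

lemma tendsto_fast_iff: "((\<lambda>r. r powr (real N - 2) * u r) \<longlongrightarrow> \<mu>) at_top \<longleftrightarrow>
    ((\<lambda>t. exp ((real N - 2 - 2 / \<alpha>) * t) * w t) \<longlongrightarrow> \<mu>) at_top"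
  by (rule trans[OF _ tendsto_ln_iff_at_top], rule tendsto_cong, rule eventually_mono[OF eventually_gt_at_top[of 0]], erule w_ln_fast)

lemma tendsto_u': "(w \<longlongrightarrow> l) at_bot \<Longrightarrow>
    ((\<lambda>r. r powr (2 / \<alpha> + 1) * deriv u r) \<longlongrightarrow> - (2 / \<alpha> * l)) (at_right 0)"
proof -
  assume lim: "(w \<longlongrightarrow> l) at_bot"
  have "(p \<longlongrightarrow> 0) at_bot" using tendsto_at_bot by blast
  then have "((\<lambda>t. p t - 2 / \<alpha> * w t) \<longlongrightarrow> 0 - 2 / \<alpha> * l) at_bot"
    by (intro tendsto_diff tendsto_mult lim tendsto_const)
  then have "((\<lambda>r. p (ln r) - 2 / \<alpha> * w (ln r)) \<longlongrightarrow> - (2 / \<alpha> * l)) (at_right 0)"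
    using tendsto_ln_iff_at_bot[of "\<lambda>t. p t - 2 / \<alpha> * w t"] by simp
  then show ?thesis
    by (rule tendsto_at_right_0_transform) (simp add: p_ln)
qed

lemma energy_ln:
  assumes "0 < r"
  shows "energy (ln r) = r powr (4 / \<alpha>) * (r\<^sup>2 / 2 * \<bar>deriv u r\<bar>\<^sup>2 + 2 / \<alpha> * r * u r * deriv u r
        + 1 / (\<alpha> + 2) * r\<^sup>2 * \<bar>u r\<bar> powr (\<alpha> + 2) + (4 - (real N - 2) * \<alpha>) / \<alpha>\<^sup>2 * \<bar>u r\<bar>\<^sup>2)"
proof -
  define s where "s = r powr (2 / \<alpha>)"
  have s: "0 < s" "s\<^sup>2 = r powr (4 / \<alpha>)" "s powr \<alpha> = r\<^sup>2"
    using assms parameters(1) by (auto simp: s_def power2_eq_square powr_add[symmetric] powr_powr)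
  have w: "w (ln r) = s * u r" using w_ln[OF assms] by (simp add: s_def)
  have p: "p (ln r) = s * (r * deriv u r + 2 / \<alpha> * u r)"
    using p_ln[OF assms] w assms by (simp add: s_def powr_add algebra_simps)
  have e: "\<bar>w (ln r)\<bar> powr (\<alpha> + 2) = s\<^sup>2 * (r\<^sup>2 * \<bar>u r\<bar> powr (\<alpha> + 2))"
    unfolding abs_powr_add_2 using s(1,3) by (simp add: w abs_mult powr_mult power_mult_distrib)
  have "energy (ln r) = s\<^sup>2 * ((r * deriv u r + 2 / \<alpha> * u r)\<^sup>2 / 2
     - 2 / \<alpha> * (real N - 2 - 2 / \<alpha>) / 2 * (u r)\<^sup>2 + r\<^sup>2 * \<bar>u r\<bar> powr (\<alpha> + 2) / (\<alpha> + 2))"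
    unfolding energy_def e unfolding w p power_mult_distrib by (simp add: algebra_simps)
  also have "(r * deriv u r + 2 / \<alpha> * u r)\<^sup>2 / 2
     - 2 / \<alpha> * (real N - 2 - 2 / \<alpha>) / 2 * (u r)\<^sup>2 = r\<^sup>2 / 2 * \<bar>deriv u r\<bar>\<^sup>2 + 2 / \<alpha> * r * u r * deriv u r
        + (4 - (real N - 2) * \<alpha>) / \<alpha>\<^sup>2 * \<bar>u r\<bar>\<^sup>2"
    using parameters(1) by (simp add: field_simps power2_eq_square)
  finally show ?thesis by (simp add: s(2) algebra_simps)
qed

lemma bound_at_infinity: "\<exists>C. \<forall>r>1. \<bar>u r\<bar> \<le> C * r powr (- (real N - 2 - 2 / \<alpha>))"
proof -
  obtain C where C: "\<And>t. 0 \<le> t \<Longrightarrow> \<bar>w t\<bar> \<le> C * exp ((2 / \<alpha> - (real N - 2 - 2 / \<alpha>)) * t)"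
    using exponential_growth_bound by blast
  have "\<bar>u r\<bar> \<le> C * r powr (- (real N - 2 - 2 / \<alpha>))" if "1 < r" for r
  proof -
    have "\<bar>u r\<bar> = r powr (- (2 / \<alpha>)) * \<bar>w (ln r)\<bar>"
      using u_eq[of r] that by (simp add: abs_mult)
    also have "\<dots> \<le> r powr (- (2 / \<alpha>)) * (C * exp ((2 / \<alpha> - (real N - 2 - 2 / \<alpha>)) * ln r))"
      using C[of "ln r"] that by (intro mult_left_mono) auto
    also have "\<dots> = C * (r powr (- (2 / \<alpha>)) * r powr (2 / \<alpha> - (real N - 2 - 2 / \<alpha>)))"
      using that by (simp add: powr_def)
    also have "r powr (- (2 / \<alpha>)) * r powr (2 / \<alpha> - (real N - 2 - 2 / \<alpha>)) = r powr (- (real N - 2 - 2 / \<alpha>))"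
      unfolding powr_add[symmetric] by (rule arg_cong[where f = "(powr) r"]) simp
    finally show ?thesis .
  qed
  then show ?thesis by blast
qed

text \<open>
  If \<open>w \<rightarrow> 0\<close>, the asymptotics on the unstable manifold say that \<open>u = e\<^bsup>-(2/\<alpha>)t\<^esup> w\<close> converges.
\<close>

lemma finite_limit_iff: "finite_limit_at_0 u \<longleftrightarrow> (w \<longlongrightarrow> 0) at_bot"
proof
  assume "finite_limit_at_0 u"
  then obtain l where l: "(u \<longlongrightarrow> l) (at_right 0)" by (auto simp: finite_limit_at_0_def)
  have "((\<lambda>r. r powr (2 / \<alpha>)) \<longlongrightarrow> 0 powr (2 / \<alpha>)) (at_right 0)"
    using parameters(1) eventually_pos_at_right
    by (intro tendsto_powr' tendsto_ident_at tendsto_const) (auto elim: eventually_mono)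
  from tendsto_mult[OF this l] show "(w \<longlongrightarrow> 0) at_bot"
    unfolding tendsto_w_iff[symmetric] by simp
next
  assume "(w \<longlongrightarrow> 0) at_bot"
  then obtain \<mu> where "((\<lambda>t. exp (- (2 / \<alpha>) * t) * w t) \<longlongrightarrow> \<mu>) at_bot"
    by (rule vanishing_asymptotics)
  then have "((\<lambda>r. exp (- (2 / \<alpha>) * ln r) * w (ln r)) \<longlongrightarrow> \<mu>) (at_right 0)"
    using tendsto_ln_iff_at_bot[of "\<lambda>t. exp (- (2 / \<alpha>) * t) * w t"] by simp
  then have "(u \<longlongrightarrow> \<mu>) (at_right 0)"
    by (rule tendsto_at_right_0_transform) (simp add: u_eq powr_def)
  then show "finite_limit_at_0 u" by (auto simp: finite_limit_at_0_def)
qed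

text \<open>
  The flux \<open>r\<^bsup>N-1\<^esup> u'\<close> tends to \<open>0\<close>, because \<open>r\<^bsup>2/\<alpha>+1\<^esup> u'\<close> does and the remaining exponent
  \<open>N - 2 - 2/\<alpha>\<close> is positive. By the equation its derivative is \<open>- r\<^bsup>N-1\<^esup> |u|\<^bsup>\<alpha>\<^esup> u\<close>, so l'Hopital's rule applies to
  \<open>r\<^bsup>N-1\<^esup> u' / r\<^sup>N\<close>.
\<close>

lemma finite_limit_imp_tendsto_u'_div:
  assumes lim: "(u \<longlongrightarrow> l) (at_right 0)"
  shows "((\<lambda>r. deriv u r / r) \<longlongrightarrow> - (\<bar>l\<bar> powr \<alpha> * l) / real N) (at_right 0)"
proof -
  have w0: "(w \<longlongrightarrow> 0) at_bot"
    using lim finite_limit_iff by (auto simp: finite_limit_at_0_def)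
  have "((\<lambda>r. r powr (real N - 2 - 2 / \<alpha>)) \<longlongrightarrow> 0 powr (real N - 2 - 2 / \<alpha>)) (at_right 0)"
    using parameters eventually_pos_at_right
    by (intro tendsto_powr' tendsto_ident_at tendsto_const) (auto elim: eventually_mono)
  from tendsto_mult[OF this tendsto_u'[OF w0]]
  have "((\<lambda>r. r powr (real N - 2 - 2 / \<alpha>) * (r powr (2 / \<alpha> + 1) * deriv u r)) \<longlongrightarrow> 0) (at_right 0)"
    by simp
  then have flux0: "((\<lambda>r. r ^ (N - 1) * deriv u r) \<longlongrightarrow> 0) (at_right 0)"
  proof (rule tendsto_at_right_0_transform)
    fix r :: real assume "0 < r"
    have "r powr (real N - 2 - 2 / \<alpha>) * r powr (2 / \<alpha> + 1) = r powr (real (N - 1))"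
      using N_ge unfolding powr_add[symmetric] by (simp add: of_nat_diff)
    then show "r powr (real N - 2 - 2 / \<alpha>) * (r powr (2 / \<alpha> + 1) * deriv u r) = r ^ (N - 1) * deriv u r"
      using \<open>0 < r\<close> by (simp add: mult.assoc[symmetric] powr_realpow)
  qed
  have force: "((\<lambda>r. \<bar>u r\<bar> powr \<alpha> * u r) \<longlongrightarrow> \<bar>l\<bar> powr \<alpha> * l) (at_right 0)"
    by (rule isCont_tendsto_compose[OF
      DERIV_isCont[OF has_real_derivative_abs_powr_mult[OF parameters(1)]] lim])
  obtain M where M: "N = Suc (Suc M)" 
    using N_ge by (intro that[of "N - 2"]) simp
  have "((\<lambda>r. (r ^ (N - 1) * deriv u r) / r ^ N) \<longlongrightarrow> - (\<bar>l\<bar> powr \<alpha> * l) / real N) (at_right 0)"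
  proof (rule lhopital_right_0[OF flux0])
    show "((\<lambda>r::real. r ^ N) \<longlongrightarrow> 0) (at_right 0)"
      using N_ge by (intro tendsto_null_power tendsto_ident_at) simp
    show "\<forall>\<^sub>F r in at_right (0::real). r ^ N \<noteq> 0" "\<forall>\<^sub>F r in at_right (0::real). real N * r ^ (N - 1) \<noteq> 0"
      using N_ge by (auto intro!: eventually_mono[OF eventually_pos_at_right])
    show "\<forall>\<^sub>F r in at_right (0::real). ((\<lambda>r. r ^ N) has_real_derivative real N * r ^ (N - 1)) (at r)"
    proof (intro always_eventually allI)
      show "((\<lambda>r. r ^ N) has_real_derivative real N * r ^ (N - 1)) (at r)" for r :: real
        using DERIV_pow[of N r UNIV] by simp
    qed
    show "\<forall>\<^sub>F r in at_right 0. ((\<lambda>r. r ^ (N - 1) * deriv u r) has_real_derivative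
        - (r ^ (N - 1) * (\<bar>u r\<bar> powr \<alpha> * u r))) (at r)"
    proof (rule eventually_mono[OF eventually_pos_at_right])
      fix r :: real assume r: "0 < r"
      show "((\<lambda>r. r ^ (N - 1) * deriv u r) has_real_derivative
        - (r ^ (N - 1) * (\<bar>u r\<bar> powr \<alpha> * u r))) (at r)"
      proof (rule DERIV_cong[OF DERIV_mult[OF DERIV_pow deriv_u'[OF r]]])
        have "r ^ (N - 1) = r * r ^ M" "real (N - 1) = real N - 1" "N - 1 - Suc 0 = M"
          by (auto simp: M)
        then show "real (N - 1) * r ^ (N - 1 - Suc 0) * deriv u r + deriv (deriv u) r * r ^ (N - 1) =
            - (r ^ (N - 1) * (\<bar>u r\<bar> powr \<alpha> * u r))"
          using r by (simp only: equation[OF r]) (simp add: field_simps)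
      qed
    qed
    have "((\<lambda>r. - (\<bar>u r\<bar> powr \<alpha> * u r) / real N) \<longlongrightarrow> - (\<bar>l\<bar> powr \<alpha> * l) / real N) (at_right 0)"
      using N_ge by (intro tendsto_divide tendsto_minus force tendsto_const) auto
    then show "((\<lambda>r. - (r ^ (N - 1) * (\<bar>u r\<bar> powr \<alpha> * u r)) / (real N * r ^ (N - 1)))
        \<longlongrightarrow> - (\<bar>l\<bar> powr \<alpha> * l) / real N) (at_right 0)"
      by (rule tendsto_at_right_0_transform) simp
  qed
  then show ?thesis
    by (rule tendsto_at_right_0_transform) (simp add: M)
qed

lemma finite_limit_imp_tendsto_u':
  assumes "finite_limit_at_0 u"
  shows "(deriv u \<longlongrightarrow> 0) (at_right 0)"
proof -
  obtain l where l: "(u \<longlongrightarrow> l) (at_right 0)" using assms by (auto simp: finite_limit_at_0_def)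
  from tendsto_mult[OF finite_limit_imp_tendsto_u'_div[OF l] tendsto_ident_at]
  have "((\<lambda>r. deriv u r / r * r) \<longlongrightarrow> 0) (at_right 0)" by simp
  then show ?thesis
    by (rule tendsto_at_right_0_transform) simp
qed

text \<open>
  A finite limit suffices for regularity: \<open>u'/r\<close> converges, and by the equation so does \<open>u''\<close>, to the same number. This
  number is the second derivative at \<open>0\<close> of the extension.
\<close>

lemma regular_iff: "regular u \<longleftrightarrow> finite_limit_at_0 u"
proof
  assume "regular u"
  then obtain v where v: "\<forall>r>0. v r = u r" "(v has_real_derivative 0) (at 0 within {0..})"
    by (auto simp: regular_def)
  have "continuous (at 0 within {0..}) v"
    by (rule DERIV_continuous[OF v(2)])
  then have "(v \<longlongrightarrow> v 0) (at 0 within {0..})" by (simp add: continuous_within)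
  then have "(v \<longlongrightarrow> v 0) (at_right 0)" by (simp add: at_within_Ici_at_right)
  then have "(u \<longlongrightarrow> v 0) (at_right 0)"
    by (rule tendsto_at_right_0_transform) (simp add: v(1))
  then show "finite_limit_at_0 u" by (auto simp: finite_limit_at_0_def)
next
  assume fin: "finite_limit_at_0 u"
  then obtain l where l: "(u \<longlongrightarrow> l) (at_right 0)" by (auto simp: finite_limit_at_0_def)
  define c where "c = - (\<bar>l\<bar> powr \<alpha> * l) / real N"
  have quot: "((\<lambda>r. deriv u r / r) \<longlongrightarrow> c) (at_right 0)"
    unfolding c_def by (rule finite_limit_imp_tendsto_u'_div[OF l])
  define v where "v r = (if r = 0 then l else u r)" for r
  define v' where "v' r = (if r = 0 then 0 else deriv u r)" for r
  define v'' where "v'' r = (if r = 0 then c else deriv (deriv u) r)" for r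
  have at0: "(at 0 within {0..}) = at_right (0::real)" by (rule at_within_Ici_at_right)
  have "((\<lambda>r. (u r - l) / r) \<longlongrightarrow> 0) (at_right 0)"
  proof (rule lhopital_right_0)
    show "((\<lambda>r. u r - l) \<longlongrightarrow> 0) (at_right 0)" using tendsto_diff[OF l tendsto_const[of l]] by simp
    show "((\<lambda>r::real. r) \<longlongrightarrow> 0) (at_right 0)" by (rule tendsto_ident_at)
    show "\<forall>\<^sub>F r in at_right (0::real). r \<noteq> 0" "\<forall>\<^sub>F r in at_right (0::real). (1::real) \<noteq> 0"
      by (auto intro!: eventually_mono[OF eventually_pos_at_right])
    show "\<forall>\<^sub>F r in at_right 0. ((\<lambda>r. u r - l) has_real_derivative deriv u r) (at r)"
      using DERIV_diff[OF deriv_u DERIV_const] by (auto intro!: eventually_mono[OF eventually_pos_at_right])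
    show "\<forall>\<^sub>F r in at_right 0. ((\<lambda>r. r) has_real_derivative 1) (at r)" by simp
    show "((\<lambda>r. deriv u r / 1) \<longlongrightarrow> 0) (at_right 0)" using finite_limit_imp_tendsto_u'[OF fin] by simp
  qed
  then have dv0: "(v has_real_derivative 0) (at 0 within {0..})"
    unfolding has_field_derivative_iff at0
    by (rule tendsto_at_right_0_transform) (simp add: v_def)
  have dv'0: "(v' has_real_derivative c) (at 0 within {0..})"
    unfolding has_field_derivative_iff at0
    by (rule tendsto_at_right_0_transform[OF quot]) (simp add: v'_def)
  have trans: "(g has_real_derivative d) (at r within {0..})"
    if "(f has_real_derivative d) (at r)" "0 < r" "\<And>x. 0 < x \<Longrightarrow> f x = g x" for f g d r
  proof -
    have "(g has_real_derivative d) (at r)"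
      by (rule has_field_derivative_transform_within_open[OF that(1), of "{0<..}"]) (use that in auto)
    then show ?thesis by (rule DERIV_subset) simp
  qed
  have dv: "(v has_real_derivative v' r) (at r within {0..})" if "r \<in> {0..}" for r
    using that dv0 trans[OF deriv_u[of r], of v] by (cases "r = 0") (auto simp: v_def v'_def)
  have dv': "(v' has_real_derivative v'' r) (at r within {0..})" if "r \<in> {0..}" for r
    using that dv'0 trans[OF deriv_u'[of r], of v'] by (cases "r = 0") (auto simp: v'_def v''_def)
  have "(deriv (deriv u) \<longlongrightarrow> c) (at_right 0)"
  proof -
    have "((\<lambda>r. \<bar>u r\<bar> powr \<alpha> * u r) \<longlongrightarrow> \<bar>l\<bar> powr \<alpha> * l) (at_right 0)"
      by (rule isCont_tendsto_compose[OF
        DERIV_isCont[OF has_real_derivative_abs_powr_mult[OF parameters(1)]] l])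
    from tendsto_diff[OF tendsto_minus[OF tendsto_mult[OF tendsto_const quot]] this]
    have "((\<lambda>r. - ((real N - 1) * (deriv u r / r)) - \<bar>u r\<bar> powr \<alpha> * u r) \<longlongrightarrow>
      - ((real N - 1) * c) - \<bar>l\<bar> powr \<alpha> * l) (at_right 0)" .
    moreover have "- ((real N - 1) * c) - \<bar>l\<bar> powr \<alpha> * l = c"
      using N_ge by (simp add: c_def field_simps)
    ultimately have "((\<lambda>r. - ((real N - 1) * (deriv u r / r)) - \<bar>u r\<bar> powr \<alpha> * u r) \<longlongrightarrow> c) (at_right 0)"
      by (simp only:)
    then show ?thesis
      by (rule tendsto_at_right_0_transform) (simp add: equation)
  qed
  then have lim'': "(v'' \<longlongrightarrow> c) (at_right 0)"
    by (rule tendsto_at_right_0_transform) (simp add: v''_def)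
  have "continuous_on {0..} v''"
    unfolding continuous_on_def
  proof
    fix r :: real assume "r \<in> {0..}"
    show "(v'' \<longlongrightarrow> v'' r) (at r within {0..})"
    proof (cases "r = 0")
      case True
      then show ?thesis using lim'' by (simp add: at0) (simp add: v''_def)
    next
      case False
      then have r: "0 < r" using \<open>r \<in> {0..}\<close> by simp
      have "isCont (deriv (deriv u)) r"
        using continuous_u'' r by (simp add: continuous_on_eq_continuous_at)
      then have "(deriv (deriv u) \<longlongrightarrow> deriv (deriv u) r) (at r)" by (simp add: isCont_def)
      moreover have "\<forall>\<^sub>F x in at r. deriv (deriv u) x = v'' x"
        using r by (auto simp: eventually_at_topological v''_def intro!: exI[of _ "{0<..}"])
      ultimately have "(v'' \<longlongrightarrow> deriv (deriv u) r) (at r)" by (rule Lim_transform_eventually)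
      then show ?thesis using r by (auto simp: v''_def intro: tendsto_within_subset)
    qed
  qed
  then have "C2_on {0..} v" using dv dv' unfolding C2_on_def by blast
  moreover have "\<forall>r>0. v r = u r" by (simp add: v_def)
  ultimately show "regular u" using dv0 unfolding regular_def by blast
qed

end

section \<open>Classification of radial solutions\<close>

lemma radial_solutionI:
  assumes "\<And>r. 0 < r \<Longrightarrow> (u has_real_derivative u' r) (at r)"
    and "\<And>r. 0 < r \<Longrightarrow> (u' has_real_derivative u'' r) (at r)"
    and cont: "continuous_on {0<..} u''"
    and eq: "\<And>r. 0 < r \<Longrightarrow> u'' r + (real N - 1) / r * u' r + \<bar>u r\<bar> powr \<alpha> * u r = 0"
  shows "radial_solution N \<alpha> u"
proof -
  have d1: "deriv u r = u' r" if "0 < r" for r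
    using assms(1)[OF that] by (rule DERIV_imp_deriv)
  have d2: "deriv (deriv u) r = u'' r" if "0 < r" for r
  proof (rule DERIV_imp_deriv)
    show "(deriv u has_real_derivative u'' r) (at r)"
      by (rule has_field_derivative_transform_within_open[OF assms(2)[OF that], of "{0<..}"])
        (use that d1 in auto)
  qed
  have "C2_on {0<..} u"
    unfolding C2_on_def
    by (intro exI[of _ u'] exI[of _ u''] conjI ballI cont)
      (auto intro!: DERIV_subset[OF assms(1)] DERIV_subset[OF assms(2)])
  then show ?thesis
    unfolding radial_solution_def using d1 d2 eq by simp
qed

lemma finite_limit_at_0_minus: "finite_limit_at_0 (\<lambda>r. - u r) \<longleftrightarrow> finite_limit_at_0 u"
proof -
  have "finite_limit_at_0 (\<lambda>r. - v r)" if "finite_limit_at_0 v" for v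
    using that tendsto_minus unfolding finite_limit_at_0_def by blast
  from this[of u] this[of "\<lambda>r. - u r"] show ?thesis by auto
qed

context radial_emden
begin

lemma radial_emden_minus: "radial_emden N \<alpha> (\<lambda>r. - u r)"
proof
  show "radial_solution N \<alpha> (\<lambda>r. - u r)"
  proof (rule radial_solutionI)
    fix r :: real assume r: "0 < r"
    show "((\<lambda>r. - u r) has_real_derivative - deriv u r) (at r)"
      by (rule DERIV_minus[OF deriv_u[OF r]])
    show "((\<lambda>r. - deriv u r) has_real_derivative - deriv (deriv u) r) (at r)"
      by (rule DERIV_minus[OF deriv_u'[OF r]])
    show "- deriv (deriv u) r + (real N - 1) / r * - deriv u r + \<bar>- u r\<bar> powr \<alpha> * - u r = 0"
      unfolding equation[OF r] by simp
  qed (intro continuous_on_minus continuous_u'')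
qed (use N_ge alpha_gt alpha_lt in auto)

lemma singular_iff: "singular u \<longleftrightarrow> (w \<longlongrightarrow> k) at_bot \<or> (w \<longlongrightarrow> - k) at_bot"
proof -
  obtain l where l: "l \<in> {0, k, - k}" "(w \<longlongrightarrow> l) at_bot" using tendsto_at_bot by blast
  have uniq: "m = l" if "(w \<longlongrightarrow> m) at_bot" for m
    using tendsto_unique[OF _ that l(2)] by simp
  show ?thesis
  proof
    assume "singular u"
    then have "l \<noteq> 0" using l(2) unfolding singular_def finite_limit_iff by auto
    then show "(w \<longlongrightarrow> k) at_bot \<or> (w \<longlongrightarrow> - k) at_bot" using l by auto
  next
    assume "(w \<longlongrightarrow> k) at_bot \<or> (w \<longlongrightarrow> - k) at_bot"
    then have "l \<noteq> 0" using uniq[of k] uniq[of "- k"] k_pos by auto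
    then show "singular u" using uniq[of 0] unfolding singular_def finite_limit_iff by auto
  qed
qed

lemma singular_imp_negative_energy:
  assumes "singular u"
  obtains t where "energy t < 0"
proof -
  obtain l where l: "l \<in> {k, - k}" "(w \<longlongrightarrow> l) at_bot"
    using assms singular_iff by auto
  moreover have "(p \<longlongrightarrow> 0) at_bot" using tendsto_at_bot by blast
  ultimately have "(energy \<longlongrightarrow> \<bar>l\<bar> powr (\<alpha> + 2) / (\<alpha> + 2)
      - 2 / \<alpha> * (real N - 2 - 2 / \<alpha>) / 2 * l\<^sup>2) at_bot"
    by (intro tendsto_energy)
  moreover have "\<bar>l\<bar> powr (\<alpha> + 2) / (\<alpha> + 2) - 2 / \<alpha> * (real N - 2 - 2 / \<alpha>) / 2 * l\<^sup>2 < 0"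
    using l(1) equilibrium_energy_neg by auto
  ultimately have "\<forall>\<^sub>F t in at_bot. energy t < 0" by (rule order_tendstoD(2))
  then show thesis using that eventually_happens'[OF trivial_limit_at_bot_linorder] by blast
qed

text \<open>
  The energy is negative near \<open>-\<infinity>\<close>. It cannot stay negative without forcing a constant sign, so the intermediate
  value theorem gives a zero.
\<close>

lemma not_constant_sign_imp_zero_energy:
  assumes "singular u" and "\<not> constant_sign u"
  shows "\<exists>t. energy t = 0"
proof -
  obtain s where s: "energy s < 0" using singular_imp_negative_energy[OF assms(1)] .
  have "\<not> ((\<forall>t. 0 < w t) \<or> (\<forall>t. w t < 0))"
  proof
    assume *: "(\<forall>t. 0 < w t) \<or> (\<forall>t. w t < 0)"
    have "constant_sign u"
      unfolding constant_sign_def using * sign_w[of "ln r" for r] by (metis exp_ln)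
    then show False using assms(2) by simp
  qed
  then obtain t where t: "0 \<le> energy t" using negative_energy_imp_constant_sign not_less by blast
  have "s \<le> t" using energy_mono[of t s] s t by linarith
  then show ?thesis using IVT[of energy s 0 t] s t isCont_energy by auto
qed

lemma zero_energy_imp_positive_energy:
  assumes zero: "energy s = 0" and nonzero: "w x \<noteq> 0" and "s < t"
  shows "0 < energy t"
proof -
  have "\<not> (\<exists>l\<in>{0, k, - k}. \<forall>t. w t = l)"
  proof
    assume "\<exists>l\<in>{0, k, - k}. \<forall>t. w t = l"
    then obtain l where l: "l \<in> {0, k, - k}" "\<And>t. w t = l" by blast
    then have l': "l \<in> {k, - k}" using nonzero by auto
    have "w = (\<lambda>_. l)" using l(2) by auto
    then have "((\<lambda>_. l) has_real_derivative p s) (at s)" using deriv_w[of s] by simp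
    then have "p s = 0" by (rule DERIV_unique[OF _ DERIV_const])
    then have "energy s = \<bar>l\<bar> powr (\<alpha> + 2) / (\<alpha> + 2) - 2 / \<alpha> * (real N - 2 - 2 / \<alpha>) / 2 * l\<^sup>2"
      using l(2)[of s] by (simp add: energy_def)
    also have "\<dots> < 0" using l' equilibrium_energy_neg by auto
    finally show False using zero by simp
  qed
  then show ?thesis using energy_strict_mono[OF \<open>s < t\<close>] zero by simp
qed

lemma positive_energy_imp_oscillates_at_infinity:
  assumes "0 < energy t"
  shows "oscillates_at_infinity u"
  unfolding oscillates_at_infinity_def
proof (intro allI impI)
  fix R :: real assume "0 < R"
  obtain a b where ab: "ln R < a" "0 < w a" "ln R < b" "w b < 0"
    using positive_energy_imp_oscillates[OF assms, of "ln R"] by blast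
  have "exp (ln R) < exp a" "exp (ln R) < exp b"
    using ab by (auto simp only: exp_less_cancel_iff)
  then have "exp a \<in> {R<..}" "exp b \<in> {R<..}" using \<open>0 < R\<close> by auto
  moreover have "0 < u (exp a)" "u (exp b) < 0" using ab sign_w by auto
  ultimately show "changes_sign_on {R<..} u" unfolding changes_sign_on_def by blast
qed

lemma oscillates_imp_changes_sign:
  assumes "oscillates_at_infinity u"
  shows "changes_sign_on {0<..} u"
proof -
  have "changes_sign_on {1<..} u" using assms by (simp add: oscillates_at_infinity_def)
  then obtain r s where "1 < r" "0 < u r" "1 < s" "u s < 0" by (auto simp: changes_sign_on_def)
  then show ?thesis unfolding changes_sign_on_def
    by (intro conjI bexI[of _ r] bexI[of _ s]) auto
qed

lemma changes_sign_imp_not_constant_sign: "changes_sign_on {0<..} u \<Longrightarrow> \<not> constant_sign u"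
  unfolding changes_sign_on_def constant_sign_def by fastforce

lemma zero_energy_imp_singular:
  assumes "energy s = 0" and "w x \<noteq> 0"
  shows "singular u"
  using vanishing_imp_energy_pos[of x s] assms finite_limit_iff by (auto simp: singular_def)

text \<open>
  The defining property of \<open>u\<^sub>\<mu>\<close> includes uniqueness on \<open>(0,\<infinity>)\<close>, which is supplied by
  \<open>fast_decay_unique\<close>.
\<close>

lemma positive_singular_classified:
  assumes sing: "singular u" and pos: "\<And>r. 0 < r \<Longrightarrow> 0 < u r"
  shows "(\<forall>r>0. u r = beta N \<alpha> powr (1 / \<alpha>) * r powr (- (2 / \<alpha>))) \<or> (\<exists>\<mu>>0. is_u_lambda N \<alpha> \<mu> u)"
proof -
  have w_pos: "0 < w t" for t using pos sign_w by simp
  have "\<not> (w \<longlongrightarrow> - k) at_bot"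
  proof
    assume "(w \<longlongrightarrow> - k) at_bot"
    then have "0 \<le> - k"
      by (rule tendsto_lowerbound) (use w_pos in \<open>auto intro!: always_eventually less_imp_le\<close>)
    then show False using k_pos by simp
  qed
  then have lim: "(w \<longlongrightarrow> k) at_bot" using sing singular_iff by blast
  from positive_imp_classified[OF lim w_pos] show ?thesis
  proof
    assume "\<forall>t. w t = k"
    then have "u r = beta N \<alpha> powr (1 / \<alpha>) * r powr (- (2 / \<alpha>))" if "0 < r" for r
      using u_eq[OF that] unfolding k_eq by (simp only: mult.commute)
    then show ?thesis by blast
  next
    assume "\<exists>\<mu>>0. ((\<lambda>t. exp ((real N - 2 - 2 / \<alpha>) * t) * w t) \<longlongrightarrow> \<mu>) at_top"
    then obtain \<mu> where \<mu>: "\<mu> > 0" "((\<lambda>t. exp ((real N - 2 - 2 / \<alpha>) * t) * w t) \<longlongrightarrow> \<mu>) at_top"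
      by blast
    have "u_lambda_spec N \<alpha> \<mu> u"
      unfolding u_lambda_spec_def tendsto_w_iff tendsto_fast_iff
      unfolding k_eq[symmetric] using solution pos lim \<mu>(2) by blast
    moreover have "v r = u r" if v: "u_lambda_spec N \<alpha> \<mu> v" and "0 < r" for v r
    proof -
      interpret V: radial_emden N \<alpha> v
        by standard (use N_ge alpha_gt alpha_lt v in \<open>auto simp: u_lambda_spec_def\<close>)
      have "V.w (ln r) = w (ln r)"
      proof (rule fast_decay_unique[OF V.subcritical_emden_fowler_axioms subcritical_emden_fowler_axioms])
        show "0 < V.w t" for t
          using v V.sign_w by (simp add: u_lambda_spec_def)
        show "((\<lambda>t. exp ((real N - 2 - 2 / \<alpha>) * t) * V.w t) \<longlongrightarrow> \<mu>) at_top"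
          using v unfolding u_lambda_spec_def V.tendsto_fast_iff by blast
      qed (use w_pos \<mu> in auto)
      then show ?thesis
        using V.u_eq[OF \<open>0 < r\<close>] u_eq[OF \<open>0 < r\<close>] by simp
    qed
    ultimately have "is_u_lambda N \<alpha> \<mu> u" unfolding is_u_lambda_def by blast
    then show ?thesis using \<mu>(1) by blast
  qed
qed

lemma constant_sign_singular_iff:
  "constant_sign u \<and> singular u \<longleftrightarrow>
    (\<exists>\<sigma>\<in>{1, -1}.
      (\<forall>r>0. u r = \<sigma> * beta N \<alpha> powr (1 / \<alpha>) * r powr (- (2 / \<alpha>))) \<or>
      (\<exists>\<mu>>0. is_u_lambda N \<alpha> \<mu> (\<lambda>r. \<sigma> * u r)))" (is "?L \<longleftrightarrow> (\<exists>\<sigma>\<in>{1, -1}. ?R \<sigma>)")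
proof
  assume L: ?L
  interpret M: radial_emden N \<alpha> "\<lambda>r. - u r" by (rule radial_emden_minus)
  have "(\<forall>r>0. 0 < u r) \<or> (\<forall>r>0. u r < 0)" using L by (simp add: constant_sign_def)
  then show "\<exists>\<sigma>\<in>{1, -1}. ?R \<sigma>"
  proof
    assume "\<forall>r>0. 0 < u r"
    then have "?R 1" using positive_singular_classified L by simp
    then show ?thesis by blast
  next
    assume "\<forall>r>0. u r < 0"
    then have "(\<forall>r>0. - u r = beta N \<alpha> powr (1 / \<alpha>) * r powr (- (2 / \<alpha>))) \<or> (\<exists>\<mu>>0. is_u_lambda N \<alpha> \<mu> (\<lambda>r. - u r))"
      using L by (intro M.positive_singular_classified) (auto simp: singular_def finite_limit_at_0_minus)
    then have "?R (-1)"
    proof (elim disjE)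
      assume *: "\<forall>r>0. - u r = beta N \<alpha> powr (1 / \<alpha>) * r powr (- (2 / \<alpha>))"
      have "u r = -1 * beta N \<alpha> powr (1 / \<alpha>) * r powr (- (2 / \<alpha>))" if "0 < r" for r
        using *[rule_format, OF that] by linarith
      then show ?thesis by blast
    qed simp
    then show ?thesis by blast
  qed
next
  assume "\<exists>\<sigma>\<in>{1, -1}. ?R \<sigma>"
  then obtain \<sigma> where \<sigma>: "\<sigma> \<in> {1, -1}" "?R \<sigma>" by blast
  from \<sigma>(2) show ?L
  proof
    assume eq: "\<forall>r>0. u r = \<sigma> * beta N \<alpha> powr (1 / \<alpha>) * r powr (- (2 / \<alpha>))"
    have "w t = \<sigma> * k" for t
    proof -
      have "w t = exp t powr (2 / \<alpha>) * (\<sigma> * k * exp t powr (- (2 / \<alpha>)))"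
        using w_ln[of "exp t"] eq unfolding k_eq by simp
      also have "\<dots> = \<sigma> * k * (exp t powr (2 / \<alpha>) * exp t powr (- (2 / \<alpha>)))"
        by (simp only: mult_ac)
      also have "exp t powr (2 / \<alpha>) * exp t powr (- (2 / \<alpha>)) = 1"
        unfolding powr_add[symmetric] by simp
      finally show ?thesis by simp
    qed
    then have "w = (\<lambda>_. \<sigma> * k)" by auto
    then have "singular u" unfolding singular_iff using \<sigma>(1) by auto
    moreover have "constant_sign u"
      using eq \<sigma>(1) k_pos unfolding k_eq constant_sign_def by auto
    ultimately show ?L by simp
  next
    assume "\<exists>\<mu>>0. is_u_lambda N \<alpha> \<mu> (\<lambda>r. \<sigma> * u r)"
    then obtain \<mu> where spec: "u_lambda_spec N \<alpha> \<mu> (\<lambda>r. \<sigma> * u r)" by (auto simp: is_u_lambda_def)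
    then have pos: "\<forall>r>0. 0 < \<sigma> * u r"
      and lim: "((\<lambda>r. r powr (2 / \<alpha>) * (\<sigma> * u r)) \<longlongrightarrow> k) (at_right 0)"
      unfolding u_lambda_spec_def k_eq by blast+
    have "constant_sign u"
    proof (cases "\<sigma> = 1")
      case True
      then show ?thesis using pos unfolding constant_sign_def by simp
    next
      case False
      then have "\<sigma> = -1" using \<sigma>(1) by simp
      then show ?thesis using pos unfolding constant_sign_def by simp
    qed
    moreover have "singular u"
    proof -
      have "((\<lambda>r. \<sigma> * (r powr (2 / \<alpha>) * (\<sigma> * u r))) \<longlongrightarrow> \<sigma> * k) (at_right 0)"
        by (intro tendsto_mult lim tendsto_const)
      moreover have "\<sigma> * (a * (\<sigma> * b)) = a * b" for a b :: real
        using \<sigma>(1) by auto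
      ultimately have "((\<lambda>r. r powr (2 / \<alpha>) * u r) \<longlongrightarrow> \<sigma> * k) (at_right 0)"
        by (simp only:)
      then have "(w \<longlongrightarrow> \<sigma> * k) at_bot" unfolding tendsto_w_iff .
      moreover have "\<sigma> * k = k \<or> \<sigma> * k = - k" using \<sigma>(1) by auto
      ultimately show ?thesis unfolding singular_iff by metis
    qed
    ultimately show ?L by simp
  qed
qed

end

section \<open>Integration on Euclidean space\<close>

text \<open>
  On the shell \<open>R 2\<^bsup>-n-1\<^esup> < |x| \<le> R 2\<^bsup>-n\<^esup>\<close> the function is at most a multiple of \<open>2\<^bsup>ns\<^esup>\<close>, and the shell lies in a ball whose
  volume is a multiple of \<open>2\<^bsup>-n DIM\<^esup>\<close>. The resulting series is geometric with ratio \<open>2\<^bsup>s-DIM\<^esup> < 1\<close>.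
\<close>

lemma integrable_norm_powr:
  fixes s R :: real
  assumes s: "0 \<le> s" "s < DIM('a::euclidean_space)" and R: "0 < R"
  shows "integrable lborel (\<lambda>x::'a. indicator (cball 0 R) x * norm x powr (- s))"
proof (rule integrableI_nonneg)
  define c where "c n = (R * (1/2) ^ Suc n) powr (- s)" for n :: nat
  have c: "0 \<le> c n" for n by (simp add: c_def)
  have pointwise: "ennreal (indicator (cball 0 R) x * norm x powr (- s))
      \<le> (\<Sum>n. ennreal (c n) * indicator (cball 0 (R * (1/2) ^ n)) x)" for x :: 'a
  proof (cases "x \<noteq> 0 \<and> norm x \<le> R")
    case True
    then have x: "0 < norm x" "norm x \<le> R" by auto
    have "\<exists>n. R * (1/2) ^ Suc n < norm x"
    proof -
      obtain n where n: "(1/2) ^ n < norm x / R"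
        using real_arch_pow_inv[of "norm x / R" "1/2"] x R by auto
      then have "R * (1/2) ^ n < norm x" using R by (simp add: field_simps)
      moreover have "R * (1/2) ^ Suc n \<le> R * (1/2) ^ n" using R by simp
      ultimately show ?thesis by (intro exI[of _ n]) linarith
    qed
    then have "\<exists>n. R * (1/2) ^ Suc n < norm x \<and> norm x \<le> R * (1/2) ^ n"
    proof -
      define n where "n = (LEAST n. R * (1/2) ^ Suc n < norm x)"
      assume "\<exists>n. R * (1/2) ^ Suc n < norm x"
      then have n: "R * (1/2) ^ Suc n < norm x" unfolding n_def by (rule LeastI_ex)
      have "norm x \<le> R * (1/2) ^ n"
      proof (cases n)
        case 0
        then show ?thesis using x by simp
      next
        case (Suc m)
        then have "m < (LEAST n. R * (1/2) ^ Suc n < norm x)" by (simp add: n_def)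
        from not_less_Least[OF this] show ?thesis using Suc by (simp only: not_less)
      qed
      then show ?thesis using n by blast
    qed
    then obtain n where n: "R * (1/2) ^ Suc n < norm x" "norm x \<le> R * (1/2) ^ n" by blast
    have "norm x powr (- s) \<le> c n"
      unfolding c_def
    proof (rule powr_mono2')
      show "0 < R * (1/2) ^ Suc n" using R by simp
    qed (use n(1) s(1) in auto)
    then have "ennreal (indicator (cball 0 R) x * norm x powr (- s)) \<le> ennreal (c n) * indicator (cball 0 (R * (1/2) ^ n)) x"
      using x n(2) by (simp add: ennreal_leI)
    also have "\<dots> \<le> (\<Sum>n. ennreal (c n) * indicator (cball 0 (R * (1/2) ^ n)) x)"
    proof -
      have "f n \<le> suminf f" for f :: "nat \<Rightarrow> ennreal"
        using sum_le_suminf[of f "{n}"] by simp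
      then show ?thesis .
    qed
    finally show ?thesis .
  qed auto
  define v where "v = unit_ball_vol (real DIM('a))"
  define \<rho> where "\<rho> = 2 powr (s - DIM('a))"
  have \<rho>: "0 < \<rho>" "\<rho> < 1" using s by (auto simp: \<rho>_def powr_less_one)
  have shell: "c n * (v * (R * (1/2) ^ n) ^ DIM('a)) = (c 0 * v * R ^ DIM('a)) * \<rho> ^ n" for n
  proof -
    have "c n = c 0 * (2 powr s) ^ n"
    proof -
      have "c n = ((R * (1/2)) * (1/2) ^ n) powr (- s)" by (simp add: c_def mult.assoc)
      also have "\<dots> = c 0 * ((1/2) ^ n) powr (- s)"
        using R by (subst powr_mult) (auto simp: c_def)
      also have "((1/2::real) ^ n) powr (- s) = (2 powr s) ^ n"
        by (simp add: powr_realpow[symmetric] powr_powr powr_divide powr_minus field_simps)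
      finally show ?thesis .
    qed
    moreover have "((1/2::real) ^ n) ^ DIM('a) = (2 powr (- DIM('a))) ^ n"
      by (simp add: power_mult[symmetric] powr_minus powr_realpow power_divide field_simps)
    moreover have "\<rho> ^ n = (2 powr s) ^ n * (2 powr (- DIM('a))) ^ n"
      by (simp add: \<rho>_def power_mult_distrib[symmetric] powr_add[symmetric])
    ultimately show ?thesis by (simp add: power_mult_distrib mult_ac)
  qed
  have "(\<integral>\<^sup>+ x. ennreal (indicator (cball 0 R) x * norm (x::'a) powr (- s)) \<partial>lborel)
     \<le> (\<integral>\<^sup>+ x. (\<Sum>n. ennreal (c n) * indicator (cball 0 (R * (1/2) ^ n)) (x::'a)) \<partial>lborel)"
    by (intro nn_integral_mono pointwise)
  also have "\<dots> = (\<Sum>n. \<integral>\<^sup>+ x. ennreal (c n) * indicator (cball 0 (R * (1/2) ^ n)) (x::'a) \<partial>lborel)"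
    by (intro nn_integral_suminf borel_measurable_times_ennreal borel_measurable_const
        borel_measurable_indicator) auto
  also have "\<dots> = (\<Sum>n. ennreal ((c 0 * v * R ^ DIM('a)) * \<rho> ^ n))"
  proof (rule suminf_cong)
    fix n
    have "(\<integral>\<^sup>+ x. ennreal (c n) * indicator (cball 0 (R * (1/2) ^ n)) (x::'a) \<partial>lborel)
        = ennreal (c n) * ennreal (v * (R * (1/2) ^ n) ^ DIM('a))"
      using R by (simp add: nn_integral_cmult_indicator emeasure_cball v_def)
    also have "\<dots> = ennreal ((c 0 * v * R ^ DIM('a)) * \<rho> ^ n)"
      unfolding shell[symmetric] using c R by (intro ennreal_mult[symmetric]) (auto simp: v_def)
    finally show "(\<integral>\<^sup>+ x. ennreal (c n) * indicator (cball 0 (R * (1/2) ^ n)) (x::'a) \<partial>lborel)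
       = ennreal ((c 0 * v * R ^ DIM('a)) * \<rho> ^ n)" .
  qed
  also have "\<dots> < \<infinity>"
  proof -
    have "summable (\<lambda>n. (c 0 * v * R ^ DIM('a)) * \<rho> ^ n)"
      using \<rho> by (intro summable_mult summable_geometric) auto
    moreover have "0 \<le> (c 0 * v * R ^ DIM('a)) * \<rho> ^ n" for n
      using c R \<rho> by (auto simp: v_def)
    ultimately show ?thesis by (subst suminf_ennreal2) auto
  qed
  finally show "(\<integral>\<^sup>+ x. ennreal (indicator (cball 0 R) x * norm (x::'a) powr (- s)) \<partial>lborel) < \<infinity>" .
  show "(\<lambda>x::'a. indicator (cball 0 R) x * norm x powr (- s)) \<in> borel_measurable lborel"
  proof (rule borel_measurable_times)
    show "indicator (cball (0::'a) R) \<in> borel_measurable lborel"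
      by (rule borel_measurable_indicator) simp
    show "(\<lambda>x::'a. norm x powr (- s)) \<in> borel_measurable lborel" by measurable
  qed
qed auto

lemma integrable_bounded_support:
  fixes f :: "'a::euclidean_space \<Rightarrow> real"
  assumes "f \<in> borel_measurable borel" and "\<And>x. \<bar>f x\<bar> \<le> M" and "\<And>x. R < norm x \<Longrightarrow> f x = 0"
  shows "integrable lborel f"
proof (rule Bochner_Integration.integrable_bound)
  show "integrable lborel (\<lambda>x::'a. M * indicator (cball 0 R) x)"
    by (intro integrable_mult_right integrable_real_indicator emeasure_lborel_cball_finite) auto
  show "AE x in lborel. norm (f x) \<le> norm (M * indicator (cball 0 R) x)"
  proof (rule AE_I2)
    fix x
    show "norm (f x) \<le> norm (M * indicator (cball 0 R) x)"
      using assms(2)[of x] assms(3)[of x] by (cases "norm x \<le> R") auto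
  qed
qed (use assms(1) in simp)

lemma lborel_integral_translate:
  fixes f :: "'a::euclidean_space \<Rightarrow> real"
  assumes [measurable]: "f \<in> borel_measurable borel"
  shows "(LINT x|lborel. f (c + x)) = (LINT x|lborel. f x)"
    and "integrable lborel f \<Longrightarrow> integrable lborel (\<lambda>x. f (c + x))"
proof -
  have "(LINT x|lborel. f x) = (LINT x|distr lborel borel ((+) c). f x)"
    by (simp add: lborel_distr_plus)
  also have "\<dots> = (LINT x|lborel. f (c + x))"
    by (rule integral_distr) auto
  finally show "(LINT x|lborel. f (c + x)) = (LINT x|lborel. f x)" by simp
  assume "integrable lborel f"
  then have "integrable (distr lborel borel ((+) c)) f"
    by (simp add: lborel_distr_plus)
  then show "integrable lborel (\<lambda>x. f (c + x))"
    by (subst (asm) integrable_distr_eq) auto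
qed

text \<open>
  Difference quotients of \<open>f\<close> have integral \<open>0\<close> because Lebesgue measure is translation invariant. They
  are bounded by the supremum of the derivative and supported in a fixed ball, so dominated convergence applies.
\<close>

lemma integral_directional_derivative:
  fixes f g :: "'a::euclidean_space \<Rightarrow> real"
  assumes f [measurable]: "f \<in> borel_measurable borel" and f_bound: "\<And>x. \<bar>f x\<bar> \<le> B"
    and f_supp: "\<And>x. R < norm x \<Longrightarrow> f x = 0"
    and deriv: "\<And>x. ((\<lambda>t. f (x + t *\<^sub>R b)) has_real_derivative g x) (at 0)"
    and g_bound: "\<And>x. \<bar>g x\<bar> \<le> M"
  shows "integrable lborel g" "(LINT x|lborel. g x) = 0"
proof -
  have f_int: "integrable lborel f"
    by (rule integrable_bounded_support[OF f f_bound f_supp])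
  define h where "h n = inverse (real (Suc n))" for n
  have h: "0 < h n" "h n \<le> 1" for n by (auto simp: h_def inverse_le_1_iff)
  define s where "s n x = (f (h n *\<^sub>R b + x) - f x) / h n" for n x
  have deriv': "((\<lambda>t. f (x + t *\<^sub>R b)) has_real_derivative g (x + t *\<^sub>R b)) (at t)" for x t
  proof -
    have "((\<lambda>r. f ((x + t *\<^sub>R b) + r *\<^sub>R b)) has_real_derivative g (x + t *\<^sub>R b)) (at (t - t))"
      using deriv[of "x + t *\<^sub>R b"] by simp
    then have "((\<lambda>r. f ((x + t *\<^sub>R b) + (r - t) *\<^sub>R b)) has_real_derivative g (x + t *\<^sub>R b)) (at t)"
      using DERIV_shift[of "\<lambda>r. f ((x + t *\<^sub>R b) + r *\<^sub>R b)" "g (x + t *\<^sub>R b)" t "- t"] by simp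
    then show ?thesis by (simp add: algebra_simps)
  qed
  have s_le: "\<bar>s n x\<bar> \<le> M" for n x
  proof -
    obtain z where "f (x + h n *\<^sub>R b) - f (x + 0 *\<^sub>R b) = (h n - 0) * g (x + z *\<^sub>R b)"
      using MVT2[of 0 "h n" "\<lambda>t. f (x + t *\<^sub>R b)" "\<lambda>t. g (x + t *\<^sub>R b)"] deriv' h(1) by blast
    then have "s n x = g (x + z *\<^sub>R b)" using h(1)[of n] by (simp add: s_def add.commute)
    then show ?thesis using g_bound by simp
  qed
  have s_supp: "s n x = 0" if "R + norm b < norm x" for n x
  proof -
    have "norm (h n *\<^sub>R b) \<le> 1 * norm b"
      using h[of n] unfolding norm_scaleR by (intro mult_right_mono) auto
    moreover have "norm x \<le> norm (h n *\<^sub>R b + x) + norm (h n *\<^sub>R b)"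
      using norm_triangle_ineq4[of "h n *\<^sub>R b + x" "h n *\<^sub>R b"] by simp
    ultimately have "R < norm (h n *\<^sub>R b + x)" "R < norm x"
      using that norm_ge_zero[of b] by linarith+
    then show ?thesis by (simp add: s_def f_supp)
  qed
  have s_lim: "(\<lambda>n. s n x) \<longlonglongrightarrow> g x" for x
  proof -
    have "((\<lambda>t. (f (x + t *\<^sub>R b) - f x) / t) \<longlongrightarrow> g x) (at 0)"
      using deriv[of x] by (simp add: has_field_derivative_iff)
    moreover have "filterlim h (at 0) sequentially"
      unfolding filterlim_at using h(1) LIMSEQ_inverse_real_of_nat
      by (auto simp: h_def[abs_def])
    ultimately have "(\<lambda>n. (f (x + h n *\<^sub>R b) - f x) / h n) \<longlonglongrightarrow> g x"
      by (rule filterlim_compose)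
    then show ?thesis by (simp add: s_def add.commute)
  qed
  have s_meas [measurable]: "s n \<in> borel_measurable borel" for n
    unfolding s_def by measurable
  have g_meas: "g \<in> borel_measurable borel"
    by (rule borel_measurable_LIMSEQ_real[OF s_lim s_meas])
  have g_supp: "g x = 0" if "R + norm b < norm x" for x
    using s_lim[of x] s_supp[OF that] by (simp add: LIMSEQ_const_iff)
  show "integrable lborel g"
    by (rule integrable_bounded_support[OF g_meas g_bound g_supp])
  have dom: "integrable lborel (\<lambda>x::'a. M * indicator (cball 0 (R + norm b)) x)"
    by (intro integrable_mult_right integrable_real_indicator emeasure_lborel_cball_finite) auto
  have "(\<lambda>n. LINT x|lborel. s n x) \<longlonglongrightarrow> (LINT x|lborel. g x)"
  proof (rule integral_dominated_convergence[OF _ _ dom])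
    show "AE x in lborel. (\<lambda>n. s n x) \<longlonglongrightarrow> g x" using s_lim by simp
    show "AE x in lborel. norm (s n x) \<le> M * indicator (cball 0 (R + norm b)) x" for n
    proof (rule AE_I2)
      fix x show "norm (s n x) \<le> M * indicator (cball 0 (R + norm b)) x"
        using s_le[of n x] s_supp[of x n] by (cases "norm x \<le> R + norm b") auto
    qed
  qed (use g_meas s_meas in auto)
  moreover have "(LINT x|lborel. s n x) = 0" for n
    unfolding s_def using lborel_integral_translate[OF f, of "h n *\<^sub>R b"] f_int
    by simp
  ultimately show "(LINT x|lborel. g x) = 0" by (simp add: LIMSEQ_const_iff)
qed

section \<open>Green's identity across a point singularity\<close>

lemma has_real_derivative_max_0_power2:
  "((\<lambda>s::real. (max 0 s)\<^sup>2) has_real_derivative 2 * max 0 s) (at s)"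
proof (cases "s = 0")
  case True
  have "((\<lambda>h::real. max 0 h) \<longlongrightarrow> max 0 0) (at 0)"
    by (intro tendsto_max tendsto_const tendsto_ident_at)
  moreover have "(max 0 h)\<^sup>2 / h = max 0 h" for h :: real
    by (simp add: max_def power2_eq_square)
  ultimately have "((\<lambda>h::real. ((max 0 (0 + h))\<^sup>2 - (max 0 0)\<^sup>2) / h) \<longlongrightarrow> 2 * max 0 0) (at 0)"
    by simp
  then show ?thesis using True by (simp add: DERIV_def)
next
  case False
  show ?thesis
  proof (cases "s > 0")
    case True
    have "((\<lambda>s. s\<^sup>2) has_real_derivative 2 * max 0 s) (at s)"
      using True by (auto intro!: derivative_eq_intros)
    then show ?thesis
      by (rule has_field_derivative_transform_within_open[of _ _ _ "{0<..}"]) (use True in auto)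
  next
    case neg: False
    have "((\<lambda>s. 0) has_real_derivative 2 * max 0 s) (at s)"
      using neg by (auto intro!: derivative_eq_intros)
    then show ?thesis
      by (rule has_field_derivative_transform_within_open[of _ _ _ "{..<0}"])
        (use neg False in auto)
  qed
qed

lemma borel_measurable_punctured:
  fixes h :: "'a::euclidean_space \<Rightarrow> real"
  assumes "continuous_on (- {0}) h" and "\<And>x. x \<noteq> 0 \<Longrightarrow> h' x = h x"
  shows "h' \<in> borel_measurable borel"
proof -
  have "(\<lambda>x. if x \<in> {0} then h' 0 else h x) \<in> borel_measurable borel"
    by (rule borel_measurable_continuous_on_if) (use assms(1) in auto)
  moreover have "(\<lambda>x. if x \<in> {0} then h' 0 else h x) = h'"
    using assms(2) by auto
  ultimately show ?thesis by simp
qed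

lemma bounded_on_annulus:
  fixes h h' :: "'a::euclidean_space \<Rightarrow> real"
  assumes cont: "continuous_on (- {0}) h" and "0 < e"
    and eq: "\<And>x. x \<noteq> 0 \<Longrightarrow> h' x = h x"
    and supp: "\<And>x. norm x < e \<Longrightarrow> h' x = 0" "\<And>x. R < norm x \<Longrightarrow> h' x = 0"
  obtains M where "\<And>x. \<bar>h' x\<bar> \<le> M"
proof -
  have "compact (cball 0 R - ball (0::'a) e)" by (intro compact_diff) auto
  moreover have "continuous_on (cball 0 R - ball (0::'a) e) h"
    by (rule continuous_on_subset[OF cont]) (use \<open>0 < e\<close> in auto)
  ultimately have "bounded (h ` (cball 0 R - ball 0 e))"
    by (intro compact_imp_bounded compact_continuous_image)
  then obtain M where M: "\<And>x. x \<in> cball 0 R - ball 0 e \<Longrightarrow> \<bar>h x\<bar> \<le> M"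
    unfolding bounded_iff real_norm_def by blast
  have "\<bar>h' x\<bar> \<le> max M 0" for x
  proof (cases "norm x < e \<or> R < norm x")
    case True
    then show ?thesis using supp by auto
  next
    case False
    then have "x \<noteq> 0" "x \<in> cball 0 R - ball 0 e" using \<open>0 < e\<close> by auto
    then show ?thesis using M[of x] eq[of x] by auto
  qed
  then show thesis by (rule that)
qed

lemma bounded_if_compact_support:
  fixes f :: "'a::euclidean_space \<Rightarrow> real"
  assumes cont: "continuous_on UNIV f" and supp: "\<And>x. R < norm x \<Longrightarrow> f x = 0"
  obtains M where "\<And>x. \<bar>f x\<bar> \<le> M"
proof -
  have "bounded (f ` cball 0 R)"
    by (intro compact_imp_bounded compact_continuous_image continuous_on_subset[OF cont]) auto
  then obtain M where M: "\<And>x. x \<in> cball 0 R \<Longrightarrow> \<bar>f x\<bar> \<le> M"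
    unfolding bounded_iff real_norm_def by blast
  have "\<bar>f x\<bar> \<le> max M 0" for x
    using M[of x] supp[of x] by (cases "R < norm x") auto
  then show thesis by (rule that)
qed

text \<open>
  The singularity at \<open>0\<close> is removed by the cutoff \<open>(max 0 (1 - \<epsilon>\<^sup>2/|x|\<^sup>2))\<^sup>2\<close>, which is continuously differentiable off the
  origin and vanishes for \<open>|x| \<le> \<epsilon>\<close>. The divergence of the cut-off vector field with components \<open>V \<phi>1 b - \<phi> V1 b\<close>
  has integral \<open>0\<close>. The gradient of the cutoff tends to \<open>0\<close> pointwise and is at most a multiple of \<open>1/|x|\<close>, uniformly in \<open>\<epsilon>\<close>. By
  the growth assumptions on \<open>V\<close> and \<open>V1\<close>, every term is thus dominated by a multiple of the integrable function
  \<open>|x|\<^bsup>-s\<^esup>\<close>, and \<open>\<epsilon> \<rightarrow> 0\<close> leaves the integral in the conclusion.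
\<close>

lemma green_punctured:
  fixes V \<phi> :: "'a::euclidean_space \<Rightarrow> real" and V1 V2 \<phi>1 \<phi>2 :: "'a \<Rightarrow> 'a \<Rightarrow> real" and s :: real
  assumes s: "0 \<le> s" "s < DIM('a)" and R: "0 < R"
    and V: "\<And>x b. x \<noteq> 0 \<Longrightarrow> b \<in> Basis \<Longrightarrow> ((\<lambda>t. V (x + t *\<^sub>R b)) has_real_derivative V1 b x) (at 0)"
    and V1: "\<And>x b. x \<noteq> 0 \<Longrightarrow> b \<in> Basis \<Longrightarrow> ((\<lambda>t. V1 b (x + t *\<^sub>R b)) has_real_derivative V2 b x) (at 0)"
    and \<phi>: "\<And>x b. b \<in> Basis \<Longrightarrow> ((\<lambda>t. \<phi> (x + t *\<^sub>R b)) has_real_derivative \<phi>1 b x) (at 0)"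
    and \<phi>1: "\<And>x b. b \<in> Basis \<Longrightarrow> ((\<lambda>t. \<phi>1 b (x + t *\<^sub>R b)) has_real_derivative \<phi>2 b x) (at 0)"
    and cont_V: "continuous_on (- {0}) V" "\<And>b. b \<in> Basis \<Longrightarrow> continuous_on (- {0}) (V1 b)"
      "\<And>b. b \<in> Basis \<Longrightarrow> continuous_on (- {0}) (V2 b)"
    and cont_\<phi>: "continuous_on UNIV \<phi>" "\<And>b. b \<in> Basis \<Longrightarrow> continuous_on UNIV (\<phi>1 b)"
      "\<And>b. b \<in> Basis \<Longrightarrow> continuous_on UNIV (\<phi>2 b)"
    and supp: "\<And>x. R < norm x \<Longrightarrow> \<phi> x = 0" "\<And>x b. R < norm x \<Longrightarrow> \<phi>1 b x = 0" "\<And>x b. R < norm x \<Longrightarrow> \<phi>2 b x = 0"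
    and V_le: "\<And>x. x \<noteq> 0 \<Longrightarrow> norm x \<le> R \<Longrightarrow> \<bar>V x\<bar> \<le> A * (norm x)\<^sup>2 * norm x powr (- s)"
    and V1_le: "\<And>x b. x \<noteq> 0 \<Longrightarrow> norm x \<le> R \<Longrightarrow> b \<in> Basis \<Longrightarrow> \<bar>V1 b x\<bar> \<le> A * norm x * norm x powr (- s)"
    and W_le: "\<And>x. x \<noteq> 0 \<Longrightarrow> norm x \<le> R \<Longrightarrow> \<bar>\<Sum>b\<in>Basis. V2 b x\<bar> \<le> A * norm x powr (- s)"
  shows "(LINT x|lborel. (if x = 0 then 0 else V x * (\<Sum>b\<in>Basis. \<phi>2 b x) - \<phi> x * (\<Sum>b\<in>Basis. V2 b x))) = 0"
proof -
  have A: "0 \<le> A"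
  proof -
    obtain b :: 'a where b: "b \<in> Basis" using nonempty_Basis by blast
    then have "R *\<^sub>R b \<noteq> 0" "norm (R *\<^sub>R b) \<le> R" using R by auto
    from W_le[OF this] have "0 \<le> A * norm (R *\<^sub>R b) powr (- s)"
      by (rule order_trans[OF abs_ge_zero])
    then show ?thesis using R b by (simp add: zero_le_mult_iff)
  qed
  define \<epsilon> where "\<epsilon> n = inverse (real (Suc n))" for n
  have \<epsilon>: "0 < \<epsilon> n" for n by (simp add: \<epsilon>_def)
  have \<epsilon>_lim: "\<epsilon> \<longlonglongrightarrow> 0" unfolding \<epsilon>_def by (rule LIMSEQ_inverse_real_of_nat)
  define q where "q e x = 1 - e\<^sup>2 / (x \<bullet> x)" for e and x :: 'a
  define q1 where "q1 e b x = e\<^sup>2 * (2 * (x \<bullet> b)) / (x \<bullet> x)\<^sup>2" for e and b x :: 'a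
  define F where "F e b x = (max 0 (q e x))\<^sup>2 * (V x * \<phi>1 b x - \<phi> x * V1 b x)" for e b x
  define G where "G e b x = 2 * max 0 (q e x) * q1 e b x * (V x * \<phi>1 b x - \<phi> x * V1 b x)
     + (max 0 (q e x))\<^sup>2 * (V x * \<phi>2 b x - \<phi> x * V2 b x)" for e b x
  \<comment> \<open>the value at \<open>0\<close> must be set, as \<open>q e 0 = 1\<close> by the convention on division by \<open>0\<close>\<close>
  define F0 where "F0 e b x = (if x = 0 then 0 else F e b x)" for e b x
  define G0 where "G0 e b x = (if x = 0 then 0 else G e b x)" for e b x
  have q_neg: "max 0 (q e x) = 0" if "x \<noteq> 0" "norm x \<le> e" for e x
  proof -
    have "x \<bullet> x \<le> e\<^sup>2"
      using that by (simp add: power2_norm_eq_inner[symmetric] power_mono)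
    then show ?thesis using that by (simp add: q_def max_def field_simps)
  qed
  have q_range: "0 \<le> max 0 (q e x)" "max 0 (q e x) \<le> 1" for e x
    by (auto simp: q_def)
  have inner_sq: "((\<lambda>t. (x + t *\<^sub>R b) \<bullet> (x + t *\<^sub>R b)) has_real_derivative 2 * (x \<bullet> b)) (at 0)" for x b :: 'a
  proof -
    have "(x + t *\<^sub>R b) \<bullet> (x + t *\<^sub>R b) = x \<bullet> x + 2 * t * (x \<bullet> b) + t\<^sup>2 * (b \<bullet> b)" for t
      by (simp add: inner_simps inner_commute algebra_simps power2_eq_square)
    then show ?thesis by (auto intro!: derivative_eq_intros)
  qed
  have dq: "((\<lambda>t. q e (x + t *\<^sub>R b)) has_real_derivative q1 e b x) (at 0)" if "x \<noteq> 0" for e x b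
  proof -
    have "((\<lambda>t. 1 - e\<^sup>2 / ((x + t *\<^sub>R b) \<bullet> (x + t *\<^sub>R b))) has_real_derivative
        0 - (0 * ((x + 0 *\<^sub>R b) \<bullet> (x + 0 *\<^sub>R b)) - e\<^sup>2 * (2 * (x \<bullet> b))) /
          (((x + 0 *\<^sub>R b) \<bullet> (x + 0 *\<^sub>R b)) * ((x + 0 *\<^sub>R b) \<bullet> (x + 0 *\<^sub>R b)))) (at 0)"
      by (intro DERIV_diff DERIV_const DERIV_divide inner_sq) (use that in simp)
    then show ?thesis by (simp add: q_def q1_def power2_eq_square)
  qed
  have F_deriv: "((\<lambda>t. F0 e b (x + t *\<^sub>R b)) has_real_derivative G0 e b x) (at 0)"
    if e: "0 < e" and b: "b \<in> Basis" for e b x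
  proof (cases "x = 0")
    case True
    have "((\<lambda>t. 0) has_real_derivative 0) (at (0::real))" by simp
    then have "((\<lambda>t. F0 e b (x + t *\<^sub>R b)) has_real_derivative 0) (at 0)"
    proof (rule has_field_derivative_transform_within_open[of _ _ _ "{- e<..<e}"])
      fix t assume "t \<in> {- e<..<e}"
      then have "norm (x + t *\<^sub>R b) \<le> e" using True b by auto
      then show "0 = F0 e b (x + t *\<^sub>R b)" using q_neg[of "x + t *\<^sub>R b" e] by (simp add: F0_def F_def)
    qed (use e in auto)
    then show ?thesis using True by (simp add: G0_def)
  next
    case False
    have eta: "((\<lambda>t. (max 0 (q e (x + t *\<^sub>R b)))\<^sup>2) has_real_derivative
        2 * max 0 (q e (x + 0 *\<^sub>R b)) * q1 e b x) (at 0)"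
      by (rule DERIV_chain2[OF has_real_derivative_max_0_power2 dq[OF False]])
    have "((\<lambda>t. F e b (x + t *\<^sub>R b)) has_real_derivative
        2 * max 0 (q e (x + 0 *\<^sub>R b)) * q1 e b x *
          (V (x + 0 *\<^sub>R b) * \<phi>1 b (x + 0 *\<^sub>R b) - \<phi> (x + 0 *\<^sub>R b) * V1 b (x + 0 *\<^sub>R b))
        + ((V1 b x * \<phi>1 b (x + 0 *\<^sub>R b) + \<phi>2 b x * V (x + 0 *\<^sub>R b))
          - (\<phi>1 b x * V1 b (x + 0 *\<^sub>R b) + V2 b x * \<phi> (x + 0 *\<^sub>R b))) * (max 0 (q e (x + 0 *\<^sub>R b)))\<^sup>2) (at 0)"
      unfolding F_def
      by (rule DERIV_mult[OF eta]) (intro DERIV_diff DERIV_mult V V1 \<phi> \<phi>1 False b)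
    then have "((\<lambda>t. F e b (x + t *\<^sub>R b)) has_real_derivative G e b x) (at 0)"
      by (rule DERIV_cong) (simp add: G_def algebra_simps)
    then have "((\<lambda>t. F0 e b (x + t *\<^sub>R b)) has_real_derivative G e b x) (at 0)"
    proof (rule has_field_derivative_transform_within_open[of _ _ _ "(\<lambda>t. x + t *\<^sub>R b) -` (- {0})"])
      show "open ((\<lambda>t. x + t *\<^sub>R b) -` (- {0}))"
        by (intro open_vimage continuous_intros)
    qed (use False in \<open>auto simp: F0_def\<close>)
    then show ?thesis using False by (simp add: G0_def)
  qed
  have cont_q: "continuous_on (- {0}) (\<lambda>x. max 0 (q e x))" "continuous_on (- {0}) (q1 e b)" for e b
    unfolding q_def q1_def by (auto intro!: continuous_intros)
  have cont_\<phi>': "continuous_on (- {0}) \<phi>" "\<And>b. b \<in> Basis \<Longrightarrow> continuous_on (- {0}) (\<phi>1 b)"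
      "\<And>b. b \<in> Basis \<Longrightarrow> continuous_on (- {0}) (\<phi>2 b)"
    using cont_\<phi> by (auto intro: continuous_on_subset)
  have cont_F: "continuous_on (- {0}) (F e b)" if "b \<in> Basis" for e b
    unfolding F_def
    by (intro continuous_on_mult continuous_on_diff continuous_on_power cont_q cont_V cont_\<phi>' that)
  have cont_G: "continuous_on (- {0}) (G e b)" if "b \<in> Basis" for e b
    unfolding G_def
    by (intro continuous_on_add continuous_on_mult continuous_on_diff continuous_on_power
        continuous_on_const cont_q cont_V cont_\<phi>' that)
  have int_G: "integrable lborel (G0 e b) \<and> (LINT x|lborel. G0 e b x) = 0" if e: "0 < e" and b: "b \<in> Basis" for e b
  proof -
    obtain B where B: "\<And>x. \<bar>F0 e b x\<bar> \<le> B"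
      by (rule bounded_on_annulus[OF cont_F[OF b] e, of "F0 e b" e R])
        (use q_neg supp in \<open>auto simp: F0_def F_def\<close>)
    obtain M where M: "\<And>x. \<bar>G0 e b x\<bar> \<le> M"
      by (rule bounded_on_annulus[OF cont_G[OF b] e, of "G0 e b" e R])
        (use q_neg supp in \<open>auto simp: G0_def G_def\<close>)
    have F_meas: "F0 e b \<in> borel_measurable borel"
      by (rule borel_measurable_punctured[OF cont_F[OF b]]) (simp add: F0_def)
    have F_supp: "F0 e b x = 0" if "R < norm x" for x
      using supp that by (simp add: F0_def F_def)
    show ?thesis
      using integral_directional_derivative[OF F_meas B F_supp F_deriv[OF e b] M] by simp
  qed
  define H where "H e x = (\<Sum>b\<in>Basis. G0 e b x)" for e x
  have int_H: "integrable lborel (H e)" "(LINT x|lborel. H e x) = 0" if "0 < e" for e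
    unfolding H_def using int_G[OF that] by (auto simp: Bochner_Integration.integral_sum)
  have H_eq: "H e x = 2 * max 0 (q e x) * (\<Sum>b\<in>Basis. q1 e b x * (V x * \<phi>1 b x - \<phi> x * V1 b x))
     + (max 0 (q e x))\<^sup>2 * (V x * (\<Sum>b\<in>Basis. \<phi>2 b x) - \<phi> x * (\<Sum>b\<in>Basis. V2 b x))" if "x \<noteq> 0" for e x
    using that by (simp add: H_def G0_def G_def sum.distrib sum_distrib_left sum_subtractf right_diff_distrib mult.assoc)
  obtain B where B: "\<And>x. \<bar>\<phi> x\<bar> \<le> B" "\<And>x b. b \<in> Basis \<Longrightarrow> \<bar>\<phi>1 b x\<bar> \<le> B" "\<And>x b. b \<in> Basis \<Longrightarrow> \<bar>\<phi>2 b x\<bar> \<le> B"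
  proof -
    obtain M0 where M0: "\<And>x. \<bar>\<phi> x\<bar> \<le> M0"
      using bounded_if_compact_support[OF cont_\<phi>(1) supp(1)] by blast
    have "\<forall>b\<in>Basis. \<exists>M. \<forall>x. \<bar>\<phi>1 b x\<bar> \<le> M" "\<forall>b\<in>Basis. \<exists>M. \<forall>x. \<bar>\<phi>2 b x\<bar> \<le> M"
      using bounded_if_compact_support[OF cont_\<phi>(2) supp(2)] bounded_if_compact_support[OF cont_\<phi>(3) supp(3)]
      by metis+
    then obtain M1 M2 where M: "\<And>b x. b \<in> Basis \<Longrightarrow> \<bar>\<phi>1 b x\<bar> \<le> M1 b" "\<And>b x. b \<in> Basis \<Longrightarrow> \<bar>\<phi>2 b x\<bar> \<le> M2 b"
      by metis
    define K where "K = \<bar>M0\<bar> + (\<Sum>b\<in>Basis. \<bar>M1 b\<bar>) + (\<Sum>b\<in>Basis. \<bar>M2 b\<bar>)"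
    have nonneg: "0 \<le> (\<Sum>b\<in>Basis. \<bar>M1 b\<bar>)" "0 \<le> (\<Sum>b\<in>Basis. \<bar>M2 b\<bar>)"
      by (auto intro: sum_nonneg)
    have member: "\<bar>M1 b\<bar> \<le> (\<Sum>b\<in>Basis. \<bar>M1 b\<bar>)" "\<bar>M2 b\<bar> \<le> (\<Sum>b\<in>Basis. \<bar>M2 b\<bar>)" if "b \<in> Basis" for b
      using that by (auto intro!: member_le_sum)
    show thesis
    proof (rule that[of K])
      show "\<bar>\<phi> x\<bar> \<le> K" for x unfolding K_def using M0[of x] nonneg by linarith
      show "\<bar>\<phi>1 b x\<bar> \<le> K" if "b \<in> Basis" for b x
        unfolding K_def using M(1)[OF that, of x] nonneg member[OF that] by linarith
      show "\<bar>\<phi>2 b x\<bar> \<le> K" if "b \<in> Basis" for b x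
        unfolding K_def using M(2)[OF that, of x] nonneg member[OF that] by linarith
    qed
  qed
  define L where "L x = (if x = 0 then 0 else V x * (\<Sum>b\<in>Basis. \<phi>2 b x) - \<phi> x * (\<Sum>b\<in>Basis. V2 b x))" for x
  define C where "C = 4 * real DIM('a) * (A * B * (R + 1)) + (A * R\<^sup>2 * (real DIM('a) * B) + B * A)"
  have "(\<lambda>n. LINT x|lborel. H (\<epsilon> n) x) \<longlonglongrightarrow> (LINT x|lborel. L x)"
  proof (rule integral_dominated_convergence)
    show "integrable lborel (\<lambda>x::'a. C * (indicator (cball 0 R) x * norm x powr (- s)))"
      by (intro integrable_mult_right integrable_norm_powr s R)
    have H_lim: "(\<lambda>n. H (\<epsilon> n) x) \<longlonglongrightarrow> L x" for x
    proof (cases "x = 0")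
      case True
      then show ?thesis by (simp add: H_def G0_def L_def)
    next
      case False
      have "(\<lambda>n. q (\<epsilon> n) x) \<longlonglongrightarrow> 1 - 0\<^sup>2 / (x \<bullet> x)"
        unfolding q_def using False by (intro tendsto_intros \<epsilon>_lim) auto
      then have 1: "(\<lambda>n. max 0 (q (\<epsilon> n) x)) \<longlonglongrightarrow> max 0 1"
        by (intro tendsto_max tendsto_const) simp
      have 2: "(\<lambda>n. q1 (\<epsilon> n) b x) \<longlonglongrightarrow> 0\<^sup>2 * (2 * (x \<bullet> b)) / (x \<bullet> x)\<^sup>2" for b
        unfolding q1_def using False by (intro tendsto_intros \<epsilon>_lim) auto
      have "(\<lambda>n. H (\<epsilon> n) x) \<longlonglongrightarrow> 2 * max 0 1 * (\<Sum>b\<in>Basis. (0\<^sup>2 * (2 * (x \<bullet> b)) / (x \<bullet> x)\<^sup>2) * (V x * \<phi>1 b x - \<phi> x * V1 b x))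
         + (max 0 1)\<^sup>2 * (V x * (\<Sum>b\<in>Basis. \<phi>2 b x) - \<phi> x * (\<Sum>b\<in>Basis. V2 b x))"
        unfolding H_eq[OF False] by (intro tendsto_add tendsto_mult tendsto_const tendsto_sum tendsto_power 1 2)
      then show ?thesis using False by (simp add: L_def)
    qed
    then show "AE x in lborel. (\<lambda>n. H (\<epsilon> n) x) \<longlonglongrightarrow> L x" by simp
    show "H (\<epsilon> n) \<in> borel_measurable lborel" for n
      using int_H(1)[OF \<epsilon>] by simp
    then show "L \<in> borel_measurable lborel"
      by (rule borel_measurable_LIMSEQ_real[OF H_lim])
    show "AE x in lborel. norm (H (\<epsilon> n) x) \<le> C * (indicator (cball 0 R) x * norm x powr (- s))" for n
    proof (rule AE_I2)
      fix x :: 'a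
      consider "x = 0" | "x \<noteq> 0" "R < norm x" | "x \<noteq> 0" "norm x \<le> R" by linarith
      then show "norm (H (\<epsilon> n) x) \<le> C * (indicator (cball 0 R) x * norm x powr (- s))"
      proof cases
        case 1
        then show ?thesis by (simp add: H_def G0_def)
      next
        case 2
        then show ?thesis by (simp add: H_eq supp)
      next
        case 3
        then have x: "0 < norm x" "norm x \<le> R" by auto
        define e where "e = \<epsilon> n"
        define r where "r = norm x powr (- s)"
        define Y where "Y b = V x * \<phi>1 b x - \<phi> x * V1 b x" for b
        define Z where "Z = V x * (\<Sum>b\<in>Basis. \<phi>2 b x) - \<phi> x * (\<Sum>b\<in>Basis. V2 b x)"
        have r: "0 \<le> r" by (simp add: r_def)
        have B0: "0 \<le> B" using B(1)[of 0] by linarith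
        have Y: "\<bar>Y b\<bar> \<le> A * B * (R + 1) * (norm x * r)" if b: "b \<in> Basis" for b
        proof -
          have "\<bar>V x * \<phi>1 b x\<bar> \<le> (A * (norm x)\<^sup>2 * r) * B"
            unfolding abs_mult r_def using V_le[OF 3] B(2)[OF b] A by (intro mult_mono) auto
          also have "\<dots> = (A * B) * (norm x * r) * norm x" by (simp add: power2_eq_square mult_ac)
          also have "\<dots> \<le> (A * B) * (norm x * r) * R"
            using x A B0 r by (intro mult_left_mono) auto
          finally have 1: "\<bar>V x * \<phi>1 b x\<bar> \<le> (A * B) * (norm x * r) * R" .
          have "\<bar>\<phi> x * V1 b x\<bar> \<le> B * (A * norm x * r)"
            unfolding abs_mult r_def using V1_le[OF 3 b] B(1) B0 by (intro mult_mono) auto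
          then have 2: "\<bar>\<phi> x * V1 b x\<bar> \<le> (A * B) * (norm x * r)" by (simp add: mult_ac)
          have "\<bar>Y b\<bar> \<le> \<bar>V x * \<phi>1 b x\<bar> + \<bar>\<phi> x * V1 b x\<bar>" unfolding Y_def by (rule abs_triangle_ineq4)
          also have "\<dots> \<le> (A * B) * (norm x * r) * R + (A * B) * (norm x * r)"
            using 1 2 by (rule add_mono)
          finally show ?thesis by (simp add: algebra_simps)
        qed
        have cut: "2 * max 0 (q e x) * \<bar>q1 e b x\<bar> \<le> 4 / norm x" if b: "b \<in> Basis" for b
        proof (cases "norm x \<le> e")
          case True
          then show ?thesis using q_neg[OF 3(1)] by simp
        next
          case False
          have e: "0 < e" using \<epsilon> by (simp add: e_def)
          have "e\<^sup>2 * (2 * \<bar>x \<bullet> b\<bar>) \<le> (norm x)\<^sup>2 * (2 * norm x)"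
            using False e Basis_le_norm[OF b, of x] by (intro mult_mono power_mono) auto
          then have "\<bar>q1 e b x\<bar> \<le> (norm x)\<^sup>2 * (2 * norm x) / ((norm x)\<^sup>2)\<^sup>2"
            unfolding q1_def power2_norm_eq_inner[symmetric] abs_divide abs_mult
            by (simp add: divide_right_mono)
          also have "\<dots> = 2 / norm x" using x by (simp add: power2_eq_square)
          finally have "2 * max 0 (q e x) * \<bar>q1 e b x\<bar> \<le> 2 * 1 * (2 / norm x)"
            using q_range[of e x] by (intro mult_mono) auto
          then show ?thesis by simp
        qed
        have "\<bar>2 * max 0 (q e x) * (\<Sum>b\<in>Basis. q1 e b x * Y b)\<bar>
            = \<bar>\<Sum>b\<in>Basis. (2 * max 0 (q e x) * q1 e b x) * Y b\<bar>"
          by (simp add: sum_distrib_left mult.assoc)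
        also have "\<dots> \<le> (\<Sum>b\<in>(Basis::'a set). 4 / norm x * (A * B * (R + 1) * (norm x * r)))"
        proof (rule order_trans[OF sum_abs sum_mono])
          fix b :: 'a assume b: "b \<in> Basis"
          have "\<bar>2 * max 0 (q e x) * q1 e b x * Y b\<bar> = 2 * max 0 (q e x) * \<bar>q1 e b x\<bar> * \<bar>Y b\<bar>"
            using q_range[of e x] by (simp add: abs_mult)
          also have "\<dots> \<le> 4 / norm x * (A * B * (R + 1) * (norm x * r))"
            using cut[OF b] Y[OF b] x by (intro mult_mono) auto
          finally show "\<bar>2 * max 0 (q e x) * q1 e b x * Y b\<bar> \<le> 4 / norm x * (A * B * (R + 1) * (norm x * r))" .
        qed
        also have "\<dots> = 4 * real DIM('a) * (A * B * (R + 1)) * r"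
          using x by simp
        finally have first: "\<bar>2 * max 0 (q e x) * (\<Sum>b\<in>Basis. q1 e b x * Y b)\<bar> \<le> 4 * real DIM('a) * (A * B * (R + 1)) * r" .
        have "\<bar>\<Sum>b\<in>Basis. \<phi>2 b x\<bar> \<le> real DIM('a) * B"
          by (rule order_trans[OF sum_abs sum_bounded_above]) (use B(3) in auto)
        then have "\<bar>V x * (\<Sum>b\<in>Basis. \<phi>2 b x)\<bar> \<le> (A * (norm x)\<^sup>2 * r) * (real DIM('a) * B)"
          unfolding abs_mult r_def using V_le[OF 3] A by (intro mult_mono) auto
        also have "\<dots> \<le> (A * R\<^sup>2 * r) * (real DIM('a) * B)"
          using x A B0 r by (intro mult_right_mono mult_left_mono power_mono) auto
        finally have Z1: "\<bar>V x * (\<Sum>b\<in>Basis. \<phi>2 b x)\<bar> \<le> A * R\<^sup>2 * (real DIM('a) * B) * r"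
          by (simp add: mult_ac)
        have "\<bar>\<phi> x * (\<Sum>b\<in>Basis. V2 b x)\<bar> \<le> B * (A * r)"
          unfolding abs_mult r_def using W_le[OF 3] B(1) B0 by (intro mult_mono) auto
        then have "\<bar>Z\<bar> \<le> A * R\<^sup>2 * (real DIM('a) * B) * r + B * A * r"
          unfolding Z_def using Z1 abs_triangle_ineq4[of "V x * (\<Sum>b\<in>Basis. \<phi>2 b x)" "\<phi> x * (\<Sum>b\<in>Basis. V2 b x)"]
          by (simp add: mult.assoc)
        moreover have "\<bar>(max 0 (q e x))\<^sup>2 * Z\<bar> \<le> 1 * \<bar>Z\<bar>"
          unfolding abs_mult using q_range[of e x] by (intro mult_right_mono) (auto simp: power_le_one)
        ultimately have "\<bar>(max 0 (q e x))\<^sup>2 * Z\<bar> \<le> A * R\<^sup>2 * (real DIM('a) * B) * r + B * A * r" by simp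
        then have "\<bar>H e x\<bar> \<le> 4 * real DIM('a) * (A * B * (R + 1)) * r + (A * R\<^sup>2 * (real DIM('a) * B) * r + B * A * r)"
          unfolding H_eq[OF 3(1)] Y_def[symmetric] Z_def[symmetric]
          by (intro order_trans[OF abs_triangle_ineq] add_mono first)
        also have "\<dots> = C * r" by (simp add: C_def algebra_simps)
        finally show ?thesis using x by (simp add: e_def r_def)
      qed
    qed
  qed
  moreover have "(LINT x|lborel. H (\<epsilon> n) x) = 0" for n by (rule int_H(2)[OF \<epsilon>])
  ultimately have "(LINT x|lborel. L x) = 0" by (simp add: LIMSEQ_const_iff)
  then show ?thesis by (simp add: L_def)
qed

section \<open>Radial functions of several variables\<close>

lemma partial_deriv_eq: "(f has_derivative f') (at x) \<Longrightarrow> partial_deriv b f x = f' b"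
  unfolding partial_deriv_def by (simp add: frechet_derivative_at[symmetric])

lemma has_real_derivative_along_line:
  fixes f :: "'a::real_normed_vector \<Rightarrow> real"
  assumes "(f has_derivative f') (at x)"
  shows "((\<lambda>t. f (x + t *\<^sub>R b)) has_real_derivative f' b) (at 0)"
proof -
  have "((\<lambda>t::real. x + t *\<^sub>R b) has_derivative (\<lambda>t. t *\<^sub>R b)) (at 0)"
    by (auto intro!: derivative_eq_intros)
  moreover have "(f has_derivative f') (at (x + 0 *\<^sub>R b))" using assms by simp
  ultimately have "((\<lambda>t. f (x + t *\<^sub>R b)) has_derivative (\<lambda>t. f' (t *\<^sub>R b))) (at 0)"
    by (rule has_derivative_compose)
  moreover have "f' (t *\<^sub>R b) = f' b * t" for t
    using linear_scale[OF has_derivative_linear[OF assms], of t b] by simp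
  ultimately show ?thesis by (simp add: has_field_derivative_def)
qed

lemma differentiable_along_line:
  fixes f :: "'a::euclidean_space \<Rightarrow> real"
  assumes "f differentiable at x"
  shows "((\<lambda>t. f (x + t *\<^sub>R b)) has_real_derivative partial_deriv b f x) (at 0)"
  unfolding partial_deriv_def
  by (rule has_real_derivative_along_line) (use assms frechet_derivative_works in blast)

lemma partial_deriv_outside_support:
  fixes f :: "'a::euclidean_space \<Rightarrow> real"
  assumes "\<And>x. R < norm x \<Longrightarrow> f x = 0" and "R < norm x"
  shows "partial_deriv b f x = 0"
proof -
  have "open {x::'a. R < norm x}" by (intro open_Collect_less continuous_intros)
  moreover have "((\<lambda>x. 0) has_derivative (\<lambda>h. 0)) (at x)" by simp
  ultimately have "(f has_derivative (\<lambda>h. 0)) (at x)"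
    using assms by (intro has_derivative_transform_within_open[of "\<lambda>x. 0" "\<lambda>h. 0" x UNIV "{x. R < norm x}" f]) auto
  then show ?thesis by (simp add: partial_deriv_eq)
qed

lemma Ck_on_cong:
  fixes f g :: "'a::euclidean_space \<Rightarrow> real"
  assumes "open S" "\<And>x. x \<in> S \<Longrightarrow> f x = g x"
  shows "Ck_on k S f \<Longrightarrow> Ck_on k S g"
  using assms(2)
proof (induction k arbitrary: f g)
  case 0
  then show ?case using continuous_on_cong[of S S f g] by simp
next
  case (Suc k)
  have fr: "(g has_derivative frechet_derivative f (at x)) (at x)" if "x \<in> S" for x
  proof (rule has_derivative_transform_within_open[OF _ assms(1) that])
    show "(f has_derivative frechet_derivative f (at x)) (at x)"
      using Suc.prems(1) that by (simp add: frechet_derivative_works[symmetric])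
  qed (use Suc.prems(2) in auto)
  have eq: "partial_deriv b f x = partial_deriv b g x" if "x \<in> S" for b x
    using partial_deriv_eq[OF fr[OF that], of b] by (simp add: partial_deriv_def)
  have "g differentiable at x" if "x \<in> S" for x
    using fr[OF that] by (rule differentiableI)
  moreover have "Ck_on k S (partial_deriv b g)" if "b \<in> Basis" for b
    by (rule Suc.IH[of "partial_deriv b f"]) (use Suc.prems(1) that eq in auto)
  ultimately show ?case by simp
qed

lemma AE_lborel_neq: "AE x in lborel. x \<noteq> (c :: 'a::euclidean_space)"
  by (rule AE_I'[of "{c}"]) auto

lemma integrable_norm_powr_bound:
  fixes f :: "'a::euclidean_space \<Rightarrow> real" and s :: real
  assumes s: "0 \<le> s" "s < DIM('a)" and R: "0 < R" and f: "f \<in> borel_measurable borel"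
    and bound: "\<And>x. x \<noteq> 0 \<Longrightarrow> norm x \<le> R \<Longrightarrow> \<bar>f x\<bar> \<le> C * norm x powr (- s)"
    and supp: "\<And>x. R < norm x \<Longrightarrow> f x = 0"
  shows "integrable lborel f"
proof (rule Bochner_Integration.integrable_bound)
  show "integrable lborel (\<lambda>x::'a. C * (indicator (cball 0 R) x * norm x powr (- s)))"
    by (intro integrable_mult_right integrable_norm_powr s R)
  show "AE x in lborel. norm (f x) \<le> norm (C * (indicator (cball 0 R) x * norm x powr (- s)))"
    using AE_lborel_neq[of 0]
  proof eventually_elim
    fix x :: 'a assume x: "x \<noteq> 0"
    show "norm (f x) \<le> norm (C * (indicator (cball 0 R) x * norm x powr (- s)))"
    proof (cases "norm x \<le> R")
      case True
      then show ?thesis using order_trans[OF bound[OF x True] abs_ge_self] by simp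
    qed (use supp in auto)
  qed
qed (use f in simp)

lemma Lp_loc_if_norm_powr_bound:
  fixes f :: "'a::euclidean_space \<Rightarrow> real" and s :: real
  assumes s: "0 \<le> s" "s < DIM('a)" and f: "f \<in> borel_measurable borel"
    and bound: "\<And>R. 0 < R \<Longrightarrow> \<exists>C. \<forall>x. x \<noteq> 0 \<longrightarrow> norm x \<le> R \<longrightarrow> \<bar>f x\<bar> powr p \<le> C * norm x powr (- s)"
  shows "Lp_loc p f"
  unfolding Lp_loc_def
proof (intro conjI allI impI)
  show "f \<in> borel_measurable lebesgue" using f by (simp add: measurable_completion)
  fix K :: "'a set" assume K: "compact K"
  obtain R where R: "0 < R" "K \<subseteq> cball 0 R"
    using compact_imp_bounded[OF K] unfolding bounded_pos by fastforce
  obtain C where C: "\<And>x. x \<noteq> 0 \<Longrightarrow> norm x \<le> R \<Longrightarrow> \<bar>f x\<bar> powr p \<le> C * norm x powr (- s)"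
    using bound[OF R(1)] by blast
  have [measurable]: "K \<in> sets borel" using K by (simp add: borel_compact)
  have meas: "(\<lambda>x. indicator K x *\<^sub>R \<bar>f x\<bar> powr p) \<in> borel_measurable borel"
    using f by measurable
  have "integrable lborel (\<lambda>x. indicator K x *\<^sub>R \<bar>f x\<bar> powr p)"
  proof (rule integrable_norm_powr_bound[OF s R(1) meas])
    fix x :: 'a assume x: "x \<noteq> 0" "norm x \<le> R"
    show "\<bar>indicator K x *\<^sub>R \<bar>f x\<bar> powr p\<bar> \<le> C * norm x powr (- s)"
      using C[OF x] order_trans[OF powr_ge_zero C[OF x]] by (cases "x \<in> K") auto
  next
    fix x :: 'a assume "R < norm x"
    then show "indicator K x *\<^sub>R \<bar>f x\<bar> powr p = 0" using R(2) by (cases "x \<in> K") auto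
  qed
  then show "set_integrable lebesgue K (\<lambda>x. \<bar>f x\<bar> powr p)"
    unfolding set_integrable_def using meas by (simp add: integrable_completion)
qed

context radial_emden
begin

text \<open>
  The derivative of \<open>x \<mapsto> u |x|\<close> at \<open>x \<noteq> 0\<close> in the direction \<open>b\<close>.
\<close>

definition radial_gradient :: "'a::euclidean_space \<Rightarrow> 'a \<Rightarrow> real" where
  "radial_gradient b x = deriv u (norm x) / norm x * (x \<bullet> b)"

text \<open>
  The mixed second derivative of \<open>x \<mapsto> u |x|\<close> in the directions \<open>b\<close> and \<open>c\<close>: the radial factor \<open>u'(|x|)/|x|\<close> of the
  gradient contributes the first summand.
\<close>

definition radial_hessian :: "'a::euclidean_space \<Rightarrow> 'a \<Rightarrow> 'a \<Rightarrow> real" where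
  "radial_hessian b c x = (deriv (deriv u) (norm x) / norm x - deriv u (norm x) / (norm x)\<^sup>2) * (x \<bullet> c / norm x) * (x \<bullet> b)
    + deriv u (norm x) / norm x * (c \<bullet> b)"

lemma has_derivative_radial:
  fixes x :: "'a::euclidean_space"
  assumes x: "x \<noteq> 0" and m: "(m has_real_derivative m') (at (norm x))"
  shows "((\<lambda>x. m (norm x)) has_derivative (\<lambda>h. m' * (x \<bullet> h / norm x))) (at x)"
proof -
  have "((\<lambda>x. m (norm x)) has_derivative (\<lambda>h. m' * (h \<bullet> sgn x))) (at x)"
    by (rule has_derivative_compose[OF has_derivative_norm[OF x]])
      (use m in \<open>simp add: has_field_derivative_def\<close>)
  moreover have "h \<bullet> sgn x = x \<bullet> h / norm x" for h
    by (simp add: sgn_div_norm inner_commute divide_inverse_commute)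
  ultimately show ?thesis by simp
qed

lemma has_derivative_radial_profile:
  fixes x :: "'a::euclidean_space"
  assumes x: "x \<noteq> 0"
  shows "((\<lambda>x. u (norm x)) has_derivative (\<lambda>h. radial_gradient h x)) (at x)"
  using has_derivative_radial[OF x deriv_u[of "norm x"]] x by (simp add: radial_gradient_def)

lemma has_derivative_radial_gradient:
  fixes x :: "'a::euclidean_space"
  assumes x: "x \<noteq> 0"
  shows "(radial_gradient b has_derivative (\<lambda>c. radial_hessian b c x)) (at x)"
proof -
  have nx: "0 < norm x" using x by simp
  have "((\<lambda>r. deriv u r / r) has_real_derivative
      (deriv (deriv u) (norm x) * norm x - deriv u (norm x) * 1) / (norm x * norm x)) (at (norm x))"
    by (rule DERIV_divide[OF deriv_u'[OF nx] DERIV_ident]) (use nx in simp)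
  moreover have "(deriv (deriv u) (norm x) * norm x - deriv u (norm x) * 1) / (norm x * norm x)
      = deriv (deriv u) (norm x) / norm x - deriv u (norm x) / (norm x)\<^sup>2"
    using nx by (simp add: field_simps power2_eq_square)
  ultimately have "((\<lambda>r. deriv u r / r) has_real_derivative
      (deriv (deriv u) (norm x) / norm x - deriv u (norm x) / (norm x)\<^sup>2)) (at (norm x))" by simp
  from has_derivative_radial[OF x this]
  have "((\<lambda>x. deriv u (norm x) / norm x) has_derivative (\<lambda>h.
      (deriv (deriv u) (norm x) / norm x - deriv u (norm x) / (norm x)\<^sup>2) * (x \<bullet> h / norm x))) (at x)" .
  moreover have "((\<lambda>x. x \<bullet> b) has_derivative (\<lambda>h. h \<bullet> b)) (at x)"
    by (intro has_derivative_inner_left has_derivative_ident)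
  ultimately have "((\<lambda>x. deriv u (norm x) / norm x * (x \<bullet> b)) has_derivative
      (\<lambda>h. deriv u (norm x) / norm x * (h \<bullet> b) +
        (deriv (deriv u) (norm x) / norm x - deriv u (norm x) / (norm x)\<^sup>2) * (x \<bullet> h / norm x) * (x \<bullet> b))) (at x)"
    by (rule has_derivative_mult)
  then show ?thesis unfolding radial_gradient_def[abs_def] radial_hessian_def by (simp only: add.commute)
qed

lemma continuous_norm_comp:
  fixes f :: "real \<Rightarrow> real"
  assumes "continuous_on {0<..} f"
  shows "continuous_on (- {0}) (\<lambda>x::'a::euclidean_space. f (norm x))"
proof (rule continuous_on_compose2[OF assms])
  show "continuous_on (- {0}) (norm :: 'a \<Rightarrow> real)" by (intro continuous_on_norm continuous_on_id)
qed auto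

lemma continuous_u: "continuous_on {0<..} u" "continuous_on {0<..} (deriv u)"
  by (rule DERIV_continuous_on[OF DERIV_subset[OF deriv_u]]; simp)
    (rule DERIV_continuous_on[OF DERIV_subset[OF deriv_u']]; simp)

lemma continuous_radial_derivatives:
  "continuous_on (- {0}) (\<lambda>x::'a::euclidean_space. u (norm x))"
  "continuous_on (- {0}) (radial_gradient b :: 'a::euclidean_space \<Rightarrow> real)"
  "continuous_on (- {0}) (radial_hessian b c :: 'a::euclidean_space \<Rightarrow> real)"
proof -
  show "continuous_on (- {0}) (\<lambda>x::'a::euclidean_space. u (norm x))"
    by (intro continuous_norm_comp continuous_u)
  show "continuous_on (- {0}) (radial_gradient b :: 'a::euclidean_space \<Rightarrow> real)"
    unfolding radial_gradient_def by (intro continuous_intros continuous_norm_comp continuous_u) auto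
  show "continuous_on (- {0}) (radial_hessian b c :: 'a::euclidean_space \<Rightarrow> real)"
    unfolding radial_hessian_def by (intro continuous_intros continuous_norm_comp continuous_u continuous_u'') auto
qed

lemma Ck_on_radial: "Ck_on 2 (- {0}) (\<lambda>x::'a::euclidean_space. u (norm x))"
proof -
  have op: "open (- {0 :: 'a})" by auto
  have "Ck_on (Suc 0) (- {0}) (partial_deriv b (\<lambda>x::'a. u (norm x)))" for b
  proof (rule Ck_on_cong[OF op])
    show "Ck_on (Suc 0) (- {0}) (radial_gradient b)"
      unfolding Ck_on.simps
    proof (intro conjI ballI)
      fix x :: 'a assume "x \<in> - {0}"
      then show "radial_gradient b differentiable at x" using has_derivative_radial_gradient differentiableI by blast
    next
      fix c :: 'a
      have "continuous_on (- {0}) (partial_deriv c (radial_gradient b)) = continuous_on (- {0}) (radial_hessian b c)"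
        by (rule continuous_on_cong) (auto simp: partial_deriv_eq[OF has_derivative_radial_gradient])
      then show "continuous_on (- {0}) (partial_deriv c (radial_gradient b))" using continuous_radial_derivatives(3) by blast
    qed
    show "radial_gradient b x = partial_deriv b (\<lambda>x. u (norm x)) x" if "x \<in> - {0}" for x :: 'a
      using that by (simp add: partial_deriv_eq[OF has_derivative_radial_profile])
  qed
  moreover have "(\<lambda>x::'a. u (norm x)) differentiable at x" if "x \<in> - {0}" for x
    using has_derivative_radial_profile[of x] that differentiableI by blast
  ultimately show ?thesis by (simp add: numeral_2_eq_2)
qed

lemma laplacian_radial:
  fixes x :: "'a::euclidean_space"
  assumes x: "x \<noteq> 0" and dim: "DIM('a) = N"
  shows "(\<Sum>b\<in>Basis. radial_hessian b b x) = - (\<bar>u (norm x)\<bar> powr \<alpha> * u (norm x))"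
proof -
  define r where "r = norm x"
  have r: "0 < r" using x by (simp add: r_def)
  have sq: "(\<Sum>b\<in>Basis. (x \<bullet> b) * (x \<bullet> b)) = r * r"
    using euclidean_inner[of x x] by (simp add: r_def dot_square_norm power2_eq_square)
  have one: "(\<Sum>b\<in>(Basis :: 'a set). b \<bullet> b) = N" using dim by simp
  have "(\<Sum>b\<in>Basis. radial_hessian b b x) =
    (\<Sum>b\<in>Basis. (deriv (deriv u) r / r - deriv u r / r\<^sup>2) / r * ((x \<bullet> b) * (x \<bullet> b)) + deriv u r / r * (b \<bullet> b))"
    by (intro sum.cong) (auto simp: radial_hessian_def r_def)
  also have "\<dots> = (deriv (deriv u) r / r - deriv u r / r\<^sup>2) / r * (r * r) + deriv u r / r * N"
    unfolding sum.distrib sum_distrib_left[symmetric] sq one by simp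
  also have "\<dots> = deriv (deriv u) r + (real N - 1) / r * deriv u r"
    using r by (simp add: field_simps power2_eq_square)
  also have "\<dots> = - (\<bar>u r\<bar> powr \<alpha> * u r)" unfolding equation[OF r] by simp
  finally show ?thesis by (simp add: r_def)
qed

text \<open>
  The orbit is bounded for \<open>t \<le> ln R\<close>. All three bounds are written in terms of \<open>r\<^bsup>-(2+2/\<alpha>)\<^esup>\<close>, the integrable power that
  dominates Green's identity; the third one uses \<open>(2/\<alpha>) (\<alpha> + 1) = 2 + 2/\<alpha>\<close>.
\<close>

lemma bounds_near_0:
  assumes "0 < R"
  shows "\<exists>A\<ge>0. \<forall>r. 0 < r \<longrightarrow> r \<le> R \<longrightarrow>
    \<bar>u r\<bar> \<le> A * r\<^sup>2 * r powr (- (2 + 2 / \<alpha>)) \<and>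
    \<bar>deriv u r\<bar> \<le> A * r * r powr (- (2 + 2 / \<alpha>)) \<and>
    \<bar>u r\<bar> powr (\<alpha> + 1) \<le> A * r powr (- (2 + 2 / \<alpha>))"
proof -
  have \<alpha>: "0 < \<alpha>" by (rule parameters)
  obtain M where M: "\<And>t. t \<le> ln R \<Longrightarrow> \<bar>w t\<bar> \<le> M" "\<And>t. t \<le> ln R \<Longrightarrow> \<bar>p t\<bar> \<le> M"
    using bounded_in_the_past[of "ln R"] by blast
  have M0: "0 \<le> M" using M(1)[of "ln R"] by linarith
  define A where "A = (1 + 2 / \<alpha>) * M + M powr (\<alpha> + 1)"
  have A: "M \<le> A" "(1 + 2 / \<alpha>) * M \<le> A" "M powr (\<alpha> + 1) \<le> A"
    using M0 \<alpha> by (auto simp: A_def distrib_right intro: add_nonneg_nonneg)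
  have pw: "r\<^sup>2 * r powr (- (2 + 2 / \<alpha>)) = r powr (- (2 / \<alpha>))"
    "r * r powr (- (2 + 2 / \<alpha>)) = r powr (- (2 / \<alpha> + 1))" if "0 < r" for r
  proof -
    have "r\<^sup>2 * r powr (- (2 + 2 / \<alpha>)) = r powr (2 + - (2 + 2 / \<alpha>))"
      unfolding powr_add using that by simp
    also have "2 + - (2 + 2 / \<alpha>) = - (2 / \<alpha>)" by simp
    finally show "r\<^sup>2 * r powr (- (2 + 2 / \<alpha>)) = r powr (- (2 / \<alpha>))" .
    have "r * r powr (- (2 + 2 / \<alpha>)) = r powr (1 + - (2 + 2 / \<alpha>))"
      unfolding powr_add using that by simp
    also have "1 + - (2 + 2 / \<alpha>) = - (2 / \<alpha> + 1)" by simp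
    finally show "r * r powr (- (2 + 2 / \<alpha>)) = r powr (- (2 / \<alpha> + 1))" .
  qed
  show ?thesis
  proof (intro exI[of _ A] conjI allI impI)
    show "0 \<le> A" using A(1) M0 by simp
    fix r assume r: "0 < r" "r \<le> R"
    then have ln: "ln r \<le> ln R" by simp
    have u: "\<bar>u r\<bar> = r powr (- (2 / \<alpha>)) * \<bar>w (ln r)\<bar>" using u_eq[OF r(1)] by (simp add: abs_mult)
    have "\<bar>u r\<bar> \<le> r powr (- (2 / \<alpha>)) * A"
      unfolding u using M(1)[OF ln] A(1) by (intro mult_left_mono) auto
    then show "\<bar>u r\<bar> \<le> A * r\<^sup>2 * r powr (- (2 + 2 / \<alpha>))"
      unfolding mult.assoc pw(1)[OF r(1)] by (simp only: mult.commute)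
    have "deriv u r = r powr (- (2 / \<alpha> + 1)) * (p (ln r) - 2 / \<alpha> * w (ln r))"
    proof -
      have "r powr (- c) * (r powr c * y) = y" for c y :: real
        using r(1) by (simp add: powr_minus)
      then show ?thesis unfolding p_ln[OF r(1), symmetric] by (rule sym)
    qed
    then have "\<bar>deriv u r\<bar> = r powr (- (2 / \<alpha> + 1)) * \<bar>p (ln r) - 2 / \<alpha> * w (ln r)\<bar>"
      by (simp add: abs_mult)
    also have "\<dots> \<le> r powr (- (2 / \<alpha> + 1)) * A"
    proof (rule mult_left_mono)
      have "\<bar>2 / \<alpha> * w (ln r)\<bar> \<le> 2 / \<alpha> * M"
        unfolding abs_mult using M(1)[OF ln] \<alpha> by (intro mult_mono) auto
      then have "\<bar>p (ln r) - 2 / \<alpha> * w (ln r)\<bar> \<le> M + 2 / \<alpha> * M"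
        using M(2)[OF ln] abs_triangle_ineq4[of "p (ln r)" "2 / \<alpha> * w (ln r)"] by linarith
      then show "\<bar>p (ln r) - 2 / \<alpha> * w (ln r)\<bar> \<le> A" using A(2) by (simp add: distrib_right)
    qed simp
    finally show "\<bar>deriv u r\<bar> \<le> A * r * r powr (- (2 + 2 / \<alpha>))"
      unfolding mult.assoc pw(2)[OF r(1)] by (simp only: mult.commute)
    have "\<bar>u r\<bar> powr (\<alpha> + 1) = (r powr (- (2 / \<alpha>))) powr (\<alpha> + 1) * \<bar>w (ln r)\<bar> powr (\<alpha> + 1)"
      unfolding u by (rule powr_mult)
    also have "(r powr (- (2 / \<alpha>))) powr (\<alpha> + 1) = r powr (- (2 + 2 / \<alpha>))"
      unfolding powr_powr by (rule arg_cong[where f = "(powr) r"]) (use \<alpha> in \<open>simp add: field_simps\<close>)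
    also have "r powr (- (2 + 2 / \<alpha>)) * \<bar>w (ln r)\<bar> powr (\<alpha> + 1) \<le> r powr (- (2 + 2 / \<alpha>)) * A"
      using M(1)[OF ln] \<alpha> by (intro mult_left_mono order_trans[OF powr_mono2 A(3)]) auto
    finally show "\<bar>u r\<bar> powr (\<alpha> + 1) \<le> A * r powr (- (2 + 2 / \<alpha>))" by (simp only: mult.commute)
  qed
qed

end

section \<open>The equation in the sense of distributions\<close>

lemma abs_powr_mult_self: "\<bar>\<bar>x\<bar> powr a * x\<bar> = \<bar>x\<bar> powr (a + 1)" for x a :: real
  by (cases "x = 0") (auto simp: abs_mult powr_add)

lemma test_functionE:
  fixes \<phi> :: "'a::euclidean_space \<Rightarrow> real"
  assumes "test_function \<phi>"
  obtains R where "0 < R" "\<And>x. R < norm x \<Longrightarrow> \<phi> x = 0"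
    "\<And>x b. R < norm x \<Longrightarrow> partial_deriv b \<phi> x = 0"
    "\<And>x b. R < norm x \<Longrightarrow> partial_deriv b (partial_deriv b \<phi>) x = 0"
proof -
  have "bounded (closure {x. \<phi> x \<noteq> 0})"
    by (rule compact_imp_bounded) (use assms in \<open>simp add: test_function_def\<close>)
  then obtain R where R: "0 < R" "\<And>x. x \<in> closure {x. \<phi> x \<noteq> 0} \<Longrightarrow> norm x \<le> R"
    unfolding bounded_pos by blast
  have 0: "\<phi> x = 0" if "R < norm x" for x
  proof (rule ccontr)
    assume "\<phi> x \<noteq> 0"
    then have "x \<in> closure {x. \<phi> x \<noteq> 0}" by (intro subsetD[OF closure_subset]) simp
    then show False using R(2)[of x] that by simp
  qed
  have 1: "partial_deriv b \<phi> x = 0" if "R < norm x" for x b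
    by (rule partial_deriv_outside_support[OF 0 that])
  have 2: "partial_deriv b (partial_deriv b \<phi>) x = 0" if "R < norm x" for x b
    by (rule partial_deriv_outside_support[OF 1 that])
  show thesis by (rule that[OF R(1) 0 1 2])
qed

lemma test_function_derivatives:
  fixes \<phi> :: "'a::euclidean_space \<Rightarrow> real"
  assumes "test_function \<phi>"
  shows "\<phi> differentiable at x" and "continuous_on UNIV \<phi>"
    and "b \<in> Basis \<Longrightarrow> partial_deriv b \<phi> differentiable at x"
    and "b \<in> Basis \<Longrightarrow> continuous_on UNIV (partial_deriv b \<phi>)"
    and "b \<in> Basis \<Longrightarrow> continuous_on UNIV (partial_deriv b (partial_deriv b \<phi>))"
proof -
  have "Ck_on (Suc (Suc 0)) UNIV \<phi>" using assms unfolding test_function_def by blast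
  then have d: "\<And>x. \<phi> differentiable at x" "\<And>b x. b \<in> Basis \<Longrightarrow> partial_deriv b \<phi> differentiable at x"
    "\<And>b. b \<in> Basis \<Longrightarrow> continuous_on UNIV (partial_deriv b (partial_deriv b \<phi>))"
    by simp_all
  have cont: "continuous_on UNIV f" if "\<And>x. f differentiable at x" for f :: "'a \<Rightarrow> real"
    using that by (intro continuous_at_imp_continuous_on ballI differentiable_imp_continuous_within)
  show "\<phi> differentiable at x" "continuous_on UNIV \<phi>"
    "b \<in> Basis \<Longrightarrow> partial_deriv b \<phi> differentiable at x"
    "b \<in> Basis \<Longrightarrow> continuous_on UNIV (partial_deriv b \<phi>)"
    "b \<in> Basis \<Longrightarrow> continuous_on UNIV (partial_deriv b (partial_deriv b \<phi>))"
    using d cont by blast+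
qed

context radial_emden
begin

text \<open>
  The bounds near the origin make \<open>green_punctured\<close> applicable with \<open>s = 2 + 2/\<alpha>\<close>, which is smaller than the
  dimension because \<open>\<gamma> > 0\<close>; off the origin the Laplacian of \<open>U\<close> is given by the radial equation.
\<close>

lemma weak_solution:
  fixes U :: "'a::euclidean_space \<Rightarrow> real"
  assumes dim: "DIM('a) = N" and U: "\<And>x. x \<noteq> 0 \<Longrightarrow> U x = u (norm x)"
  shows "Ck_on 2 (- {0}) U" "Lp_loc (\<alpha> + 1) U" "minus_laplacian_distr U (\<lambda>x. \<bar>U x\<bar> powr \<alpha> * U x)"
proof -
  define s where "s = 2 + 2 / \<alpha>"
  have s: "0 \<le> s" "s < DIM('a)" using parameters dim by (auto simp: s_def)
  have U_meas [measurable]: "U \<in> borel_measurable borel"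
    by (rule borel_measurable_punctured[OF continuous_radial_derivatives(1) U])
  have f_meas: "(\<lambda>x. \<bar>U x\<bar> powr \<alpha> * U x) \<in> borel_measurable borel" by measurable
  show "Ck_on 2 (- {0}) U"
    by (rule Ck_on_cong[OF _ _ Ck_on_radial]) (auto simp: U)
  have U_bound: "\<exists>C. \<forall>x. x \<noteq> 0 \<longrightarrow> norm x \<le> R \<longrightarrow> \<bar>U x\<bar> powr (\<alpha> + 1) \<le> C * norm x powr (- s)" if "0 < R" for R
  proof -
    obtain A where "\<forall>r. 0 < r \<longrightarrow> r \<le> R \<longrightarrow> \<bar>u r\<bar> powr (\<alpha> + 1) \<le> A * r powr (- (2 + 2 / \<alpha>))"
      using bounds_near_0[OF \<open>0 < R\<close>] by metis
    then have "\<forall>x. x \<noteq> 0 \<longrightarrow> norm x \<le> R \<longrightarrow> \<bar>U x\<bar> powr (\<alpha> + 1) \<le> A * norm x powr (- s)"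
      unfolding s_def using U by simp
    then show ?thesis by blast
  qed
  show Lp: "Lp_loc (\<alpha> + 1) U"
    by (rule Lp_loc_if_norm_powr_bound[OF s U_meas U_bound])
  have "Lp_loc 1 (\<lambda>x. \<bar>U x\<bar> powr \<alpha> * U x)"
    by (rule Lp_loc_if_norm_powr_bound[OF s f_meas]) (use U_bound in \<open>simp add: abs_powr_mult_self\<close>)
  moreover have "Lp_loc 1 U"
  proof (rule Lp_loc_if_norm_powr_bound[OF s U_meas])
    fix R :: real assume "0 < R"
    obtain A where A: "0 \<le> A" "\<And>r. 0 < r \<Longrightarrow> r \<le> R \<Longrightarrow> \<bar>u r\<bar> \<le> A * r\<^sup>2 * r powr (- (2 + 2 / \<alpha>))"
      using bounds_near_0[OF \<open>0 < R\<close>] by metis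
    have "\<bar>U x\<bar> powr 1 \<le> (A * R\<^sup>2) * norm x powr (- s)" if x: "x \<noteq> 0" "norm x \<le> R" for x
    proof -
      have "\<bar>U x\<bar> \<le> A * (norm x)\<^sup>2 * norm x powr (- s)"
        unfolding s_def U[OF x(1)] using A(2)[of "norm x"] x by simp
      also have "\<dots> \<le> A * R\<^sup>2 * norm x powr (- s)"
        using A(1) x by (intro mult_right_mono mult_left_mono power_mono) auto
      finally show ?thesis by simp
    qed
    then show "\<exists>C. \<forall>x. x \<noteq> 0 \<longrightarrow> norm x \<le> R \<longrightarrow> \<bar>U x\<bar> powr 1 \<le> C * norm x powr (- s)" by blast
  qed
  moreover have "(LINT x|lebesgue. U x * (- laplacian \<phi> x)) = (LINT x|lebesgue. \<bar>U x\<bar> powr \<alpha> * U x * \<phi> x)"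
    if \<phi>: "test_function \<phi>" for \<phi>
  proof -
    note d = test_function_derivatives[OF \<phi>]
    obtain R where R: "0 < R" and supp: "\<And>x. R < norm x \<Longrightarrow> \<phi> x = 0"
      "\<And>x b. R < norm x \<Longrightarrow> partial_deriv b \<phi> x = 0"
      "\<And>x b. R < norm x \<Longrightarrow> partial_deriv b (partial_deriv b \<phi>) x = 0"
      using test_functionE[OF \<phi>] by blast
    obtain A where A: "0 \<le> A"
      "\<And>r. 0 < r \<Longrightarrow> r \<le> R \<Longrightarrow> \<bar>u r\<bar> \<le> A * r\<^sup>2 * r powr (- s)"
      "\<And>r. 0 < r \<Longrightarrow> r \<le> R \<Longrightarrow> \<bar>deriv u r\<bar> \<le> A * r * r powr (- s)"
      "\<And>r. 0 < r \<Longrightarrow> r \<le> R \<Longrightarrow> \<bar>u r\<bar> powr (\<alpha> + 1) \<le> A * r powr (- s)"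
      using bounds_near_0[OF R] unfolding s_def by metis
    define D where "D x = (\<Sum>b\<in>Basis. partial_deriv b (partial_deriv b \<phi>) x)" for x
    have green: "(LINT x|lborel. (if x = 0 then 0 else u (norm x) * (\<Sum>b\<in>Basis. partial_deriv b (partial_deriv b \<phi>) x)
        - \<phi> x * (\<Sum>b\<in>Basis. radial_hessian b b x))) = 0"
    proof (rule green_punctured[OF s R])
      fix x b :: 'a assume x: "x \<noteq> 0"
      show "((\<lambda>t. u (norm (x + t *\<^sub>R b))) has_real_derivative radial_gradient b x) (at 0)"
        using has_real_derivative_along_line[OF has_derivative_radial_profile[OF x]] by simp
      show "((\<lambda>t. radial_gradient b (x + t *\<^sub>R b)) has_real_derivative radial_hessian b b x) (at 0)"
        using has_real_derivative_along_line[OF has_derivative_radial_gradient[OF x]] by simp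
    next
      fix x b :: 'a assume b: "b \<in> Basis"
      show "((\<lambda>t. \<phi> (x + t *\<^sub>R b)) has_real_derivative partial_deriv b \<phi> x) (at 0)"
        by (rule differentiable_along_line[OF d(1)])
      show "((\<lambda>t. partial_deriv b \<phi> (x + t *\<^sub>R b)) has_real_derivative partial_deriv b (partial_deriv b \<phi>) x) (at 0)"
        by (rule differentiable_along_line[OF d(3)[OF b]])
    next
      fix x b :: 'a assume x: "x \<noteq> 0" "norm x \<le> R" and b: "b \<in> Basis"
      have "\<bar>radial_gradient b x\<bar> = \<bar>deriv u (norm x)\<bar> * (\<bar>x \<bullet> b\<bar> / norm x)" by (simp add: radial_gradient_def abs_mult)
      also have "\<dots> \<le> \<bar>deriv u (norm x)\<bar> * 1"
        using Basis_le_norm[OF b, of x] x by (intro mult_left_mono) auto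
      also have "\<dots> \<le> A * norm x * norm x powr (- s)" using A(3)[of "norm x"] x by simp
      finally show "\<bar>radial_gradient b x\<bar> \<le> A * norm x * norm x powr (- s)" .
    next
      fix x :: 'a assume x: "x \<noteq> 0" "norm x \<le> R"
      show "\<bar>u (norm x)\<bar> \<le> A * (norm x)\<^sup>2 * norm x powr (- s)" using A(2)[of "norm x"] x by simp
      show "\<bar>\<Sum>b\<in>Basis. radial_hessian b b x\<bar> \<le> A * norm x powr (- s)"
        unfolding laplacian_radial[OF x(1) dim] abs_minus_cancel abs_powr_mult_self
        using A(4)[of "norm x"] x by simp
    qed (use d supp continuous_radial_derivatives in auto)
    have D_cont: "continuous_on UNIV D"
      unfolding D_def by (intro continuous_on_sum d(5))
    obtain M where M: "\<And>x. \<bar>\<phi> x\<bar> \<le> M"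
      using bounded_if_compact_support[OF d(2) supp(1)] by blast
    obtain M' where M': "\<And>x. \<bar>D x\<bar> \<le> M'"
      using bounded_if_compact_support[OF D_cont, of R] supp(3) by (auto simp: D_def)
    have [measurable]: "\<phi> \<in> borel_measurable borel" "D \<in> borel_measurable borel"
      using d(2) D_cont by (auto intro: borel_measurable_continuous_onI)
    have meas: "(\<lambda>x. U x * D x) \<in> borel_measurable borel" "(\<lambda>x. \<bar>U x\<bar> powr \<alpha> * U x * \<phi> x) \<in> borel_measurable borel"
      by measurable
    have int1: "integrable lborel (\<lambda>x. U x * D x)"
    proof (rule integrable_norm_powr_bound[OF s R meas(1)])
      fix x :: 'a assume x: "x \<noteq> 0" "norm x \<le> R"
      have "\<bar>U x * D x\<bar> \<le> (A * (norm x)\<^sup>2 * norm x powr (- s)) * M'"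
        unfolding abs_mult U[OF x(1)] using A(1) A(2)[of "norm x"] x M' by (intro mult_mono) auto
      also have "\<dots> \<le> (A * R\<^sup>2 * norm x powr (- s)) * M'"
        using A(1) x order_trans[OF abs_ge_zero M'[of x]] by (intro mult_right_mono mult_left_mono power_mono) auto
      finally show "\<bar>U x * D x\<bar> \<le> (A * R\<^sup>2 * M') * norm x powr (- s)" by (simp only: mult_ac)
    qed (simp add: D_def supp)
    have int2: "integrable lborel (\<lambda>x. \<bar>U x\<bar> powr \<alpha> * U x * \<phi> x)"
    proof (rule integrable_norm_powr_bound[OF s R meas(2)])
      fix x :: 'a assume x: "x \<noteq> 0" "norm x \<le> R"
      have "\<bar>\<bar>U x\<bar> powr \<alpha> * U x * \<phi> x\<bar> \<le> (A * norm x powr (- s)) * M"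
        unfolding abs_mult[of _ "\<phi> x"] abs_powr_mult_self U[OF x(1)]
        using A(1) A(4)[of "norm x"] x M by (intro mult_mono) auto
      then show "\<bar>\<bar>U x\<bar> powr \<alpha> * U x * \<phi> x\<bar> \<le> (A * M) * norm x powr (- s)" by (simp only: mult_ac)
    qed (simp add: supp)
    have "(LINT x|lborel. U x * D x + \<bar>U x\<bar> powr \<alpha> * U x * \<phi> x) = (LINT x|lborel. (if x = 0 then 0 else u (norm x) * (\<Sum>b\<in>Basis. partial_deriv b (partial_deriv b \<phi>) x)
        - \<phi> x * (\<Sum>b\<in>Basis. radial_hessian b b x)))"
    proof (rule integral_cong_AE)
      let ?g = "\<lambda>x::'a. if x = 0 then 0 else u (norm x) * (\<Sum>b\<in>Basis. partial_deriv b (partial_deriv b \<phi>) x)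
        - \<phi> x * (\<Sum>b\<in>Basis. radial_hessian b b x)"
      have "?g \<in> borel_measurable borel"
      proof (rule borel_measurable_punctured)
        show "continuous_on (- {0}) (\<lambda>x. u (norm x) * D x - \<phi> x * (\<Sum>b\<in>Basis. radial_hessian b b x))"
          by (intro continuous_intros continuous_radial_derivatives continuous_on_subset[OF D_cont]
              continuous_on_subset[OF d(2)]) auto
      qed (simp add: D_def)
      then show "?g \<in> borel_measurable lborel" by simp
      show "AE x in lborel. U x * D x + \<bar>U x\<bar> powr \<alpha> * U x * \<phi> x = ?g x"
        using AE_lborel_neq[of 0]
      proof eventually_elim
        fix x :: 'a assume x: "x \<noteq> 0"
        show "U x * D x + \<bar>U x\<bar> powr \<alpha> * U x * \<phi> x = ?g x"
          unfolding laplacian_radial[OF x dim] U[OF x] D_def using x by simp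
      qed
    qed (use meas in simp)
    then have "(LINT x|lborel. U x * D x) + (LINT x|lborel. \<bar>U x\<bar> powr \<alpha> * U x * \<phi> x) = 0"
      using green int1 int2 by simp
    moreover have "(LINT x|lebesgue. U x * (- laplacian \<phi> x)) = - (LINT x|lborel. U x * D x)"
      using meas(1) by (simp add: laplacian_def D_def[symmetric] integral_completion)
    moreover have "(LINT x|lebesgue. \<bar>U x\<bar> powr \<alpha> * U x * \<phi> x) = (LINT x|lborel. \<bar>U x\<bar> powr \<alpha> * U x * \<phi> x)"
      using meas(2) by (simp add: integral_completion)
    ultimately show ?thesis by simp
  qed
  ultimately show "minus_laplacian_distr U (\<lambda>x. \<bar>U x\<bar> powr \<alpha> * U x)"
    unfolding minus_laplacian_distr_def by blast
qed

end

section \<open>The proposition\<close>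

theorem proposition6p1:
  fixes N :: nat and \<alpha> \<beta> :: real and u :: "real \<Rightarrow> real" and U :: "real ^ 'n \<Rightarrow> real"
  assumes N_def: "N = CARD('n)" and N_ge: "N \<ge> 3"
    and alpha_gt: "2 / (real N - 2) < \<alpha>" and alpha_lt: "\<alpha> < 4 / (real N - 2)"
    and beta_eq: "\<beta> = beta N \<alpha>"
    and solution: "radial_solution N \<alpha> u"
    and nonzero: "\<exists>r>0. u r \<noteq> 0"
    and U_eq: "\<And>x. x \<noteq> 0 \<Longrightarrow> U x = u (norm x)"
  shows
    "\<comment> \<open>(i)\<close>
     ((\<exists>C. \<forall>r>1. \<bar>u r\<bar> \<le> C * r powr (- (real N - 2 - 2 / \<alpha>))) \<and>
     (finite_limit_at_0 u \<or>
       (\<exists>\<sigma>\<in>{1, -1}. ((\<lambda>r. r powr (2 / \<alpha>) * u r) \<longlongrightarrow> \<sigma> * \<beta> powr (1 / \<alpha>)) (at_right 0))) \<and>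
     (finite_limit_at_0 u \<longrightarrow> (deriv u \<longlongrightarrow> 0) (at_right 0)) \<and>
     (\<forall>\<sigma>\<in>{1, -1}.
       ((\<lambda>r. r powr (2 / \<alpha>) * u r) \<longlongrightarrow> \<sigma> * \<beta> powr (1 / \<alpha>)) (at_right 0) \<longrightarrow>
       ((\<lambda>r. r powr (2 / \<alpha> + 1) * deriv u r)
          \<longlongrightarrow> - \<sigma> * (2 / \<alpha>) * \<beta> powr (1 / \<alpha>)) (at_right 0))) \<and>
     \<comment> \<open>(ii)\<close>
     ((regular u \<or> (constant_sign u \<and> singular u) \<or> (singular u \<and> changes_sign_on {0<..} u)) \<and>
     (regular u \<longrightarrow> oscillates_at_infinity u) \<and>
     (constant_sign u \<and> singular u \<longleftrightarrow>
       (\<exists>\<sigma>\<in>{1, -1}.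
         (\<forall>r>0. u r = \<sigma> * \<beta> powr (1 / \<alpha>) * r powr (- (2 / \<alpha>))) \<or>
         (\<exists>\<mu>>0. is_u_lambda N \<alpha> \<mu> (\<lambda>r. \<sigma> * u r)))) \<and>
     (singular u \<and> changes_sign_on {0<..} u \<longrightarrow>
       (\<exists>\<sigma>\<in>{1, -1}. ((\<lambda>r. r powr (2 / \<alpha>) * u r) \<longlongrightarrow> \<sigma> * \<beta> powr (1 / \<alpha>)) (at_right 0)) \<and>
       oscillates_at_infinity u)) \<and>
     \<comment> \<open>(iii)\<close>
     (singular u \<and> changes_sign_on {0<..} u \<longleftrightarrow>
     (\<exists>r\<^sub>0>0. r\<^sub>0\<^sup>2 / 2 * \<bar>deriv u r\<^sub>0\<bar>\<^sup>2 + 2 / \<alpha> * r\<^sub>0 * u r\<^sub>0 * deriv u r\<^sub>0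
        + 1 / (\<alpha> + 2) * r\<^sub>0\<^sup>2 * \<bar>u r\<^sub>0\<bar> powr (\<alpha> + 2)
        + (4 - (real N - 2) * \<alpha>) / \<alpha>\<^sup>2 * \<bar>u r\<^sub>0\<bar>\<^sup>2 = 0)) \<and>
     \<comment> \<open>(iv)\<close>
     (Ck_on 2 (- {0}) U \<and> Lp_loc (\<alpha> + 1) U \<and>
     minus_laplacian_distr U (\<lambda>x. \<bar>U x\<bar> powr \<alpha> * U x))"
proof -
  interpret radial_emden N \<alpha> u
    using N_ge alpha_gt alpha_lt solution by unfold_locales
  have beta_k: "\<beta> powr (1 / \<alpha>) = k" unfolding k_eq beta_eq ..
  obtain r where r: "0 < r" "u r \<noteq> 0" using nonzero by blast
  have nonzero_w: "w (ln r) \<noteq> 0" using sign_w(3)[of "ln r"] r by simp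
  have limit_iff: "((\<lambda>r. r powr (2 / \<alpha>) * u r) \<longlongrightarrow> \<sigma> * \<beta> powr (1 / \<alpha>)) (at_right 0) \<longleftrightarrow>
      (w \<longlongrightarrow> \<sigma> * k) at_bot" for \<sigma>
    unfolding beta_k tendsto_w_iff ..
  have singular_limit: "\<exists>\<sigma>\<in>{1, -1}. ((\<lambda>r. r powr (2 / \<alpha>) * u r) \<longlongrightarrow> \<sigma> * \<beta> powr (1 / \<alpha>)) (at_right 0)"
    if "singular u"
    using that unfolding singular_iff limit_iff by simp
  have zero_energy_iff: "(\<exists>r\<^sub>0>0. r\<^sub>0\<^sup>2 / 2 * \<bar>deriv u r\<^sub>0\<bar>\<^sup>2 + 2 / \<alpha> * r\<^sub>0 * u r\<^sub>0 * deriv u r\<^sub>0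
        + 1 / (\<alpha> + 2) * r\<^sub>0\<^sup>2 * \<bar>u r\<^sub>0\<bar> powr (\<alpha> + 2)
        + (4 - (real N - 2) * \<alpha>) / \<alpha>\<^sup>2 * \<bar>u r\<^sub>0\<bar>\<^sup>2 = 0) \<longleftrightarrow> (\<exists>t. energy t = 0)" (is "?L \<longleftrightarrow> ?R")
  proof
    assume ?L
    then obtain r0 where r0: "0 < r0" "r0\<^sup>2 / 2 * \<bar>deriv u r0\<bar>\<^sup>2 + 2 / \<alpha> * r0 * u r0 * deriv u r0
        + 1 / (\<alpha> + 2) * r0\<^sup>2 * \<bar>u r0\<bar> powr (\<alpha> + 2)
        + (4 - (real N - 2) * \<alpha>) / \<alpha>\<^sup>2 * \<bar>u r0\<bar>\<^sup>2 = 0" by blast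
    then have "energy (ln r0) = 0" unfolding energy_ln[OF r0(1)] by (simp only: mult_zero_right)
    then show ?R by blast
  next
    assume ?R
    then obtain t where t: "energy (ln (exp t)) = 0" by auto
    have "exp t powr (4 / \<alpha>) \<noteq> 0" by simp
    then show ?L
      using t unfolding energy_ln[OF exp_gt_zero] mult_eq_0_iff[of "exp t powr (4 / \<alpha>)"]
      by (intro exI[of _ "exp t"]) (simp only: exp_gt_zero simp_thms)
  qed
  have zero_energy_imp_oscillates: "oscillates_at_infinity u" if "energy t = 0" for t
    by (rule positive_energy_imp_oscillates_at_infinity[of "t + 1"])
      (rule zero_energy_imp_positive_energy[OF that nonzero_w], simp)
  have part_iii: "singular u \<and> changes_sign_on {0<..} u \<longleftrightarrow> (\<exists>t. energy t = 0)"
  proof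
    assume "singular u \<and> changes_sign_on {0<..} u"
    then show "\<exists>t. energy t = 0"
      using not_constant_sign_imp_zero_energy changes_sign_imp_not_constant_sign by blast
  next
    assume "\<exists>t. energy t = 0"
    then obtain t where t: "energy t = 0" by blast
    show "singular u \<and> changes_sign_on {0<..} u"
      using zero_energy_imp_singular[OF t nonzero_w] oscillates_imp_changes_sign[OF zero_energy_imp_oscillates[OF t]]
      by blast
  qed
  have regular_oscillates: "oscillates_at_infinity u" if "regular u"
    using that vanishing_imp_energy_pos[OF _ nonzero_w] positive_energy_imp_oscillates_at_infinity
    unfolding regular_iff finite_limit_iff by blast
  have singular_or_regular: "regular u \<or> singular u" unfolding regular_iff singular_def by blast
  have trichotomy: "regular u \<or> (constant_sign u \<and> singular u) \<or> (singular u \<and> changes_sign_on {0<..} u)"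
    using singular_or_regular not_constant_sign_imp_zero_energy part_iii by blast
  have derivative_limit: "((\<lambda>r. r powr (2 / \<alpha> + 1) * deriv u r)
      \<longlongrightarrow> - \<sigma> * (2 / \<alpha>) * \<beta> powr (1 / \<alpha>)) (at_right 0)"
    if "((\<lambda>r. r powr (2 / \<alpha>) * u r) \<longlongrightarrow> \<sigma> * \<beta> powr (1 / \<alpha>)) (at_right 0)" for \<sigma>
  proof -
    have "- (2 / \<alpha> * (\<sigma> * k)) = - \<sigma> * (2 / \<alpha>) * \<beta> powr (1 / \<alpha>)" unfolding beta_k by simp
    with tendsto_u'[OF that[unfolded limit_iff]] show ?thesis by (simp only:)
  qed
  have iv: "Ck_on 2 (- {0}) U \<and> Lp_loc (\<alpha> + 1) U \<and> minus_laplacian_distr U (\<lambda>x. \<bar>U x\<bar> powr \<alpha> * U x)"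
    using weak_solution[of U] N_def U_eq by simp
  show ?thesis
    unfolding zero_energy_iff
    using bound_at_infinity singular_limit finite_limit_imp_tendsto_u' derivative_limit trichotomy
      regular_oscillates constant_sign_singular_iff[folded beta_eq] part_iii zero_energy_imp_oscillates iv
    unfolding singular_def by blast
qed

end
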